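(* Let $\mathcal A$ be a session automaton over $\Sigma$ and $D$. Let $k$ be the least number such that $\mathit{snf}(L(\mathcal A))\subseteq(\Sigma\times\Gamma_k)^*$, and let $N$ be the number of states of the minimal (complete) deterministic finite automaton over $\Sigma\times\Gamma_k$ recognizing $\mathit{snf}(L(\mathcal A))$ (the canonical session automaton of $\mathcal A$). There is a learning algorithm which, interacting with a teacher for $L(\mathcal A)$ that answers membership queries (given a data word $w$, whether $w\in L(\mathcal A)$) and equivalence queries (given a hypothesis session automaton $\mathcal H$, either "yes" if $L(\mathcal H)=L(\mathcal A)$, or a data word in the symmetric difference of $L(\mathcal H)$ and $L(\mathcal A)$), terminates and outputs a session automaton recognizing $L(\mathcal A)$ (namely the canonical session automaton), using at most $O(k|\Sigma|N^2+N\log M)$ membership queries and $O(N)$ equivalence queries, where $M$ is the length of the longest counterexample returned by an equivalence query.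
   Context: $\Sigma$ is a non-empty finite alphabet, $D$ an infinite set of data values; data words are elements of $(\Sigma\times D)^*$. A session automaton $(S,\mathcal R,\iota,F,\Delta)$ with $\mathcal R=\{1,\dots,k\}$ has finite non-empty state set $S$, initial state $\iota$, final states $F$, and finitely many transitions $(s,(a,\pi),s')$ with $a\in\Sigma$, $\pi\in\Gamma_k=\{r^\circledast,r^\uparrow:r\in\{1,\dots,k\}\}$; configurations $(s,\tau,U)$ with $\tau:\mathcal R\rightharpoonup D$ partial, $U\subseteq D$; reading $(a,d)$ on register $r$ requires $d=\tau(r)$ for $r^\uparrow$ and $d\notin U$ for $r^\circledast$, then sets $\tau(r):=d$, $U:=U\cup\{d\}$; runs start in $(\iota,\emptyset,\emptyset)$ and $L(\mathcal A)$ is the set of data words with a run ending in $F$. A session automaton can equally be read as a finite automaton over the finite alphabet $\Sigma\times\Gamma_k$. Let $\Gamma=\{r^\circledast,r^\uparrow:r\in\mathbb N_{>0}\}$, $\mathrm{reg}(r^\circledast)=\mathrm{reg}(r^\uparrow)=r$. For $w=(a_1,d_1)\cdots(a_n,d_n)$, with $\mathrm{first}_w(d),\mathrm{last}_w(d)$ the first and last positions carrying $d$, the symbolic normal form $\mathit{snf}(w)=(a_1,\pi_1)\cdots(a_n,\pi_n)\in(\Sigma\times\Gamma)^*$ is defined with $\mathit{Free}(0)=\mathbb N_{>0}$; $\pi_i=(\min\mathit{Free}(i-1))^\circledast$ if $i=\mathrm{first}_w(d_i)$, else $\pi_i=(\mathrm{reg}(\pi_{\mathrm{first}_w(d_i)}))^\uparrow$;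 $\mathit{Free}(i)=\mathit{Free}(i-1)\setminus\{\min\mathit{Free}(i-1)\}$ if $i=\mathrm{first}_w(d_i)\ne\mathrm{last}_w(d_i)$, $\mathit{Free}(i-1)\cup\{\mathrm{reg}(\pi_i)\}$ if $i=\mathrm{last}_w(d_i)$, $\mathit{Free}(i-1)$ otherwise. $\mathit{snf}(L)=\{\mathit{snf}(w)\mid w\in L\}$; for a session automaton with $k$ registers, $\mathit{snf}(L(\mathcal A))$ is a regular language over $\Sigma\times\Gamma_k$. *)

theory Defs
  imports Complex_Main
begin

section \<open>Session automata\<close>

text \<open>
  \<open>Fresh r\<close> is the operation written $r^\circledast$, \<open>Reuse r\<close> the one written $r^\uparrow$.
\<close>

datatype reg_op = Fresh (reg: nat) | Reuse (reg: nat)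

definition Gam :: "nat \<Rightarrow> reg_op set" where
  "Gam k = {\<pi>. 1 \<le> reg \<pi> \<and> reg \<pi> \<le> k}"

record ('s, 'a) session_automaton =
  states :: "'s set"
  registers :: nat
  initial :: 's
  finals :: "'s set"
  transitions :: "('s \<times> ('a \<times> reg_op) \<times> 's) set"

definition session_automaton :: "'a set \<Rightarrow> ('s, 'a) session_automaton \<Rightarrow> bool" where
  "session_automaton \<Sigma> A \<longleftrightarrow>
     finite (states A) \<and> initial A \<in> states A \<and> finals A \<subseteq> states A \<and>
     finite (transitions A) \<and>
     transitions A \<subseteq> states A \<times> (\<Sigma> \<times> Gam (registers A)) \<times> states A"

type_synonym ('s, 'd) config = "'s \<times> (nat \<rightharpoonup> 'd) \<times> 'd set"

inductive step ::
  "('s, 'a) session_automaton \<Rightarrow> ('s, 'd) config \<Rightarrow> 'a \<times> 'd \<Rightarrow> ('s, 'd) config \<Rightarrow> bool"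
  for A where
  fresh: "(s, (a, Fresh r), s') \<in> transitions A \<Longrightarrow> d \<notin> U \<Longrightarrow>
     step A (s, \<tau>, U) (a, d) (s', \<tau>(r \<mapsto> d), insert d U)"
| reuse: "(s, (a, Reuse r), s') \<in> transitions A \<Longrightarrow> \<tau> r = Some d \<Longrightarrow>
     step A (s, \<tau>, U) (a, d) (s', \<tau>(r \<mapsto> d), insert d U)"

fun run ::
  "('s, 'a) session_automaton \<Rightarrow> ('s, 'd) config \<Rightarrow> ('a \<times> 'd) list \<Rightarrow> ('s, 'd) config \<Rightarrow> bool"
where
  "run A c [] c' \<longleftrightarrow> c = c'"
| "run A c (x # w) c' \<longleftrightarrow> (\<exists>c''. step A c x c'' \<and> run A c'' w c')"

definition data_lang ::
  "'a set \<Rightarrow> 'd set \<Rightarrow> ('s, 'a) session_automaton \<Rightarrow> ('a \<times> 'd) list set" where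
  "data_lang \<Sigma> D A =
     {w \<in> lists (\<Sigma> \<times> D). \<exists>s \<tau> U. run A (initial A, Map.empty, {}) w (s, \<tau>, U) \<and> s \<in> finals A}"

text \<open>A session automaton read as a finite automaton over the alphabet \<open>\<Sigma> \<times> Gam k\<close>.\<close>

fun sym_path ::
  "('s, 'a) session_automaton \<Rightarrow> 's \<Rightarrow> ('a \<times> reg_op) list \<Rightarrow> 's \<Rightarrow> bool" where
  "sym_path A s [] t \<longleftrightarrow> s = t"
| "sym_path A s (x # u) t \<longleftrightarrow> (\<exists>s'. (s, x, s') \<in> transitions A \<and> sym_path A s' u t)"

definition sym_lang :: "('s, 'a) session_automaton \<Rightarrow> ('a \<times> reg_op) list set" where
  "sym_lang A = {u. \<exists>t \<in> finals A. sym_path A (initial A) u t}"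

definition complete_dfa :: "'a set \<Rightarrow> nat \<Rightarrow> ('s, 'a) session_automaton \<Rightarrow> bool" where
  "complete_dfa \<Sigma> k A \<longleftrightarrow>
     session_automaton \<Sigma> A \<and> registers A = k \<and>
     (\<forall>s \<in> states A. \<forall>x \<in> \<Sigma> \<times> Gam k. \<exists>!s'. (s, x, s') \<in> transitions A)"


section \<open>Symbolic normal form\<close>

text \<open>Positions are counted from 0.\<close>

definition first_pos :: "('a \<times> 'd) list \<Rightarrow> 'd \<Rightarrow> nat" where
  "first_pos w d = (LEAST i. i < length w \<and> snd (w ! i) = d)"

definition last_pos :: "('a \<times> 'd) list \<Rightarrow> 'd \<Rightarrow> nat" where
  "last_pos w d = (GREATEST i. i < length w \<and> snd (w ! i) = d)"

text \<open>
  \<open>snf_upto w i\<close> is the set of registers that are free after the first \<open>i\<close> letters, together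
  with the operations chosen for these letters.
\<close>

primrec snf_upto :: "('a \<times> 'd) list \<Rightarrow> nat \<Rightarrow> nat set \<times> reg_op list" where
  "snf_upto w 0 = ({1..}, [])"
| "snf_upto w (Suc i) =
     (let (free, \<pi>s) = snf_upto w i;
          d = snd (w ! i);
          m = (LEAST r. r \<in> free);
          \<pi> = (if i = first_pos w d then Fresh m else Reuse (reg (\<pi>s ! first_pos w d)));
          free' = (if i = first_pos w d \<and> i \<noteq> last_pos w d then free - {m}
                   else if i = last_pos w d then free \<union> {reg \<pi>}
                   else free)
      in (free', \<pi>s @ [\<pi>]))"

definition snf :: "('a \<times> 'd) list \<Rightarrow> ('a \<times> reg_op) list" where
  "snf w = zip (map fst w) (snd (snf_upto w (length w)))"


section \<open>The canonical session automaton\<close>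

definition snf_registers :: "'a set \<Rightarrow> ('a \<times> 'd) list set \<Rightarrow> nat" where
  "snf_registers \<Sigma> L = (LEAST k. snf ` L \<subseteq> lists (\<Sigma> \<times> Gam k))"

text \<open>Every finite automaton has a copy whose states are natural numbers.\<close>

definition min_dfa_size :: "'a set \<Rightarrow> nat \<Rightarrow> ('a \<times> reg_op) list set \<Rightarrow> nat" where
  "min_dfa_size \<Sigma> k K =
     (LEAST n. \<exists>B :: (nat, 'a) session_automaton.
        complete_dfa \<Sigma> k B \<and> sym_lang B = K \<and> card (states B) = n)"

definition canonical_size :: "'a set \<Rightarrow> ('a \<times> 'd) list set \<Rightarrow> nat" where
  "canonical_size \<Sigma> L = min_dfa_size \<Sigma> (snf_registers \<Sigma> L) (snf ` L)"

text \<open>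
  The minimal automaton is unique up to renaming of states, and so is the canonical session
  automaton.
\<close>

definition canonical ::
  "'a set \<Rightarrow> ('a \<times> 'd) list set \<Rightarrow> ('s, 'a) session_automaton \<Rightarrow> bool" where
  "canonical \<Sigma> L B \<longleftrightarrow>
     complete_dfa \<Sigma> (snf_registers \<Sigma> L) B \<and> sym_lang B = snf ` L \<and>
     card (states B) = canonical_size \<Sigma> L"


section \<open>Learners and teachers\<close>

datatype ('a, 'd) action =
    Member "('a \<times> 'd) list"
  | Equiv "(nat, 'a) session_automaton"
  | Output "(nat, 'a) session_automaton"

datatype ('a, 'd) answer =
    Truth bool
  | Yes
  | Counterexample "('a \<times> 'd) list"

text \<open>
  A learner chooses its next action from the answers received so far. Its own earlier queries are
  determined by these answers.
\<close>

type_synonym ('a, 'd) learner = "('a, 'd) answer list \<Rightarrow> ('a, 'd) action"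

text \<open>
  \<open>dialogue \<Sigma> D L \<Lambda> h\<close>: the list \<open>h\<close> of answers can arise, in this order, in an interaction of the
  learner \<open>\<Lambda>\<close> with some teacher for \<open>L\<close>. The choice of counterexamples is unrestricted and may depend
  on the whole interaction.
\<close>

inductive dialogue ::
  "'a set \<Rightarrow> 'd set \<Rightarrow> ('a \<times> 'd) list set \<Rightarrow> ('a, 'd) learner \<Rightarrow> ('a, 'd) answer list \<Rightarrow> bool"
  for \<Sigma> D L \<Lambda> where
  start: "dialogue \<Sigma> D L \<Lambda> []"
| member: "dialogue \<Sigma> D L \<Lambda> h \<Longrightarrow> \<Lambda> h = Member w \<Longrightarrow>
     dialogue \<Sigma> D L \<Lambda> (h @ [Truth (w \<in> L)])"
| equiv_yes: "dialogue \<Sigma> D L \<Lambda> h \<Longrightarrow> \<Lambda> h = Equiv H \<Longrightarrow> data_lang \<Sigma> D H = L \<Longrightarrow>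
     dialogue \<Sigma> D L \<Lambda> (h @ [Yes])"
| equiv_no: "dialogue \<Sigma> D L \<Lambda> h \<Longrightarrow> \<Lambda> h = Equiv H \<Longrightarrow>
     w \<in> (data_lang \<Sigma> D H - L) \<union> (L - data_lang \<Sigma> D H) \<Longrightarrow>
     dialogue \<Sigma> D L \<Lambda> (h @ [Counterexample w])"

fun admissible :: "'a set \<Rightarrow> 'd set \<Rightarrow> ('a, 'd) action \<Rightarrow> bool" where
  "admissible \<Sigma> D (Member w) \<longleftrightarrow> w \<in> lists (\<Sigma> \<times> D)"
| "admissible \<Sigma> D (Equiv H) \<longleftrightarrow> session_automaton \<Sigma> H"
| "admissible \<Sigma> D (Output H) \<longleftrightarrow> session_automaton \<Sigma> H"

definition member_queries :: "('a, 'd) answer list \<Rightarrow> nat" where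
  "member_queries h = length (filter (\<lambda>x. \<exists>b. x = Truth b) h)"

definition equiv_queries :: "('a, 'd) answer list \<Rightarrow> nat" where
  "equiv_queries h = length (filter (\<lambda>x. x = Yes \<or> (\<exists>w. x = Counterexample w)) h)"

text \<open>The length of the longest counterexample in \<open>h\<close>, or 0 if there is none.\<close>

definition max_counterexample :: "('a, 'd) answer list \<Rightarrow> nat" where
  "max_counterexample h = Max (insert 0 {length w | w. Counterexample w \<in> set h})"


section \<open>Effective learners\<close>

text \<open>
  The total computable functions on binary trees, in the style of the WHILE language: tests for
  equality, and loops that are required to terminate on every input.
\<close>

datatype sexp = Atom | Cell sexp sexp

fun car :: "sexp \<Rightarrow> sexp" where
  "car Atom = Atom"
| "car (Cell x y) = x"

fun cdr :: "sexp \<Rightarrow> sexp" where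
  "cdr Atom = Atom"
| "cdr (Cell x y) = y"

inductive computable :: "(sexp \<Rightarrow> sexp) \<Rightarrow> bool" where
  "computable (\<lambda>x. x)"
| "computable (\<lambda>x. Atom)"
| "computable car"
| "computable cdr"
| "computable f \<Longrightarrow> computable g \<Longrightarrow> computable (\<lambda>x. Cell (f x) (g x))"
| "computable f \<Longrightarrow> computable g \<Longrightarrow> computable (\<lambda>x. g (f x))"
| "computable p \<Longrightarrow> computable q \<Longrightarrow> computable f \<Longrightarrow> computable g \<Longrightarrow>
     computable (\<lambda>x. if p x = q x then f x else g x)"
| "computable p \<Longrightarrow> computable f \<Longrightarrow> \<forall>x. \<exists>n. p ((f ^^ n) x) = Atom \<Longrightarrow>
     computable (\<lambda>x. (f ^^ (LEAST n. p ((f ^^ n) x) = Atom)) x)"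

fun enc_nat :: "nat \<Rightarrow> sexp" where
  "enc_nat 0 = Atom"
| "enc_nat (Suc n) = Cell Atom (enc_nat n)"

fun enc_list :: "('b \<Rightarrow> sexp) \<Rightarrow> 'b list \<Rightarrow> sexp" where
  "enc_list e [] = Atom"
| "enc_list e (x # xs) = Cell (e x) (enc_list e xs)"

text \<open>In what follows, \<open>\<alpha>\<close> numbers the letters of the alphabet.\<close>

definition enc_word :: "('a \<Rightarrow> nat) \<Rightarrow> ('a \<times> nat) list \<Rightarrow> sexp" where
  "enc_word \<alpha> = enc_list (\<lambda>(a, n). Cell (enc_nat (\<alpha> a)) (enc_nat n))"

fun enc_op :: "reg_op \<Rightarrow> sexp" where
  "enc_op (Fresh r) = Cell (enc_nat 0) (enc_nat r)"
| "enc_op (Reuse r) = Cell (enc_nat 1) (enc_nat r)"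

definition enc_transition :: "('a \<Rightarrow> nat) \<Rightarrow> nat \<times> ('a \<times> reg_op) \<times> nat \<Rightarrow> sexp" where
  "enc_transition \<alpha> =
     (\<lambda>(s, (a, \<pi>), t). enc_list id [enc_nat s, enc_nat (\<alpha> a), enc_op \<pi>, enc_nat t])"

text \<open>The finite sets of an automaton are coded as lists of their elements, in any order.\<close>

inductive codes_automaton :: "('a \<Rightarrow> nat) \<Rightarrow> sexp \<Rightarrow> (nat, 'a) session_automaton \<Rightarrow> bool"
  for \<alpha> where
  "set ss = states H \<Longrightarrow> set fs = finals H \<Longrightarrow> set ts = transitions H \<Longrightarrow>
   codes_automaton \<alpha>
     (enc_list id [enc_list enc_nat ss, enc_nat (registers H), enc_nat (initial H),
        enc_list enc_nat fs, enc_list (enc_transition \<alpha>) ts]) H"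

inductive codes_action :: "('a \<Rightarrow> nat) \<Rightarrow> sexp \<Rightarrow> ('a, nat) action \<Rightarrow> bool"
  for \<alpha> where
  "codes_action \<alpha> (Cell (enc_nat 0) (enc_word \<alpha> w)) (Member w)"
| "codes_automaton \<alpha> c H \<Longrightarrow> codes_action \<alpha> (Cell (enc_nat 1) c) (Equiv H)"
| "codes_automaton \<alpha> c H \<Longrightarrow> codes_action \<alpha> (Cell (enc_nat 2) c) (Output H)"

text \<open>
  Data values carry no structure but equality. Those of a counterexample are therefore presented to
  a program by the position of their first occurrence.
\<close>

definition pattern :: "('a \<times> 'd) list \<Rightarrow> ('a \<times> nat) list" where
  "pattern w = map (\<lambda>(a, d). (a, first_pos w d)) w"

fun enc_answer :: "('a \<Rightarrow> nat) \<Rightarrow> ('a, 'd) answer \<Rightarrow> sexp" where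
  "enc_answer \<alpha> (Truth b) = Cell (enc_nat 0) (enc_nat (of_bool b))"
| "enc_answer \<alpha> Yes = Cell (enc_nat 1) Atom"
| "enc_answer \<alpha> (Counterexample w) = Cell (enc_nat 2) (enc_word \<alpha> (pattern w))"

text \<open>
  A learner is an algorithm if its actions are computed by a single computable function \<open>F\<close> from the
  answers received. In the data words that \<open>F\<close> asks for, the natural number \<open>n\<close> stands for the data
  value \<open>\<nu> n\<close>, where \<open>\<nu>\<close> is a fixed supply of distinct data values.
\<close>

definition algorithm :: "'a set \<Rightarrow> 'd set \<Rightarrow> ('a, 'd) learner \<Rightarrow> bool" where
  "algorithm \<Sigma> D \<Lambda> \<longleftrightarrow>
     (\<exists>(\<alpha> :: 'a \<Rightarrow> nat) (\<nu> :: nat \<Rightarrow> 'd) F.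
        inj_on \<alpha> \<Sigma> \<and> inj \<nu> \<and> range \<nu> \<subseteq> D \<and> computable F \<and>
        (\<forall>h. (\<forall>w. Counterexample w \<in> set h \<longrightarrow> w \<in> lists (\<Sigma> \<times> D)) \<longrightarrow>
           (\<exists>act. codes_action \<alpha> (F (enc_list (enc_answer \<alpha>) h)) act \<and>
                  \<Lambda> h = map_action \<nu> act)))"

end

theory Submission
  imports Defs
begin

text \<open>
  The language to be learned is \<open>K = snf ` L\<close>, which is regular: an automaton reading a normal form
  can follow all runs of the session automaton on the data word, remembering which registers hold
  equal values. A membership query for a symbolic word \<open>u\<close> is a membership query for the data word
  that \<open>u\<close> denotes, and \<open>u \<notin> K\<close> unless \<open>u\<close> is in normal form.

  The learner is the algorithm of Angluin in the version of Rivest and Schapire. It keeps access words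
  that are pairwise inequivalent for \<open>K\<close>, hence at most \<open>N\<close> of them, together with distinguishing
  suffixes. A counterexample is processed by binary search, which yields a new access word and a new
  suffix. The number of registers starts from 0 and is only increased when a counterexample demands
  it. Before asking an equivalence query, the learner makes sure that its hypothesis accepts normal
  forms only; then \<open>snf w\<close> is a counterexample for \<open>K\<close> whenever \<open>w\<close> is one for \<open>L\<close>, and a confirmed
  hypothesis recognizes \<open>K\<close> itself. Words not in normal form are excluded by a search of bounded
  length, and treated as further counterexamples; the logarithm of the bound is only linear in \<open>N\<close>
  and \<open>k\<close>. Finally \<open>k \<le> N\<close>, because after register \<open>k\<close> has been filled, every shortest completion in \<open>K\<close>
  has to reuse the \<open>k - 1\<close> smaller registers, and passes through pairwise inequivalent words.

  Since only queries are counted, all searches of the learner may be exhaustive. Its computability then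
  reduces to that of folding over lists, which is a single loop.
\<close>

section \<open>Effective functions\<close>

text \<open>The definition of \<open>snf\<close> looks ahead, since a register becomes free at the
  last occurrence of its value. Normal forms can be checked from left to right because this
  lookahead turns into obligations on registers. The resulting predicate \<open>nf\<close> and the
  denoted data word determine a symbolic word, so the recursion behind \<open>snf\<close> is
  analysed only once. Hypotheses must accept normal forms only, because an automaton may accept a
  data word along another symbolic word while rejecting its normal form; then \<open>snf w\<close>
  need not distinguish the hypothesis from \<open>K\<close>. Two points shape the accounting. For
  \<open>k = 0\<close> the permitted number of membership queries is zero as long as counterexamples
  have length at most one, so nothing may be asked before a register is in use. And the bound
  depends on the longest counterexample, hence does not by itself exclude an infinite dialogue; but
  the number of counterexamples is bounded independently of their lengths, so an infinite dialogue
  would contain finitely many of them, and their lengths a common bound.\<close>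

class encodable =
  fixes sexp_of :: "'a \<Rightarrow> sexp"
  assumes sexp_of_inject: "sexp_of x = sexp_of y \<longleftrightarrow> x = y"

instantiation sexp :: encodable
begin
definition "sexp_of (x :: sexp) = x"
instance by standard (simp add: sexp_of_sexp_def)
end

instantiation unit :: encodable
begin
definition "sexp_of (x :: unit) = Atom"
instance by standard simp
end

lemma enc_nat_inject: "enc_nat m = enc_nat n \<longleftrightarrow> m = n"
proof (induction m arbitrary: n)
  case 0 show ?case by (cases n) auto
next
  case (Suc m) show ?case by (cases n) (auto simp: Suc.IH)
qed

instantiation nat :: encodable
begin
definition "sexp_of (n :: nat) = enc_nat n"
instance by standard (simp add: sexp_of_nat_def enc_nat_inject)
end

instantiation bool :: encodable
begin
definition "sexp_of (b :: bool) = enc_nat (of_bool b)"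
instance by standard (simp add: sexp_of_bool_def enc_nat_inject)
end

instantiation prod :: (encodable, encodable) encodable
begin
definition "sexp_of (p :: 'a \<times> 'b) = Cell (sexp_of (fst p)) (sexp_of (snd p))"
instance by standard (auto simp: sexp_of_prod_def sexp_of_inject prod_eq_iff)
end

lemma enc_list_inject:
  assumes "\<And>x y. e x = e y \<longleftrightarrow> x = y"
  shows "enc_list e xs = enc_list e ys \<longleftrightarrow> xs = ys"
proof (induction xs arbitrary: ys)
  case Nil show ?case by (cases ys) auto
next
  case (Cons x xs) show ?case by (cases ys) (auto simp: Cons.IH assms)
qed

instantiation list :: (encodable) encodable
begin
definition "sexp_of (xs :: 'a list) = enc_list sexp_of xs"
instance by standard (simp add: sexp_of_list_def enc_list_inject sexp_of_inject)
end

instantiation reg_op :: encodable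
begin
definition "sexp_of \<pi> = enc_op \<pi>"
instance
proof
  fix x y :: reg_op
  show "sexp_of x = sexp_of y \<longleftrightarrow> x = y"
    by (cases x; cases y) (auto simp: sexp_of_reg_op_def enc_nat_inject)
qed
end

text \<open>The tags agree with \<open>enc_answer\<close>, so that the coded history given to a
  learner is \<open>sexp_of\<close> of a list of answers over numbered letters.\<close>

instantiation answer :: (encodable, encodable) encodable
begin
fun sexp_of_answer :: "('a, 'b) answer \<Rightarrow> sexp" where
  "sexp_of_answer (Truth b) = Cell (enc_nat 0) (sexp_of b)"
| "sexp_of_answer Yes = Cell (enc_nat 1) Atom"
| "sexp_of_answer (Counterexample w) = Cell (enc_nat 2) (sexp_of w)"
instance
proof
  fix x y :: "('a, 'b) answer"
  show "sexp_of x = sexp_of y \<longleftrightarrow> x = y"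
    by (cases x; cases y) (auto simp: enc_nat_inject sexp_of_inject numeral_2_eq_2)
qed
end

lemma sexp_of_simps [simp]:
  "sexp_of (x, y) = Cell (sexp_of x) (sexp_of y)"
  "sexp_of ([] :: 'b list) = Atom"
  "sexp_of (z # zs) = Cell (sexp_of z) (sexp_of (zs :: 'b :: encodable list))"
  "sexp_of (0 :: nat) = Atom"
  "sexp_of (Suc n) = Cell Atom (sexp_of n)"
  "sexp_of False = Atom"
  "sexp_of True = Cell Atom Atom"
  "sexp_of () = Atom"
  "sexp_of (t :: sexp) = t"
  by (simp_all add: sexp_of_prod_def sexp_of_list_def sexp_of_nat_def sexp_of_bool_def
      sexp_of_unit_def sexp_of_sexp_def)

text \<open>Nothing is required of \<open>F\<close> on trees that are not codes, so programs may
  decode blindly; only loops have to halt on all trees.\<close>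

definition effective :: "('a :: encodable \<Rightarrow> 'b :: encodable) \<Rightarrow> bool" where
  "effective f \<longleftrightarrow> (\<exists>F. computable F \<and> (\<forall>x. F (sexp_of x) = sexp_of (f x)))"

lemma effectiveI: "computable F \<Longrightarrow> (\<And>x. F (sexp_of x) = sexp_of (f x)) \<Longrightarrow> effective f"
  unfolding effective_def by blast

named_theorems effective_intros

lemma computable_const: "computable (\<lambda>x. c)"
  by (induction c) (auto intro: computable.intros)

lemma computable_car: "computable f \<Longrightarrow> computable (\<lambda>x. car (f x))"
  and computable_cdr: "computable f \<Longrightarrow> computable (\<lambda>x. cdr (f x))"
  by (auto intro: computable.intros(3,4) computable.intros(6)[where f = f])

lemmas computable_intros = computable.intros(1,5,7) computable_const computable_car computable_cdr

lemma effective_id [effective_intros]: "effective (\<lambda>x. x)"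
  by (rule effectiveI[of "\<lambda>x. x"]) (auto intro: computable_intros computable.intros(3,4))

lemma effective_const [effective_intros]: "effective (\<lambda>x. c)"
  by (rule effectiveI[OF computable_const]) simp

lemma effective_comp:
  assumes "effective g" "effective f"
  shows "effective (\<lambda>x. g (f x))"
proof -
  obtain F G where "computable F" "\<And>x. F (sexp_of x) = sexp_of (f x)"
    "computable G" "\<And>x. G (sexp_of x) = sexp_of (g x)"
    using assms unfolding effective_def by metis
  then show ?thesis
    by (intro effectiveI[of "\<lambda>x. G (F x)"]) (auto intro: computable.intros(6))
qed

lemma effective_Pair [effective_intros]:
  assumes "effective f" "effective g"
  shows "effective (\<lambda>x. (f x, g x))"
proof -
  obtain F G where "computable F" "\<And>x. F (sexp_of x) = sexp_of (f x)"
    "computable G" "\<And>x. G (sexp_of x) = sexp_of (g x)"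
    using assms unfolding effective_def by metis
  then show ?thesis
    by (intro effectiveI[of "\<lambda>x. Cell (F x) (G x)"])
      (auto intro: computable_intros computable.intros(3,4))
qed

text \<open>Programs have no closures: a function with parameters is treated as a function on pairs,
  and a bound variable becomes a component of the input.\<close>

lemma effective_comp2:
  assumes "effective (\<lambda>p. g (fst p) (snd p))" "effective f" "effective f'"
  shows "effective (\<lambda>x. g (f x) (f' x))"
  using effective_comp[OF assms(1) effective_Pair[OF assms(2,3)]] by simp

lemma effective_comp3:
  assumes "effective (\<lambda>p. g (fst p) (fst (snd p)) (snd (snd p)))"
    "effective f" "effective f'" "effective f''"
  shows "effective (\<lambda>x. g (f x) (f' x) (f'' x))"
  using effective_comp[OF assms(1) effective_Pair[OF assms(2) effective_Pair[OF assms(3,4)]]]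
  by simp

lemma effective_fst [effective_intros]: "effective f \<Longrightarrow> effective (\<lambda>x. fst (f x))"
  by (rule effective_comp, rule effectiveI[of car])
    (auto intro: computable_intros computable.intros(3,4))

lemma effective_snd [effective_intros]: "effective f \<Longrightarrow> effective (\<lambda>x. snd (f x))"
  by (rule effective_comp, rule effectiveI[of cdr])
    (auto intro: computable_intros computable.intros(3,4))

lemma effective_Cell [effective_intros]:
  "effective f \<Longrightarrow> effective g \<Longrightarrow> effective (\<lambda>x. Cell (f x) (g x))"
  by (rule effective_comp2, rule effectiveI[of "\<lambda>x. x"])
    (auto intro: computable_intros computable.intros(3,4))

lemma effective_sexp_of [effective_intros]: "effective f \<Longrightarrow> effective (\<lambda>x. sexp_of (f x))"
  by (rule effective_comp, rule effectiveI[of "\<lambda>x. x"])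
    (auto intro: computable_intros computable.intros(3,4))

lemma effective_Cons [effective_intros]:
  "effective f \<Longrightarrow> effective g \<Longrightarrow> effective (\<lambda>x. f x # g x)"
  by (rule effective_comp2[of Cons], rule effectiveI[of "\<lambda>x. x"])
    (auto intro: computable_intros computable.intros(3,4))

lemma effective_tl [effective_intros]:
  fixes f :: "'a :: encodable \<Rightarrow> 'b :: encodable list"
  assumes "effective f" shows "effective (\<lambda>x. tl (f x))"
proof (rule effective_comp[OF _ assms], rule effectiveI[of cdr])
  show "cdr (sexp_of xs) = sexp_of (tl xs)" for xs :: "'b list" by (cases xs) auto
qed (rule computable.intros)

lemma effective_Suc [effective_intros]: "effective f \<Longrightarrow> effective (\<lambda>x. Suc (f x))"
  by (rule effective_comp, rule effectiveI[of "\<lambda>x. Cell Atom x"])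
    (auto intro: computable_intros computable.intros(3,4))

lemma effective_pred:
  assumes "effective f" shows "effective (\<lambda>x. f x - Suc 0)"
proof (rule effective_comp[OF _ assms], rule effectiveI[of cdr])
  show "cdr (sexp_of n) = sexp_of (n - Suc 0)" for n :: nat by (cases n) auto
qed (rule computable.intros)

lemma effective_if [effective_intros]:
  assumes "effective P" "effective f" "effective g"
  shows "effective (\<lambda>x. if P x then f x else g x)"
proof (rule effective_comp3[of "\<lambda>b y z. if b then y else z", OF _ assms],
    rule effectiveI[of "\<lambda>x. if car x = Atom then cdr (cdr x) else car (cdr x)"])
  show "computable (\<lambda>x. if car x = Atom then cdr (cdr x) else car (cdr x))"
    by (intro computable_intros)
qed auto

lemma effective_eq [effective_intros]:
  assumes "effective f" "effective g"
  shows "effective (\<lambda>x. f x = g x)"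
proof (rule effective_comp2[of "(=)", OF _ assms],
    rule effectiveI[of "\<lambda>x. if car x = cdr x then Cell Atom Atom else Atom"])
  show "computable (\<lambda>x. if car x = cdr x then Cell Atom Atom else Atom)"
    by (intro computable_intros)
qed (auto simp: sexp_of_inject)

lemma effective_Not [effective_intros]:
  assumes "effective P"
  shows "effective (\<lambda>x. \<not> P x)"
proof -
  have "(\<lambda>x. \<not> P x) = (\<lambda>x. if P x then False else True)" by auto
  then show ?thesis by (simp only:) (intro effective_if effective_const assms)
qed

lemma effective_conj [effective_intros]:
  assumes "effective P" "effective Q"
  shows "effective (\<lambda>x. P x \<and> Q x)"
proof -
  have "(\<lambda>x. P x \<and> Q x) = (\<lambda>x. if P x then Q x else False)" by auto
  then show ?thesis by (simp only:) (intro effective_if effective_const assms)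
qed

lemma effective_disj [effective_intros]:
  assumes "effective P" "effective Q"
  shows "effective (\<lambda>x. P x \<or> Q x)"
proof -
  have "(\<lambda>x. P x \<or> Q x) = (\<lambda>x. if P x then True else Q x)" by auto
  then show ?thesis by (simp only:) (intro effective_if effective_const assms)
qed

text \<open>Unlike \<^const>\<open>hd\<close>, its value on the empty list is under control of the program.\<close>

definition first :: "'a \<Rightarrow> 'a list \<Rightarrow> 'a" where
  "first d xs = (if xs = [] then d else hd xs)"

lemma effective_first [effective_intros]:
  fixes f :: "'a :: encodable \<Rightarrow> 'b :: encodable list"
  assumes "effective d" "effective f"
  shows "effective (\<lambda>x. first (d x) (f x))"
proof (rule effective_comp2[OF _ assms],
    rule effectiveI[of "\<lambda>p. if cdr p = Atom then car p else car (cdr p)"])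
  show "computable (\<lambda>p. if cdr p = Atom then car p else car (cdr p))"
    by (intro computable_intros)
  show "(if cdr (sexp_of p) = Atom then car (sexp_of p) else car (cdr (sexp_of p))) =
      sexp_of (first (fst p) (snd p))" for p :: "'b \<times> 'b list"
    by (cases p; cases "snd p") (auto simp: first_def)
qed

subsection \<open>Loops\<close>

text \<open>Turns the \<open>LEAST\<close> of the loop construct into a recursion equation.\<close>

lemma while_unfold:
  assumes "\<exists>n. p ((f ^^ n) x) = Atom"
  shows "(f ^^ (LEAST n. p ((f ^^ n) x) = Atom)) x =
    (if p x = Atom then x else (f ^^ (LEAST n. p ((f ^^ n) (f x)) = Atom)) (f x))"
proof (cases "p x = Atom")
  case True
  then have "(LEAST n. p ((f ^^ n) x) = Atom) = 0" by (intro Least_eq_0) simp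
  with True show ?thesis by simp
next
  case False
  obtain n where "p ((f ^^ n) x) = Atom" using assms by blast
  then have "(LEAST n. p ((f ^^ n) x) = Atom) = Suc (LEAST n. p ((f ^^ Suc n) x) = Atom)"
    using False by (intro Least_Suc) auto
  with False show ?thesis by (simp add: funpow_swap1)
qed

text \<open>Loops must halt on every tree, also on those that code no list; each \<open>cdr\<close>
  moves down the right spine, which ends in an \<open>Atom\<close>.\<close>

lemma cdr_iterates_to_Atom: "\<exists>n. (cdr ^^ n) x = Atom"
proof (induction x)
  case Atom show ?case by (rule exI[of _ 0]) simp
next
  case (Cell x y)
  then obtain n where "(cdr ^^ n) y = Atom" by blast
  then show ?case by (intro exI[of _ "Suc n"]) (simp add: funpow_swap1)
qed

text \<open>The single loop from which all iteration is obtained. Its state holds a constant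
  context, the remaining list and the accumulator; the context replaces the closure that
  \<open>F\<close> would need.\<close>

lemma computable_fold:
  assumes "computable F"
  obtains G where "computable G"
    "\<And>c l a. G (Cell c (Cell (enc_list e l) a)) =
       fold (\<lambda>x acc. F (Cell c (Cell (e x) acc))) l a"
proof -
  define f where "f = (\<lambda>s. Cell (car s) (Cell (cdr (car (cdr s)))
      (F (Cell (car s) (Cell (car (car (cdr s))) (cdr (cdr s)))))))"
  define p where "p = (\<lambda>s. car (cdr s))"
  have f: "computable f" unfolding f_def by (intro computable_intros computable.intros(6)[OF _ assms])
  have p: "computable p" unfolding p_def by (intro computable_intros)
  have "p ((f ^^ n) s) = (cdr ^^ n) (p s)" for n s
    by (induction n) (simp_all add: p_def f_def)
  then have halts: "\<exists>n. p ((f ^^ n) s) = Atom" for s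
    using cdr_iterates_to_Atom by metis
  define W where "W = (\<lambda>s. (f ^^ (LEAST n. p ((f ^^ n) s) = Atom)) s)"
  have W: "computable W" unfolding W_def using p f halts by (intro computable.intros(8)) auto
  have unfold: "W s = (if p s = Atom then s else W (f s))" for s
    unfolding W_def by (rule while_unfold[OF halts])
  have "cdr (cdr (W (Cell c (Cell (enc_list e l) a)))) =
      fold (\<lambda>x acc. F (Cell c (Cell (e x) acc))) l a" for c l a
  proof (induction l arbitrary: a)
    case Nil show ?case by (subst unfold) (simp add: p_def)
  next
    case (Cons x l)
    show ?case by (subst unfold) (simp add: p_def f_def Cons.IH)
  qed
  moreover have "computable (\<lambda>s. cdr (cdr (W s)))" by (intro computable_intros W)
  ultimately show thesis using that by blast
qed

lemma effective_fold [effective_intros]: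
  fixes l :: "'a :: encodable \<Rightarrow> 'b :: encodable list" and i :: "'a \<Rightarrow> 'c :: encodable"
  assumes "effective (\<lambda>p. f (fst p) (fst (snd p)) (snd (snd p)))" "effective l" "effective i"
  shows "effective (\<lambda>x. fold (f x) (l x) (i x))"
proof -
  obtain F where F: "computable F"
    "\<And>x y z. F (Cell (sexp_of x) (Cell (sexp_of y) (sexp_of z))) = sexp_of (f x y z)"
    using assms(1) unfolding effective_def by force
  obtain G where G: "computable G"
    "\<And>c l a. G (Cell c (Cell (enc_list sexp_of l) a)) =
       fold (\<lambda>x acc. F (Cell c (Cell (sexp_of (x :: 'b)) acc))) l a"
    using computable_fold[OF F(1)] by blast
  have fold_F: "fold (\<lambda>x acc. F (Cell (sexp_of c) (Cell (sexp_of x) acc))) l (sexp_of a) =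
      sexp_of (fold (f c) l a)" for c a and l :: "'b list"
    by (induction l arbitrary: a) (simp_all add: F(2))
  obtain L I where "computable L" "\<And>x. L (sexp_of x) = sexp_of (l x)"
    "computable I" "\<And>x. I (sexp_of x) = sexp_of (i x)"
    using assms(2,3) unfolding effective_def by metis
  then show ?thesis
    by (intro effectiveI[of "\<lambda>x. G (Cell x (Cell (L x) (I x)))"])
      (auto intro!: computable_intros computable.intros(6)[OF _ G(1)] simp: G(2) fold_F sexp_of_list_def)
qed

text \<open>A unary number is a list of units, so that bounded iteration is a fold.\<close>

lemma sexp_of_replicate: "sexp_of (replicate n ()) = sexp_of n"
  by (induction n) simp_all

lemma effective_funpow [effective_intros]:
  fixes f :: "'a :: encodable \<Rightarrow> 'b :: encodable \<Rightarrow> 'b"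
  assumes "effective (\<lambda>p. f (fst p) (snd p))" "effective n" "effective i"
  shows "effective (\<lambda>x. (f x ^^ n x) (i x))"
proof -
  have "effective (\<lambda>m. replicate m ())"
    by (rule effectiveI[of "\<lambda>x. x"]) (auto intro: computable_intros simp: sexp_of_replicate)
  then have "effective (\<lambda>x. fold (\<lambda>_. f x) (replicate (n x) ()) (i x))"
    by (intro effective_intros assms effective_comp[OF _ assms(2)]
        effective_comp2[where g = f, OF assms(1)])
  then show ?thesis by (simp add: fold_replicate)
qed

subsection \<open>Lists and numbers\<close>

lemma effective_rev [effective_intros]: "effective l \<Longrightarrow> effective (\<lambda>x. rev (l x))"
  unfolding rev_conv_fold by (intro effective_intros)

lemma effective_append [effective_intros]:
  fixes l :: "'a :: encodable \<Rightarrow> 'b :: encodable list"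
  assumes "effective l" "effective l'"
  shows "effective (\<lambda>x. l x @ l' x)"
proof -
  have "fold Cons (rev ys) zs = ys @ zs" for ys zs :: "'b list"
    by (induction ys arbitrary: zs rule: rev_induct) simp_all
  moreover have "effective (\<lambda>x. fold Cons (rev (l x)) (l' x))"
    by (intro effective_intros assms)
  ultimately show ?thesis by simp
qed

lemma effective_map [effective_intros]:
  assumes "effective (\<lambda>p. f (fst p) (snd p))" "effective l"
  shows "effective (\<lambda>x. map (f x) (l x))"
proof -
  have "fold (\<lambda>y acc. acc @ [f x y]) ys zs = zs @ map (f x) ys" for x ys zs
    by (induction ys arbitrary: zs) simp_all
  then have "map (f x) ys = fold (\<lambda>y acc. acc @ [f x y]) ys []" for x ys by simp
  moreover have "effective (\<lambda>x. fold (\<lambda>y acc. acc @ [f x y]) (l x) [])"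
    by (intro effective_intros assms effective_comp2[where g = f, OF assms(1)])
  ultimately show ?thesis by simp
qed

lemma effective_filter [effective_intros]:
  assumes "effective (\<lambda>p. P (fst p) (snd p))" "effective l"
  shows "effective (\<lambda>x. filter (P x) (l x))"
proof -
  have "fold (\<lambda>y acc. if P x y then acc @ [y] else acc) ys zs = zs @ filter (P x) ys" for x ys zs
    by (induction ys arbitrary: zs) simp_all
  then have "filter (P x) ys = fold (\<lambda>y acc. if P x y then acc @ [y] else acc) ys []" for x ys
    by simp
  moreover have "effective (\<lambda>x. fold (\<lambda>y acc. if P x y then acc @ [y] else acc) (l x) [])"
    by (intro effective_intros assms effective_comp2[where g = P, OF assms(1)])
  ultimately show ?thesis by simp
qed

lemma effective_concat [effective_intros]:
  fixes l :: "'a :: encodable \<Rightarrow> 'b :: encodable list list"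
  assumes "effective l"
  shows "effective (\<lambda>x. concat (l x))"
proof -
  have "fold (\<lambda>y acc. acc @ y) ys zs = zs @ concat ys" for ys and zs :: "'b list"
    by (induction ys arbitrary: zs) simp_all
  then have "concat ys = fold (\<lambda>y acc. acc @ y) ys []" for ys :: "'b list list" by simp
  moreover have "effective (\<lambda>x. fold (\<lambda>y acc. acc @ y) (l x) [])"
    by (intro effective_intros assms)
  ultimately show ?thesis by simp
qed

lemma effective_Ball_set [effective_intros]:
  assumes "effective (\<lambda>p. P (fst p) (snd p))" "effective l"
  shows "effective (\<lambda>x. \<forall>y\<in>set (l x). P x y)"
proof -
  have "effective (\<lambda>x. filter (\<lambda>y. \<not> P x y) (l x) = [])"
    by (intro effective_intros assms effective_comp2[where g = P, OF assms(1)])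
  then show ?thesis by (simp add: filter_empty_conv)
qed

lemma effective_Bex_set [effective_intros]:
  assumes "effective (\<lambda>p. P (fst p) (snd p))" "effective l"
  shows "effective (\<lambda>x. \<exists>y\<in>set (l x). P x y)"
proof -
  have "effective (\<lambda>x. \<not> (\<forall>y\<in>set (l x). \<not> P x y))"
    by (intro effective_intros assms effective_comp2[where g = P, OF assms(1)])
  then show ?thesis by simp
qed

lemma effective_in_set [effective_intros]:
  assumes "effective f" "effective l"
  shows "effective (\<lambda>x. f x \<in> set (l x))"
proof -
  have "effective (\<lambda>x. \<exists>y\<in>set (l x). y = f x)"
    by (intro effective_intros assms effective_comp[OF assms(1)])
  then show ?thesis by simp
qed

lemma effective_length [effective_intros]:
  fixes l :: "'a :: encodable \<Rightarrow> 'b :: encodable list"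
  assumes "effective l" shows "effective (\<lambda>x. length (l x))"
proof -
  have "fold (\<lambda>_. Suc) ys n = n + length ys" for ys :: "'b list" and n
    by (induction ys arbitrary: n) simp_all
  then have "length ys = fold (\<lambda>_. Suc) ys 0" for ys :: "'b list" by simp
  then show ?thesis by (simp only:) (intro effective_intros assms)
qed

lemma effective_drop [effective_intros]:
  assumes "effective n" "effective l"
  shows "effective (\<lambda>x. drop (n x) (l x))"
proof -
  have "drop m xs = (tl ^^ m) xs" for m and xs :: "'b list"
    by (induction m) (simp_all add: drop_Suc drop_tl)
  then show ?thesis by (simp only:) (intro effective_intros assms)
qed

lemma effective_minus [effective_intros]:
  assumes "effective m" "effective n"
  shows "effective (\<lambda>x. m x - n x :: nat)"
proof -
  have "((\<lambda>i. i - Suc 0) ^^ j) i = i - j" for i j :: nat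
    by (induction j) simp_all
  moreover have "effective (\<lambda>x. ((\<lambda>i. i - Suc 0) ^^ n x) (m x))"
    by (intro effective_intros assms effective_pred)
  ultimately show ?thesis by simp
qed

lemma effective_take [effective_intros]:
  assumes "effective n" "effective l"
  shows "effective (\<lambda>x. take (n x) (l x))"
proof -
  have "take m xs = rev (drop (length xs - m) (rev xs))" for m and xs :: "'b list"
    by (cases "m \<le> length xs") (simp_all add: rev_drop)
  then show ?thesis by (simp only:) (intro effective_intros assms)
qed

lemma effective_plus [effective_intros]:
  assumes "effective m" "effective n"
  shows "effective (\<lambda>x. m x + n x :: nat)"
proof -
  have "i + j = (Suc ^^ j) i" for i j :: nat
    by (induction j) simp_all
  then show ?thesis by (simp only:) (intro effective_intros assms)
qed

lemma effective_times [effective_intros]: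
  assumes "effective m" "effective n"
  shows "effective (\<lambda>x. m x * n x :: nat)"
proof -
  have "i * j = ((\<lambda>z. i + z) ^^ j) 0" for i j :: nat
    by (induction j) simp_all
  then show ?thesis
    by (simp only:) (intro effective_intros assms effective_comp[OF assms(1)])
qed

lemma effective_power [effective_intros]:
  assumes "effective m" "effective n"
  shows "effective (\<lambda>x. m x ^ n x :: nat)"
proof -
  have "i ^ j = ((\<lambda>z. i * z) ^^ j) 1" for i j :: nat
    by (induction j) simp_all
  then show ?thesis
    by (simp only:) (intro effective_intros assms effective_comp[OF assms(1)])
qed

lemma effective_le [effective_intros]:
  assumes "effective m" "effective n"
  shows "effective (\<lambda>x. (m x :: nat) \<le> n x)"
proof -
  have "effective (\<lambda>x. m x - n x = 0)" by (intro effective_intros assms)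
  then show ?thesis by simp
qed

lemma effective_less [effective_intros]:
  assumes "effective m" "effective n"
  shows "effective (\<lambda>x. (m x :: nat) < n x)"
  unfolding less_eq_Suc_le by (intro effective_intros assms)

lemma effective_upt [effective_intros]:
  assumes "effective m" "effective n"
  shows "effective (\<lambda>x. [m x..<n x])"
proof -
  have "((\<lambda>l. l @ [i + length l]) ^^ j) [] = [i..<i + j]" for i j
    by (induction j) simp_all
  then have "((\<lambda>l. l @ [i + length l]) ^^ (j - i)) [] = [i..<j]" for i j
    by (cases "i \<le> j") simp_all
  from this[symmetric] have "[i..<j] = ((\<lambda>l. l @ [i + length l]) ^^ (j - i)) []" for i j .
  then show ?thesis by (simp only:) (intro effective_intros assms effective_comp[OF assms(1)])
qed

lemma effective_div_2 [effective_intros]: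
  assumes "effective m"
  shows "effective (\<lambda>x. m x div 2 :: nat)"
proof -
  \<comment> \<open>Division by two is done by counting: \<open>2 * Suc i \<le> j\<close> holds for
    exactly \<open>j div 2\<close> numbers \<open>i\<close>.\<close>
  have "card ({i. 2 * Suc i \<le> j} \<inter> set [0..<j]) = j div 2" for j :: nat
  proof -
    have "{i. 2 * Suc i \<le> j} \<inter> set [0..<j] = {..<j div 2}" by auto
    then show ?thesis by simp
  qed
  then have "j div 2 = length (filter (\<lambda>i. 2 * Suc i \<le> j) [0..<j])" for j :: nat
    by (simp only: distinct_length_filter[OF distinct_upt])
  then show ?thesis
    by (simp only:) (intro effective_intros assms effective_comp[OF assms(1)])
qed

text \<open>The value of \<open>xs ! i\<close> is unspecified beyond the length of
  \<open>xs\<close>, so no program can be given for it; a chosen default makes the access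
  total.\<close>

definition nth_default :: "'a \<Rightarrow> 'a list \<Rightarrow> nat \<Rightarrow> 'a" where
  "nth_default d xs i = first d (drop i xs)"

lemma nth_default_eq [simp]: "i < length xs \<Longrightarrow> nth_default d xs i = xs ! i"
  by (simp add: nth_default_def first_def hd_drop_conv_nth)

lemma effective_nth_default [effective_intros]:
  "effective d \<Longrightarrow> effective l \<Longrightarrow> effective i \<Longrightarrow> effective (\<lambda>x. nth_default (d x) (l x) (i x))"
  unfolding nth_default_def by (intro effective_intros)

lemma effective_Fresh [effective_intros]: "effective f \<Longrightarrow> effective (\<lambda>x. Fresh (f x))"
  by (rule effective_comp, rule effectiveI[of "\<lambda>x. Cell Atom x"])
    (auto intro: computable_intros simp: sexp_of_reg_op_def sexp_of_nat_def)

lemma effective_Reuse [effective_intros]: "effective f \<Longrightarrow> effective (\<lambda>x. Reuse (f x))"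
  by (rule effective_comp, rule effectiveI[of "\<lambda>x. Cell (Cell Atom Atom) x"])
    (auto intro: computable_intros simp: sexp_of_reg_op_def sexp_of_nat_def)

lemma effective_reg [effective_intros]:
  assumes "effective f" shows "effective (\<lambda>x. reg (f x))"
proof (rule effective_comp[OF _ assms], rule effectiveI[of cdr])
  show "cdr (sexp_of \<pi>) = sexp_of (reg \<pi>)" for \<pi>
    by (cases \<pi>) (auto simp: sexp_of_reg_op_def sexp_of_nat_def)
qed (rule computable.intros)

lemma effective_is_Fresh [effective_intros]:
  assumes "effective f" shows "effective (\<lambda>x. is_Fresh (f x))"
proof -
  have "effective (\<lambda>x. f x = Fresh (reg (f x)))" by (intro effective_intros assms)
  moreover have "\<pi> = Fresh (reg \<pi>) \<longleftrightarrow> is_Fresh \<pi>" for \<pi> by (cases \<pi>) auto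
  ultimately show ?thesis by simp
qed

lemma effective_case_answer [effective_intros]:
  fixes r :: "'a :: encodable \<Rightarrow> ('b :: encodable, 'c :: encodable) answer"
  assumes "effective r" "effective (\<lambda>p. f (fst p) (snd p))" "effective g"
    "effective (\<lambda>p. h (fst p) (snd p))"
  shows "effective (\<lambda>x. case r x of Truth b \<Rightarrow> f x b | Yes \<Rightarrow> g x | Counterexample w \<Rightarrow> h x w)"
proof -
  obtain R F G H where c: "computable R" "computable F" "computable G" "computable H"
    and e: "\<And>x. R (sexp_of x) = sexp_of (r x)" "\<And>p. F (sexp_of p) = sexp_of (f (fst p) (snd p))"
     "\<And>x. G (sexp_of x) = sexp_of (g x)" "\<And>p. H (sexp_of p) = sexp_of (h (fst p) (snd p))"
    using assms unfolding effective_def by metis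
  have "F (Cell (sexp_of x) (sexp_of b)) = sexp_of (f x b)"
    "H (Cell (sexp_of x) (sexp_of w)) = sexp_of (h x w)" for x b w
    using e(2)[of "(x, b)"] e(4)[of "(x, w)"] by simp_all
  then show ?thesis
    by (intro effectiveI[of "\<lambda>x. if car (R x) = Atom then F (Cell x (cdr (R x)))
        else if car (R x) = Cell Atom Atom then G x else H (Cell x (cdr (R x)))"])
      (auto intro!: computable_intros c
        computable.intros(6)[OF _ c(2)] computable.intros(6)[OF _ c(4)]
        simp: e numeral_2_eq_2 split: answer.split)
qed

section \<open>Symbolic words\<close>

text \<open>A list rather than a set: its last element is the position whose value register
  \<open>r\<close> holds at present.\<close>

definition opens :: "('a \<times> reg_op) list \<Rightarrow> nat \<Rightarrow> nat list" where
  "opens u r = filter (\<lambda>j. snd (u ! j) = Fresh r) [0..<length u]"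

definition current :: "('a \<times> reg_op) list \<Rightarrow> nat \<Rightarrow> nat" where
  "current u r = (if opens u r = [] then 0 else last (opens u r))"

definition dval :: "('a \<times> reg_op) list \<Rightarrow> reg_op \<Rightarrow> nat" where
  "dval u \<pi> = (if is_Fresh \<pi> then length u else current u (reg \<pi>))"

text \<open>
  The data word denoted by a symbolic word. A data value is named by the position at which it was
  introduced, as in \<^const>\<open>pattern\<close>.
\<close>

definition dat :: "('a \<times> reg_op) list \<Rightarrow> ('a \<times> nat) list" where
  "dat u = map (\<lambda>i. (fst (u ! i), dval (take i u) (snd (u ! i)))) [0..<length u]"

text \<open>Holds exactly when \<open>dval\<close> never falls back on the default 0 of
  \<open>current\<close> for a register that was not filled before.\<close>

definition well_formed :: "('a \<times> reg_op) list \<Rightarrow> bool" where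
  "well_formed u \<longleftrightarrow> (\<forall>i<length u. is_Fresh (snd (u ! i)) \<or> opens (take i u) (reg (snd (u ! i))) \<noteq> [])"

text \<open>
  In a normal form, a fresh value is stored in register \<open>r\<close> only if the values in all smaller
  registers occur again. The registers that have to be reused before they are overwritten, because of
  an earlier fresh value in a greater register, are the obligations \<open>obs u\<close>.
\<close>

definition obs :: "('a \<times> reg_op) list \<Rightarrow> nat list" where
  "obs u = fold (\<lambda>x ob. if is_Fresh (snd x) then [1..<reg (snd x)] @ ob
     else filter (\<lambda>r. r \<noteq> reg (snd x)) ob) u []"

text \<open>Taking the least free register means that every smaller one is occupied by a value that
  occurs again. That it has been filled is tested here; the recurrence becomes an obligation, and a
  register with a pending obligation must not be overwritten.\<close>

definition ok :: "('a \<times> reg_op) list \<Rightarrow> reg_op \<Rightarrow> bool" where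
  "ok u \<pi> \<longleftrightarrow> (if is_Fresh \<pi>
     then 1 \<le> reg \<pi> \<and> (\<forall>r\<in>set [1..<reg \<pi>]. opens u r \<noteq> []) \<and> reg \<pi> \<notin> set (obs u)
     else opens u (reg \<pi>) \<noteq> [])"

definition pre :: "('a \<times> reg_op) list \<Rightarrow> bool" where
  "pre u \<longleftrightarrow> (\<forall>i<length u. ok (take i u) (snd (u ! i)))"

definition nf :: "('a \<times> reg_op) list \<Rightarrow> bool" where
  "nf u \<longleftrightarrow> pre u \<and> obs u = []"

lemma opens_Nil [simp]: "opens [] r = []"
  by (simp add: opens_def)

lemma opens_snoc [simp]:
  "opens (u @ [x]) r = opens u r @ (if snd x = Fresh r then [length u] else [])"
proof -
  have "filter (\<lambda>j. snd ((u @ [x]) ! j) = Fresh r) [0..<length u] =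
      filter (\<lambda>j. snd (u ! j) = Fresh r) [0..<length u]"
    by (rule filter_cong) (auto simp: nth_append)
  then show ?thesis by (simp add: opens_def)
qed

lemma current_snoc [simp]:
  "current (u @ [x]) r = (if snd x = Fresh r then length u else current u r)"
  by (simp add: current_def)

lemma opens_nonempty_iff: "opens u r \<noteq> [] \<longleftrightarrow> (\<exists>j<length u. snd (u ! j) = Fresh r)"
  by (auto simp: opens_def filter_empty_conv)

lemma current_Fresh:
  assumes "opens u r \<noteq> []"
  shows "current u r < length u" "snd (u ! current u r) = Fresh r"
proof -
  have "current u r \<in> set (opens u r)" using assms by (simp add: current_def)
  then show "current u r < length u" "snd (u ! current u r) = Fresh r"
    by (auto simp: opens_def)
qed

lemma current_greatest:
  assumes "j < length u" "snd (u ! j) = Fresh r"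
  shows "j \<le> current u r"
  using assms
proof (induction u rule: rev_induct)
  case (snoc x u)
  then show ?case by (cases "j < length u") (auto simp: nth_append)
qed simp

lemma dat_Nil [simp]: "dat [] = []"
  by (simp add: dat_def)

lemma dat_snoc [simp]: "dat (u @ [x]) = dat u @ [(fst x, dval u (snd x))]"
  by (simp add: dat_def nth_append)

lemma length_dat [simp]: "length (dat u) = length u"
  by (simp add: dat_def)

lemma nth_dat: "i < length u \<Longrightarrow> dat u ! i = (fst (u ! i), dval (take i u) (snd (u ! i)))"
  by (simp add: dat_def)

lemma map_fst_dat: "map fst (dat u) = map fst u"
  by (rule nth_equalityI) (simp_all add: nth_dat)

lemma well_formed_Nil [simp]: "well_formed []"
  by (simp add: well_formed_def)

lemma well_formed_snoc [simp]:
  "well_formed (u @ [x]) \<longleftrightarrow> well_formed u \<and> (is_Fresh (snd x) \<or> opens u (reg (snd x)) \<noteq> [])"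
  by (auto simp: well_formed_def nth_append less_Suc_eq)

lemma obs_Nil [simp]: "obs [] = []"
  by (simp add: obs_def)

lemma obs_snoc [simp]:
  "obs (u @ [x]) = (if is_Fresh (snd x) then [1..<reg (snd x)] @ obs u
     else filter (\<lambda>r. r \<noteq> reg (snd x)) (obs u))"
  by (simp add: obs_def)

lemma pre_Nil [simp]: "pre []"
  by (simp add: pre_def)

lemma pre_snoc [simp]: "pre (u @ [x]) \<longleftrightarrow> pre u \<and> ok u (snd x)"
  by (auto simp: pre_def nth_append less_Suc_eq)

lemma pre_appendD: "pre (u @ v) \<Longrightarrow> pre u"
proof (induction v rule: rev_induct)
  case (snoc x v) then show ?case by (metis append_assoc pre_snoc)
qed simp

lemma nf_Nil [simp]: "nf []"
  by (simp add: nf_def)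

lemma pre_imp_well_formed: "pre u \<Longrightarrow> well_formed u"
  by (auto simp: pre_def well_formed_def ok_def split: if_splits)

lemma nf_imp_well_formed: "nf u \<Longrightarrow> well_formed u"
  by (simp add: nf_def pre_imp_well_formed)

text \<open>Freshness is visible in the data word: a reused value is named by an earlier position, a
  fresh one by its own. Hence well-formed symbolic words with the same data are fresh at the same
  positions.\<close>

lemma dval_eq_length_iff:
  "is_Fresh \<pi> \<or> opens u (reg \<pi>) \<noteq> [] \<Longrightarrow> dval u \<pi> = length u \<longleftrightarrow> is_Fresh \<pi>"
  using current_Fresh(1)[of u "reg \<pi>"] by (auto simp: dval_def)

lemma dat_nth_current:
  assumes "opens u r \<noteq> []"
  shows "snd (dat u ! current u r) = current u r"
  using current_Fresh[OF assms] by (simp add: nth_dat dval_def)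

section \<open>Patterns and runs\<close>

lemma first_pos_props:
  assumes "d \<in> snd ` set w"
  shows "first_pos w d < length w" "snd (w ! first_pos w d) = d"
proof -
  have "\<exists>i. i < length w \<and> snd (w ! i) = d" using assms by (metis image_iff in_set_conv_nth)
  from LeastI_ex[OF this] show "first_pos w d < length w" "snd (w ! first_pos w d) = d"
    by (auto simp: first_pos_def)
qed

lemma first_pos_le: "i < length w \<Longrightarrow> snd (w ! i) = d \<Longrightarrow> first_pos w d \<le> i"
  unfolding first_pos_def by (rule Least_le) simp

lemma last_pos_props:
  assumes "d \<in> snd ` set w"
  shows "last_pos w d < length w" "snd (w ! last_pos w d) = d"
proof -
  obtain i where "i < length w \<and> snd (w ! i) = d" using assms by (metis image_iff in_set_conv_nth)
  then have "last_pos w d < length w \<and> snd (w ! last_pos w d) = d"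
    unfolding last_pos_def by (rule GreatestI_nat[where b = "length w"]) auto
  then show "last_pos w d < length w" "snd (w ! last_pos w d) = d" by auto
qed

lemma last_pos_ge: "i < length w \<Longrightarrow> snd (w ! i) = d \<Longrightarrow> i \<le> last_pos w d"
  unfolding last_pos_def by (rule Greatest_le_nat[where b = "length w"]) auto

lemma first_pos_eqI:
  assumes "i < length w" "snd (w ! i) = d" "\<And>j. j < i \<Longrightarrow> snd (w ! j) \<noteq> d"
  shows "first_pos w d = i"
proof -
  have "first_pos w d \<le> i" using assms by (intro first_pos_le)
  moreover have "snd (w ! first_pos w d) = d"
    using assms by (intro first_pos_props) (auto intro!: image_eqI[of _ _ "w ! i"])
  ultimately show ?thesis using assms(3) by (meson le_neq_implies_less)
qed

lemma first_pos_snoc: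
  "first_pos (w @ [x]) d = (if d \<in> snd ` set w then first_pos w d else length w)"
  if "d \<in> snd ` set (w @ [x])"
proof (cases "d \<in> snd ` set w")
  case True
  note f = first_pos_props[OF True]
  have "first_pos (w @ [x]) d = first_pos w d"
  proof (rule first_pos_eqI)
    fix j assume "j < first_pos w d"
    then show "snd ((w @ [x]) ! j) \<noteq> d"
      using f(1) first_pos_le[of j w d] by (auto simp: nth_append)
  qed (use f in \<open>auto simp: nth_append\<close>)
  with True show ?thesis by simp
next
  case False
  then show ?thesis
    using that by (auto intro!: first_pos_eqI simp: nth_append) (metis image_eqI nth_mem)
qed

lemma length_pattern [simp]: "length (pattern w) = length w"
  by (simp add: pattern_def)

lemma nth_pattern: "i < length w \<Longrightarrow> pattern w ! i = (fst (w ! i), first_pos w (snd (w ! i)))"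
  by (simp add: pattern_def case_prod_beta)

lemma map_fst_pattern: "map fst (pattern w) = map fst w"
  by (simp add: pattern_def case_prod_beta)

lemma pattern_snoc:
  "pattern (w @ [(a, d)]) = pattern w @ [(a, if d \<in> snd ` set w then first_pos w d else length w)]"
proof -
  have "first_pos (w @ [(a, d)]) (snd x) = first_pos w (snd x)" if "x \<in> set w" for x
    using that by (subst first_pos_snoc) auto
  then show ?thesis by (auto simp: pattern_def first_pos_snoc case_prod_beta)
qed

lemma dat_eq_pattern_first_pos:
  assumes "dat z = pattern w" "opens z r \<noteq> []"
  shows "current z r < length w" "first_pos w (snd (w ! current z r)) = current z r"
proof -
  have "length z = length w" using assms(1) by (metis length_dat length_pattern)
  then show "current z r < length w" using current_Fresh(1)[OF assms(2)] by simp
  then show "first_pos w (snd (w ! current z r)) = current z r"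
    using dat_nth_current[OF assms(2)] assms(1) by (simp add: nth_pattern)
qed

lemma dat_eq_pattern_Nil_iff: "dat z = pattern [] \<longleftrightarrow> z = []"
  by (auto simp: pattern_def) (metis length_0_conv length_dat)

lemma run_append: "run A c (w @ w') c' \<longleftrightarrow> (\<exists>c''. run A c w c'' \<and> run A c'' w' c')"
  by (induction w arbitrary: c) (simp_all, blast)

lemma sym_path_append:
  "sym_path A s (u @ v) t \<longleftrightarrow> (\<exists>s'. sym_path A s u s' \<and> sym_path A s' v t)"
  by (induction u arbitrary: s) auto

text \<open>The register contents after a run are a function of the label \<open>z\<close> of its
  path and the data word \<open>w\<close>, which allows configurations to be eliminated.\<close>

definition store :: "('a \<times> reg_op) list \<Rightarrow> ('b \<times> 'd) list \<Rightarrow> nat \<rightharpoonup> 'd" where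
  "store z w = (\<lambda>r. if opens z r = [] then None else Some (snd (w ! current z r)))"

lemma store_snoc:
  assumes "length z = length w"
  shows "store (z @ [x]) (w @ [y]) = (if is_Fresh (snd x)
    then (store z w)(reg (snd x) \<mapsto> snd y) else store z w)"
proof
  fix r show "store (z @ [x]) (w @ [y]) r = (if is_Fresh (snd x)
    then (store z w)(reg (snd x) \<mapsto> snd y) else store z w) r"
    using assms current_Fresh(1)[of z r]
    by (cases "snd x") (auto simp: store_def nth_append)
qed

text \<open>A configuration is its state together with data determined by path label and data word,
  and the two step conditions become one: the name of the value read is the one that the operation
  yields, either the new position or the current one of the register. So a run on \<open>w\<close>
  is a path whose label denotes \<open>w\<close> up to renaming of values.\<close>

lemma run_iff_sym_path:
  "run A (i, Map.empty, {}) w (s, \<tau>, U) \<longleftrightarrow>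
    (\<exists>z. sym_path A i z s \<and> well_formed z \<and> dat z = pattern w \<and> \<tau> = store z w \<and> U = snd ` set w)"
proof (induction w arbitrary: s \<tau> U rule: rev_induct)
  case Nil
  show ?case by (auto simp: dat_eq_pattern_Nil_iff store_def)
next
  case (snoc y w)
  obtain a d where y: "y = (a, d)" by (cases y)
  show ?case
  proof
    assume "run A (i, Map.empty, {}) (w @ [y]) (s, \<tau>, U)"
    then obtain s' \<tau>' U' where r: "run A (i, Map.empty, {}) w (s', \<tau>', U')"
      and st: "step A (s', \<tau>', U') (a, d) (s, \<tau>, U)"
      by (auto simp: run_append y)
    from r obtain z where z: "sym_path A i z s'" "well_formed z" "dat z = pattern w"
      "\<tau>' = store z w" "U' = snd ` set w"
      using snoc.IH by blast
    have len: "length z = length w" using z(3) by (metis length_dat length_pattern)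
    from st show "\<exists>z. sym_path A i z s \<and> well_formed z \<and> dat z = pattern (w @ [y]) \<and>
        \<tau> = store z (w @ [y]) \<and> U = snd ` set (w @ [y])"
    proof cases
      case (fresh r)
      then show ?thesis using z len
        by (intro exI[of _ "z @ [(a, Fresh r)]"])
          (auto simp: y sym_path_append pattern_snoc dval_def store_snoc)
    next
      case (reuse r)
      then have o: "opens z r \<noteq> []" "d = snd (w ! current z r)"
        using z by (auto simp: store_def split: if_splits)
      note c = dat_eq_pattern_first_pos[OF z(3) o(1)]
      have "d \<in> snd ` set w" using c(1) o(2) by simp
      moreover have "(store z w)(r \<mapsto> d) = store z w"
        using reuse z by (auto simp: fun_upd_idem)
      ultimately show ?thesis using z len o c reuse
        by (intro exI[of _ "z @ [(a, Reuse r)]"])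
          (auto simp: y sym_path_append pattern_snoc dval_def store_snoc)
    qed
  next
    assume "\<exists>z. sym_path A i z s \<and> well_formed z \<and> dat z = pattern (w @ [y]) \<and>
        \<tau> = store z (w @ [y]) \<and> U = snd ` set (w @ [y])"
    then obtain z' where z': "sym_path A i z' s" "well_formed z'" "dat z' = pattern (w @ [y])"
        "\<tau> = store z' (w @ [y])" "U = snd ` set (w @ [y])"
      by blast
    have "length z' = Suc (length w)"
      using z'(3) by (metis length_append_singleton length_dat length_pattern)
    then obtain z x where zx: "z' = z @ [x]" by (cases z' rule: rev_cases) auto
    obtain b \<pi> where x: "x = (b, \<pi>)" by (cases x)
    from z'(1) obtain s' where s': "sym_path A i z s'" "(s', (b, \<pi>), s) \<in> transitions A"
      by (auto simp: zx x sym_path_append)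
    have e: "dat z = pattern w" "b = a"
      "dval z \<pi> = (if d \<in> snd ` set w then first_pos w d else length w)"
      using z'(3) by (auto simp: zx x y pattern_snoc)
    have well_formed: "well_formed z" "is_Fresh \<pi> \<or> opens z (reg \<pi>) \<noteq> []"
      using z'(2) by (auto simp: zx x)
    have len: "length z = length w" using e(1) by (metis length_dat length_pattern)
    have run: "run A (i, Map.empty, {}) w (s', store z w, snd ` set w)"
      using snoc.IH s'(1) well_formed(1) e(1) by blast
    have "step A (s', store z w, snd ` set w) (a, d) (s, \<tau>, U)"
    proof (cases \<pi>)
      case (Fresh r)
      then have "d \<notin> snd ` set w"
        using e(3) len first_pos_props(1)[of d w] by (cases "d \<in> snd ` set w") (simp_all add: dval_def)
      then have "step A (s', store z w, snd ` set w) (a, d)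
          (s, (store z w)(r \<mapsto> d), insert d (snd ` set w))"
        using s'(2) Fresh e(2) by (intro step.fresh) auto
      then show ?thesis using z' len by (simp add: zx x y Fresh store_snoc)
    next
      case (Reuse r)
      then have o: "opens z r \<noteq> []" using well_formed by auto
      note c = dat_eq_pattern_first_pos[OF e(1) o]
      have "d \<in> snd ` set w" using c e(3) by (auto simp: Reuse dval_def split: if_splits)
      then have "d = snd (w ! current z r)"
        using e(3) first_pos_props(2)[of d w] by (auto simp: Reuse dval_def)
      then have sd: "store z w r = Some d" using o by (simp add: store_def)
      then have "step A (s', store z w, snd ` set w) (a, d)
          (s, (store z w)(r \<mapsto> d), insert d (snd ` set w))"
        using s'(2) Reuse e(2) by (intro step.reuse) auto
      then show ?thesis using z' len sd by (simp add: zx x y Reuse store_snoc fun_upd_idem)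
    qed
    then show "run A (i, Map.empty, {}) (w @ [y]) (s, \<tau>, U)"
      using run by (auto simp: run_append y)
  qed
qed

lemma data_lang_iff:
  "w \<in> data_lang \<Sigma> D A \<longleftrightarrow>
    w \<in> lists (\<Sigma> \<times> D) \<and> (\<exists>z\<in>sym_lang A. well_formed z \<and> dat z = pattern w)"
  unfolding data_lang_def sym_lang_def by (auto simp: run_iff_sym_path)

section \<open>Normal forms\<close>

text \<open>The values that occupy a register after \<open>i\<close> letters; with positions counted
  from 0, \<open>i \<le> last_pos w d\<close> says that \<open>d\<close> occurs among the remaining
  letters.\<close>

definition live :: "('a \<times> 'd) list \<Rightarrow> nat \<Rightarrow> 'd set" where
  "live w i = {d \<in> snd ` set w. first_pos w d < i \<and> i \<le> last_pos w d}"

lemma finite_live: "finite (live w i)"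
  by (simp add: live_def)

lemma zip_snoc_right:
  "length ys < length xs \<Longrightarrow> zip xs (ys @ [y]) = zip xs ys @ [(xs ! length ys, y)]"
proof (induction ys arbitrary: xs)
  case Nil then show ?case by (cases xs) auto
next
  case (Cons z ys) then show ?case by (cases xs) auto
qed

text \<open>\<open>g d\<close> is the register of \<open>d\<close>. Obligations lie on registers of
  live values only, so none is left once no value is live.\<close>

definition snf_inv :: "('a \<times> 'd) list \<Rightarrow> nat \<Rightarrow> nat set \<Rightarrow> reg_op list \<Rightarrow> bool" where
  "snf_inv w i free \<pi>s \<longleftrightarrow>
     (let u = zip (map fst w) \<pi>s; g = \<lambda>d. reg (\<pi>s ! first_pos w d)
      in length \<pi>s = i \<and> free = {1..} - g ` live w i \<and>
        (\<forall>d\<in>live w i. opens u (g d) \<noteq> [] \<and> current u (g d) = first_pos w d) \<and>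
        pre u \<and> dat u = take i (pattern w) \<and> set (obs u) \<subseteq> g ` live w i)"

lemma snf_upto_invariant:
  assumes "i \<le> length w" "snf_upto w i = (free, \<pi>s)"
  shows "snf_inv w i free \<pi>s"
  using assms
proof (induction i arbitrary: free \<pi>s)
  case 0
  then show ?case by (auto simp: live_def snf_inv_def)
next
  case (Suc i)
  obtain free0 \<pi>s0 where up: "snf_upto w i = (free0, \<pi>s0)" by fastforce
  have i: "i < length w" using Suc.prems by simp
  define u where "u = zip (map fst w) \<pi>s0"
  define g where "g = (\<lambda>d. reg (\<pi>s0 ! first_pos w d))"
  have len: "length \<pi>s0 = i" and free0: "free0 = {1..} - g ` live w i"
    and cur: "\<And>d. d \<in> live w i \<Longrightarrow> opens u (g d) \<noteq> [] \<and> current u (g d) = first_pos w d"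
    and pre: "pre u" and dat: "dat u = take i (pattern w)" and obs: "set (obs u) \<subseteq> g ` live w i"
    using Suc.IH[OF _ up] i unfolding u_def g_def snf_inv_def Let_def by auto
  have len_u: "length u = i" using i len by (simp add: u_def)
  define d where "d = snd (w ! i)"
  have d: "d \<in> snd ` set w" using i by (simp add: d_def)
  define m where "m = (LEAST r. r \<in> free0)"
  define \<pi> where "\<pi> = (if i = first_pos w d then Fresh m else Reuse (g d))"
  have upd: "free = (if i = first_pos w d \<and> i \<noteq> last_pos w d then free0 - {m}
      else if i = last_pos w d then free0 \<union> {reg \<pi>} else free0)"
    and \<pi>s: "\<pi>s = \<pi>s0 @ [\<pi>]"
    using Suc.prems(2) up by (auto simp: Let_def \<pi>_def g_def m_def d_def)
  define u' where "u' = zip (map fst w) \<pi>s"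
  define g' where "g' = (\<lambda>d. reg (\<pi>s ! first_pos w d))"
  have u': "u' = u @ [(fst (w ! i), \<pi>)]"
    using i len by (simp add: u'_def \<pi>s u_def zip_snoc_right)
  have take: "take (Suc i) (pattern w) = take i (pattern w) @ [(fst (w ! i), first_pos w d)]"
    using i by (simp add: take_Suc_conv_app_nth nth_pattern d_def)
  have le: "first_pos w d \<le> i" "i \<le> last_pos w d"
    using i by (auto simp: d_def intro: first_pos_le last_pos_ge)
  have g': "g' d' = g d'" if "first_pos w d' < i" for d'
    using that len by (simp add: \<pi>s g_def g'_def nth_append)
  \<comment> \<open>A value starts or ceases to be live only at its own first or last position, so
    this letter affects the liveness of \<open>d\<close> alone.\<close>
  have other: "d' \<in> live w (Suc i) \<longleftrightarrow> d' \<in> live w i" if "d' \<noteq> d" for d'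
  proof (cases "d' \<in> snd ` set w")
    case True
    then have "first_pos w d' \<noteq> i" "last_pos w d' \<noteq> i"
      using that first_pos_props(2)[OF True] last_pos_props(2)[OF True] by (auto simp: d_def)
    then have "first_pos w d' < Suc i \<longleftrightarrow> first_pos w d' < i" "Suc i \<le> last_pos w d' \<longleftrightarrow> i \<le> last_pos w d'"
      by linarith+
    then show ?thesis by (simp add: live_def)
  qed (simp add: live_def)
  have own: "d \<in> live w (Suc i) \<longleftrightarrow> i \<noteq> last_pos w d" "d \<in> live w i \<longleftrightarrow> i \<noteq> first_pos w d"
    using d le by (auto simp: live_def)
  have "free = {1..} - g' ` live w (Suc i) \<and> ok u \<pi> \<and> dval u \<pi> = first_pos w d \<and>
    (\<forall>d\<in>live w (Suc i). opens u' (g' d) \<noteq> [] \<and> current u' (g' d) = first_pos w d) \<and>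
    set (obs u') \<subseteq> g' ` live w (Suc i)"
  proof (cases "i = first_pos w d")
    case True
    then have \<pi>: "\<pi> = Fresh m" by (simp add: \<pi>_def)
    \<comment> \<open>Only finitely many values are live, so the least free register
      \<open>m\<close> exists.\<close>
    have "infinite free0" unfolding free0 by (simp add: finite_live infinite_Ici)
    then have "\<exists>r. r \<in> free0" by (metis ex_in_conv finite.emptyI)
    then have m: "m \<in> free0" unfolding m_def by (rule LeastI_ex)
    \<comment> \<open>By minimality of \<open>m\<close>, all smaller registers hold live values;
      this gives \<open>ok\<close> and places the new obligations on registers of live
      values.\<close>
    have below: "r \<in> g ` live w i" if "1 \<le> r" "r < m" for r
    proof (rule ccontr)
      assume "r \<notin> g ` live w i"
      then have "r \<in> free0" using that by (simp add: free0)
      then show False using that not_less_Least unfolding m_def by blast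
    qed
    have gd: "g' d = m" using True len by (simp add: g'_def \<pi>s \<pi> nth_append)
    have live: "live w (Suc i) = live w i \<union> (if i = last_pos w d then {} else {d})"
    proof (rule set_eqI)
      show "d' \<in> live w (Suc i) \<longleftrightarrow> d' \<in> live w i \<union> (if i = last_pos w d then {} else {d})" for d'
        using other[of d'] own True by (cases "d' = d") auto
    qed
    have img: "g' ` live w i = g ` live w i" using g' by (auto simp: live_def)
    have "free = (if i \<noteq> last_pos w d then free0 - {m} else free0 \<union> {m})"
      using upd True \<pi> by simp
    then have "free = {1..} - g' ` live w (Suc i)"
      using m img gd by (auto simp: live image_Un free0)
    moreover have "opens u' (g' d') \<noteq> [] \<and> current u' (g' d') = first_pos w d'" if d': "d' \<in> live w (Suc i)" for d'
    proof (cases "d' = d")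
      case True
      then show ?thesis using gd \<open>i = first_pos w d\<close> len_u by (simp add: u' \<pi>)
    next
      case False
      then have "d' \<in> live w i" using d' other by blast
      moreover from this have "g d' \<noteq> m" using m by (auto simp: free0)
      ultimately show ?thesis using cur g' by (auto simp: u' \<pi> live_def)
    qed
    moreover have "ok u \<pi>" using m below cur obs by (fastforce simp: ok_def \<pi> free0)
    moreover have "dval u \<pi> = first_pos w d" using True len_u by (simp add: dval_def \<pi>)
    moreover have "set (obs u') \<subseteq> g' ` live w i" unfolding img using obs below by (auto simp: u' \<pi>)
    ultimately show ?thesis by (auto simp: live image_Un)
  next
    case False
    have \<pi>: "\<pi> = Reuse (g d)" using False by (simp add: \<pi>_def)
    have dl: "d \<in> live w i" using own False by simp
    have live: "live w (Suc i) = live w i - (if i = last_pos w d then {d} else {})"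
    proof (rule set_eqI)
      show "d' \<in> live w (Suc i) \<longleftrightarrow> d' \<in> live w i - (if i = last_pos w d then {d} else {})" for d'
        using other[of d'] own False by (cases "d' = d") auto
    qed
    have gl: "g' d' = g d'" if "d' \<in> live w i" for d' using that g' by (simp add: live_def)
    \<comment> \<open>Two live values never share a register, as \<open>current\<close> recovers the
      first position of the value from the register; so releasing \<open>g d\<close> affects no
      other value.\<close>
    have inj: "inj_on g (live w i)"
    proof (rule inj_onI)
      fix x y assume xy: "x \<in> live w i" "y \<in> live w i" "g x = g y"
      then have "first_pos w x = first_pos w y" using cur by metis
      moreover have "x \<in> snd ` set w" "y \<in> snd ` set w" using xy by (simp_all add: live_def)
      ultimately show "x = y" using first_pos_props(2) by metis
    qed
    have "g' ` live w (Suc i) = g ` live w (Suc i)"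
      using gl by (intro image_cong) (auto simp: live split: if_splits)
    also have "\<dots> = g ` live w i - (if i = last_pos w d then {g d} else {})"
      unfolding live using inj dl by (auto simp: inj_on_def)
    finally have img: "g' ` live w (Suc i) = g ` live w i - (if i = last_pos w d then {g d} else {})" .
    have c: "current u (g d) = first_pos w d" "opens u (g d) \<noteq> []" using cur[OF dl] by auto
    then have "snd (u ! first_pos w d) = Fresh (g d)" "first_pos w d < length u"
      using current_Fresh[OF c(2)] by auto
    then have "1 \<le> g d" using pre by (auto simp: pre_def ok_def)
    moreover have "free = (if i = last_pos w d then free0 \<union> {g d} else free0)"
      using upd False \<pi> by simp
    ultimately have "free = {1..} - g' ` live w (Suc i)" using dl img by (auto simp: free0)
    moreover have "opens u' (g' d') \<noteq> [] \<and> current u' (g' d') = first_pos w d'" if "d' \<in> live w (Suc i)" for d'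
    proof -
      have "d' \<in> live w i" using that by (simp add: live split: if_splits)
      then show ?thesis using cur gl by (simp add: u' \<pi>)
    qed
    moreover have "set (obs u') \<subseteq> g' ` live w (Suc i)" using obs unfolding img by (auto simp: u' \<pi>)
    ultimately show ?thesis using c by (simp add: ok_def dval_def \<pi>)
  qed
  then show ?case
    unfolding snf_inv_def Let_def u'_def[symmetric] g'_def[symmetric]
    using len pre dat take by (simp add: u') (simp add: \<pi>s)
qed

lemma live_length: "live w (length w) = {}"
  using last_pos_props(1)[of _ w] by (fastforce simp: live_def)

lemma nf_snf: "nf (snf w)"
  and dat_snf: "dat (snf w) = pattern w"
proof -
  obtain free \<pi>s where "snf_upto w (length w) = (free, \<pi>s)" by fastforce
  from snf_upto_invariant[OF order.refl this] this
  show "nf (snf w)" "dat (snf w) = pattern w"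
    by (auto simp: snf_def nf_def live_length snf_inv_def Let_def)
qed

text \<open>While the obligation is pending, \<open>ok\<close> forbids \<open>Fresh r\<close>, and
  only \<open>Reuse r\<close> removes it; so the value reused is the one that \<open>r\<close> holds
  after \<open>v\<close>.\<close>

lemma obligation_discharged:
  assumes "pre (v @ z)" "r \<in> set (obs v)" "r \<notin> set (obs (v @ z))"
  shows "\<exists>z1 a z2. z = z1 @ (a, Reuse r) # z2 \<and> (\<forall>x\<in>set z1. snd x \<noteq> Fresh r)"
  using assms
proof (induction z arbitrary: v)
  case (Cons x z)
  obtain a \<pi> where x: "x = (a, \<pi>)" by (cases x)
  show ?case
  proof (cases "\<pi> = Reuse r")
    case True
    then show ?thesis by (intro exI[of _ "[]"]) (auto simp: x)
  next
    case False
    have "pre (v @ [x])" using Cons.prems(1) pre_appendD[of "v @ [x]" z] by simp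
    then have nF: "\<pi> \<noteq> Fresh r" using Cons.prems(2) by (auto simp: x ok_def)
    have "r \<in> set (obs (v @ [x]))" using Cons.prems(2) False by (cases \<pi>) (auto simp: x)
    then obtain z1 b z2 where "z = z1 @ (b, Reuse r) # z2" "\<forall>x\<in>set z1. snd x \<noteq> Fresh r"
      using Cons.IH[of "v @ [x]"] Cons.prems by auto
    then show ?thesis using nF by (intro exI[of _ "x # z1"]) (auto simp: x)
  qed
qed simp

lemma opens_append_no_Fresh:
  "\<forall>x\<in>set z. snd x \<noteq> Fresh r \<Longrightarrow> opens (v @ z) r = opens v r"
proof (induction z rule: rev_induct)
  case (snoc x z) then show ?case using opens_snoc[of "v @ z" x r] by simp
qed simp

lemma current_append_no_Fresh:
  "\<forall>x\<in>set z. snd x \<noteq> Fresh r \<Longrightarrow> current (v @ z) r = current v r"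
  by (simp add: current_def opens_append_no_Fresh)

text \<open>Opening register \<open>r\<close> is a promise that each smaller register holds a value
  needed later. Both the uniqueness of normal forms and \<open>nf_registers_le\<close> rest on
  this.\<close>

lemma nf_Fresh_reused:
  assumes "nf u" "i < length u" "snd (u ! i) = Fresh r" "1 \<le> q" "q < r"
  obtains j where "i < j" "j < length u" "snd (u ! j) = Reuse q"
    "current (take j u) q = current (take i u) q" "opens (take i u) q \<noteq> []"
proof -
  define v where "v = take (Suc i) u"
  have v: "v = take i u @ [u ! i]" using assms(2) by (simp add: v_def take_Suc_conv_app_nth)
  have u: "v @ drop (Suc i) u = u" by (simp add: v_def)
  have "pre u" "obs u = []" using assms(1) by (auto simp: nf_def)
  moreover have "q \<in> set (obs v)" using assms by (auto simp: v)
  ultimately obtain z1 a z2 where z: "drop (Suc i) u = z1 @ (a, Reuse q) # z2"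
    "\<forall>x\<in>set z1. snd x \<noteq> Fresh q"
    using obligation_discharged[of v "drop (Suc i) u" q] u by auto
  define j where "j = length (v @ z1)"
  have uj: "u = (v @ z1) @ (a, Reuse q) # z2" using u z(1) by simp
  have "length v = Suc i" using assms(2) by (simp add: v_def)
  then have "i < j" by (simp add: j_def)
  moreover have "j < length u" by (subst uj) (simp add: j_def)
  moreover have "snd (u ! j) = Reuse q" by (subst uj) (simp only: j_def nth_append_length snd_conv)
  moreover have "take j u = v @ z1" by (subst uj) (simp add: j_def)
  then have "current (take j u) q = current (take i u) q"
    using z(2) assms by (simp add: current_append_no_Fresh v)
  moreover have "ok (take i u) (Fresh r)"
    using \<open>pre u\<close> assms(2,3) by (auto simp: pre_def)
  then have "opens (take i u) q \<noteq> []" using assms by (auto simp: ok_def)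
  ultimately show thesis using that by blast
qed

text \<open>If \<open>q < r\<close>, then \<open>u\<close> later reuses, at some \<open>j\<close>,
  the value that register \<open>q\<close> holds before \<open>i\<close>. In \<open>v\<close> this
  value was put into register \<open>q\<close> as well, since the prefixes agree, but register
  \<open>q\<close> is overwritten at \<open>i\<close>; so \<open>v\<close> cannot refer to the value
  at \<open>j\<close>.\<close>

lemma nf_Fresh_le:
  assumes nf: "nf u" "nf v" and dat: "dat u = dat v" and i: "i < length u"
    and same: "take i u = take i v" and F: "snd (u ! i) = Fresh r" "snd (v ! i) = Fresh q"
  shows "r \<le> q"
proof (rule ccontr)
  assume "\<not> r \<le> q"
  then have "q < r" by simp
  have len: "length v = length u" using dat by (metis length_dat)
  have "ok (take i v) (Fresh q)" using nf(2) i F len by (auto simp: nf_def pre_def)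
  then have "1 \<le> q" by (simp add: ok_def)
  then obtain j where j: "i < j" "j < length u" "snd (u ! j) = Reuse q"
    "current (take j u) q = current (take i u) q" "opens (take i u) q \<noteq> []"
    using nf_Fresh_reused[OF nf(1) i F(1) _ \<open>q < r\<close>] by blast
  define p where "p = current (take i u) q"
  have p: "p < i" "snd (u ! p) = Fresh q" "snd (v ! p) = Fresh q"
    using current_Fresh[OF j(5)] i same unfolding p_def
    by (auto simp: len) (metis nth_take same current_Fresh(2) j(5))
  have "snd (dat v ! j) = p"
    using j dat by (metis dval_def nth_dat p_def reg_op.disc(2) reg_op.sel(2) snd_conv)
  then have dv: "dval (take j v) (snd (v ! j)) = p" using j len by (simp add: nth_dat)
  then have nF: "\<not> is_Fresh (snd (v ! j))" using p j len by (auto simp: dval_def)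
  define q' where "q' = reg (snd (v ! j))"
  have cp: "current (take j v) q' = p" using dv nF by (simp add: dval_def q'_def)
  have "opens (take j v) q' \<noteq> []"
    using nf_imp_well_formed[OF nf(2)] nF j len by (auto simp: well_formed_def q'_def)
  from current_Fresh(2)[OF this] have "snd (v ! p) = Fresh q'" using cp p j by simp
  then have "q' = q" using p by simp
  moreover have "i \<le> current (take j v) q"
    using F j len by (intro current_greatest) auto
  ultimately show False using cp p by simp
qed

lemma nf_unique:
  assumes nf: "nf u" "nf v" and dat: "dat u = dat v"
  shows "u = v"
proof -
  have len: "length v = length u" using dat by (metis length_dat)
  have "take i u = take i v" if "i \<le> length u" for i
    using that
  proof (induction i)
    case (Suc i)
    then have i: "i < length u" and same: "take i u = take i v" by auto
    have "dat u ! i = dat v ! i" using dat by simp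
    then have e: "fst (u ! i) = fst (v ! i)"
      "dval (take i u) (snd (u ! i)) = dval (take i u) (snd (v ! i))"
      using i len same by (auto simp: nth_dat)
    have well_formed: "is_Fresh (snd (u ! i)) \<or> opens (take i u) (reg (snd (u ! i))) \<noteq> []"
      "is_Fresh (snd (v ! i)) \<or> opens (take i u) (reg (snd (v ! i))) \<noteq> []"
      using nf_imp_well_formed[OF nf(1)] nf_imp_well_formed[OF nf(2)] i len unfolding well_formed_def same by (metis same)+
    from dval_eq_length_iff[OF well_formed(1)] dval_eq_length_iff[OF well_formed(2)] e(2)
    have F: "is_Fresh (snd (u ! i)) \<longleftrightarrow> is_Fresh (snd (v ! i))" by simp
    have "snd (u ! i) = snd (v ! i)"
    proof (cases "is_Fresh (snd (u ! i))")
      case True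
      then obtain r q where rq: "snd (u ! i) = Fresh r" "snd (v ! i) = Fresh q"
        using F by (metis reg_op.collapse(1))
      have "r \<le> q" by (rule nf_Fresh_le[OF nf dat i same rq])
      moreover have "q \<le> r"
        using i len by (intro nf_Fresh_le[OF nf(2,1) dat[symmetric] _ same[symmetric] rq(2,1)]) simp
      ultimately show ?thesis using rq by simp
    next
      case False
      then obtain r q where rq: "snd (u ! i) = Reuse r" "snd (v ! i) = Reuse q"
        using F by (metis reg_op.collapse(2))
      then have "current (take i u) r = current (take i u) q" using e(2) by (simp add: dval_def)
      moreover have "opens (take i u) r \<noteq> []" "opens (take i u) q \<noteq> []" using well_formed rq by auto
      ultimately have "Fresh r = Fresh q" using current_Fresh(2) by metis
      then show ?thesis using rq by simp
    qed
    then have "u ! i = v ! i" using e by (simp add: prod_eq_iff)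
    then show ?case using i len same by (simp add: take_Suc_conv_app_nth)
  qed simp
  from this[of "length u"] len show ?thesis by simp
qed

lemma eq_snf_iff: "u = snf w \<longleftrightarrow> nf u \<and> dat u = pattern w"
proof
  assume "nf u \<and> dat u = pattern w"
  then show "u = snf w" using nf_unique[OF _ nf_snf[of w]] dat_snf[of w] by simp
qed (simp add: nf_snf dat_snf)

section \<open>Deterministic automata and right-invariant maps\<close>

lemma finite_Gam: "finite (Gam k)"
proof -
  have "Gam k \<subseteq> Fresh ` {1..k} \<union> Reuse ` {1..k}"
  proof
    fix \<pi> assume "\<pi> \<in> Gam k"
    then show "\<pi> \<in> Fresh ` {1..k} \<union> Reuse ` {1..k}" by (cases \<pi>) (auto simp: Gam_def)
  qed
  then show ?thesis by (rule finite_subset) simp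
qed

lemma Gam_mono: "k \<le> k' \<Longrightarrow> Gam k \<subseteq> Gam k'"
  by (auto simp: Gam_def)

text \<open>\<open>f u\<close> plays the part of the state reached by \<open>u\<close>; automata are
  handled through such maps.\<close>

definition right_invariant :: "'x set \<Rightarrow> ('x list \<Rightarrow> 'q) \<Rightarrow> bool" where
  "right_invariant Al f \<longleftrightarrow>
     (\<forall>u\<in>lists Al. \<forall>v\<in>lists Al. \<forall>x\<in>Al. f u = f v \<longrightarrow> f (u @ [x]) = f (v @ [x]))"

lemma right_invariant_append:
  assumes "right_invariant Al f" "u \<in> lists Al" "v \<in> lists Al" "z \<in> lists Al" "f u = f v"
  shows "f (u @ z) = f (v @ z)"
  using assms(4)
proof (induction z rule: rev_induct)
  case Nil then show ?case using assms(5) by simp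
next
  case (snoc x z)
  then have "f (u @ z) = f (v @ z)" "u @ z \<in> lists Al" "v @ z \<in> lists Al" "x \<in> Al"
    using assms(2,3) by auto
  then have "f ((u @ z) @ [x]) = f ((v @ z) @ [x])"
    using assms(1) unfolding right_invariant_def by blast
  then show ?case by simp
qed

text \<open>The prefixes of a shortest witness have pairwise different values of \<open>f\<close>,
  because the segment between two equal ones could be cut out.\<close>

lemma short_witness:
  assumes inv: "right_invariant Al f" and fin: "finite (f ` lists Al)"
    and sat: "\<And>u v. u \<in> lists Al \<Longrightarrow> v \<in> lists Al \<Longrightarrow> f u = f v \<Longrightarrow> P u \<Longrightarrow> P v"
    and u: "u \<in> lists Al" "P u"
  obtains v where "v \<in> lists Al" "P v" "length v < card (f ` lists Al)"
proof -
  obtain v where v: "v \<in> lists Al" "P v"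
    and least: "\<And>z. z \<in> lists Al \<Longrightarrow> P z \<Longrightarrow> length v \<le> length z"
    using ex_has_least_nat[of "\<lambda>v. v \<in> lists Al \<and> P v" u length] u by blast
  have tk: "take i v \<in> lists Al" "drop i v \<in> lists Al" for i
    using v(1) by (auto dest: in_set_takeD in_set_dropD)
  have less: "f (take i v) \<noteq> f (take j v)" if "i < j" "j \<le> length v" for i j
  proof
    assume "f (take i v) = f (take j v)"
    then have "f (take i v @ drop j v) = f v"
      using right_invariant_append[OF inv tk(1) tk(1) tk(2), of i j j] by simp
    then have "P (take i v @ drop j v)" using sat[of v "take i v @ drop j v"] v tk by simp
    then have "length v \<le> length (take i v @ drop j v)" using tk by (intro least) auto
    then show False using that by simp
  qed
  have "inj_on (\<lambda>i. f (take i v)) {..length v}"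
    by (rule linorder_inj_onI) (use less in auto)
  then have "card {..length v} \<le> card (f ` lists Al)"
    using tk fin by (intro card_inj_on_le) auto
  then show thesis using that v by simp
qed

definition dfa_of :: "'s set \<Rightarrow> ('a \<times> reg_op) set \<Rightarrow> nat \<Rightarrow> ('s \<Rightarrow> 'a \<times> reg_op \<Rightarrow> 's) \<Rightarrow> 's \<Rightarrow> 's set
    \<Rightarrow> ('s, 'a) session_automaton" where
  "dfa_of Q Al k \<delta> i F = \<lparr>states = Q, registers = k, initial = i, finals = F,
     transitions = {(s, x, \<delta> s x) | s x. s \<in> Q \<and> x \<in> Al}\<rparr>"

lemma foldl_closed:
  assumes "\<And>s x. s \<in> Q \<Longrightarrow> x \<in> Al \<Longrightarrow> \<delta> s x \<in> Q" "s \<in> Q" "u \<in> lists Al"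
  shows "foldl \<delta> s u \<in> Q"
  using assms(2,3)
proof (induction u arbitrary: s)
  case (Cons x u) then show ?case using assms(1) by simp
qed simp

lemma sym_path_dfa_iff:
  assumes trans: "transitions A = {(s, x, \<delta> s x) | s x. s \<in> Q \<and> x \<in> Al}"
    and closed: "\<And>s x. s \<in> Q \<Longrightarrow> x \<in> Al \<Longrightarrow> \<delta> s x \<in> Q" and "s \<in> Q"
  shows "sym_path A s u t \<longleftrightarrow> u \<in> lists Al \<and> t = foldl \<delta> s u"
  using \<open>s \<in> Q\<close>
proof (induction u arbitrary: s)
  case (Cons x u)
  have "sym_path A s (x # u) t \<longleftrightarrow> x \<in> Al \<and> sym_path A (\<delta> s x) u t"
    using Cons.prems unfolding sym_path.simps trans by blast
  then show ?case using Cons closed[of s x] by auto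
qed auto

lemma complete_dfa_dfa_of:
  assumes "finite \<Sigma>" "finite Q" "i \<in> Q" "F \<subseteq> Q"
    and "\<And>s x. s \<in> Q \<Longrightarrow> x \<in> \<Sigma> \<times> Gam k \<Longrightarrow> \<delta> s x \<in> Q"
  shows "complete_dfa \<Sigma> k (dfa_of Q (\<Sigma> \<times> Gam k) k \<delta> i F)"
proof -
  have "{(s, x, \<delta> s x) | s x. s \<in> Q \<and> x \<in> \<Sigma> \<times> Gam k} =
      (\<lambda>(s, x). (s, x, \<delta> s x)) ` (Q \<times> (\<Sigma> \<times> Gam k))" by auto
  moreover have "finite \<dots>" using assms finite_Gam by (intro finite_imageI finite_cartesian_product)
  ultimately show ?thesis
    using assms by (auto simp: complete_dfa_def session_automaton_def dfa_of_def)
qed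

lemma sym_lang_dfa_of:
  assumes "i \<in> Q" "\<And>s x. s \<in> Q \<Longrightarrow> x \<in> Al \<Longrightarrow> \<delta> s x \<in> Q"
  shows "sym_lang (dfa_of Q Al k \<delta> i F) = {u \<in> lists Al. foldl \<delta> i u \<in> F}"
proof -
  have "sym_path (dfa_of Q Al k \<delta> i F) i u t \<longleftrightarrow> u \<in> lists Al \<and> t = foldl \<delta> i u" for u t
    using assms by (intro sym_path_dfa_iff[where Q = Q]) (auto simp: dfa_of_def)
  then show ?thesis by (auto simp: sym_lang_def) (auto simp: dfa_of_def)
qed

text \<open>The values of \<open>f\<close> serve as states, numbered because
  \<open>min_dfa_size\<close> ranges over automata on \<open>nat\<close>; a transition is computed
  at a representative word.\<close>

lemma complete_dfa_exists:
  assumes "finite \<Sigma>" and inv: "right_invariant (\<Sigma> \<times> Gam k) f"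
    and fin: "finite (f ` lists (\<Sigma> \<times> Gam k))" and K: "K \<subseteq> lists (\<Sigma> \<times> Gam k)"
    and sat: "\<And>u v. u \<in> lists (\<Sigma> \<times> Gam k) \<Longrightarrow> v \<in> lists (\<Sigma> \<times> Gam k) \<Longrightarrow> f u = f v \<Longrightarrow> u \<in> K \<Longrightarrow> v \<in> K"
  obtains B :: "(nat, 'a) session_automaton" where "complete_dfa \<Sigma> k B" "sym_lang B = K"
proof -
  let ?Al = "\<Sigma> \<times> Gam k"
  obtain g :: "_ \<Rightarrow> nat" where g: "inj_on g (f ` lists ?Al)"
    using finite_imp_inj_to_nat_seg[OF fin] by blast
  define h where "h = (\<lambda>u. g (f u))"
  have h: "h u = h v \<longleftrightarrow> f u = f v" if "u \<in> lists ?Al" "v \<in> lists ?Al" for u v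
    using g that by (auto simp: h_def inj_on_def)
  define rep where "rep = (\<lambda>s. SOME u. u \<in> lists ?Al \<and> h u = s)"
  define \<delta> where "\<delta> = (\<lambda>s x. h (rep s @ [x]))"
  have rep: "rep (h u) \<in> lists ?Al \<and> h (rep (h u)) = h u" if "u \<in> lists ?Al" for u
    unfolding rep_def by (rule someI[of _ u]) (use that in simp)
  have \<delta>: "\<delta> (h u) x = h (u @ [x])" if "u \<in> lists ?Al" "x \<in> ?Al" for u x
  proof -
    have r: "rep (h u) \<in> lists ?Al" "f (rep (h u)) = f u"
      using rep[OF that(1)] h[of "rep (h u)" u] that(1) by auto
    then have "f (rep (h u) @ [x]) = f (u @ [x])"
      using inv that unfolding right_invariant_def by blast
    then show ?thesis by (simp add: \<delta>_def h_def)
  qed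
  have fold: "foldl \<delta> (h []) u = h u" if "u \<in> lists ?Al" for u
    using that by (induction u rule: rev_induct) (auto simp: \<delta>)
  define B where "B = dfa_of (h ` lists ?Al) ?Al k \<delta> (h []) (h ` K)"
  have closed: "\<delta> s x \<in> h ` lists ?Al" if s: "s \<in> h ` lists ?Al" and x: "x \<in> ?Al" for s x
  proof -
    obtain u where "u \<in> lists ?Al" "s = h u" using s by blast
    then show ?thesis using \<delta>[of u x] x by (auto intro!: imageI)
  qed
  have "finite (h ` lists ?Al)" using fin by (simp add: h_def image_image[symmetric])
  then have "complete_dfa \<Sigma> k B"
    unfolding B_def using assms(1) K closed by (intro complete_dfa_dfa_of) auto
  moreover have "sym_lang B = K"
  proof -
    have "sym_lang B = {u \<in> lists ?Al. foldl \<delta> (h []) u \<in> h ` K}"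
      unfolding B_def using closed by (intro sym_lang_dfa_of) auto
    also have "\<dots> = K"
    proof (intro set_eqI iffI)
      fix u assume "u \<in> {u \<in> lists ?Al. foldl \<delta> (h []) u \<in> h ` K}"
      then have u: "u \<in> lists ?Al" and "h u \<in> h ` K" using fold[of u] by simp_all
      then obtain v where v: "v \<in> K" "h u = h v" by auto
      with K have vl: "v \<in> lists ?Al" by blast
      then show "u \<in> K" using sat[OF vl u] h[OF u vl] v by simp
    next
      fix u assume "u \<in> K"
      with K have "u \<in> lists ?Al" by blast
      with fold[OF this] \<open>u \<in> K\<close> show "u \<in> {u \<in> lists ?Al. foldl \<delta> (h []) u \<in> h ` K}" by simp
    qed
    finally show ?thesis .
  qed
  ultimately show thesis using that by blast
qed

lemma complete_dfa_reach:
  assumes "complete_dfa \<Sigma> k B"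
  obtains \<rho> where "\<And>u. u \<in> lists (\<Sigma> \<times> Gam k) \<Longrightarrow> \<rho> u \<in> states B"
    "right_invariant (\<Sigma> \<times> Gam k) \<rho>"
    "sym_lang B = {u \<in> lists (\<Sigma> \<times> Gam k). \<rho> u \<in> finals B}"
proof -
  let ?Al = "\<Sigma> \<times> Gam k"
  define \<delta> where "\<delta> = (\<lambda>s x. THE s'. (s, x, s') \<in> transitions B)"
  have B: "initial B \<in> states B" "transitions B \<subseteq> states B \<times> ?Al \<times> states B"
    and ex1: "\<And>s x. s \<in> states B \<Longrightarrow> x \<in> ?Al \<Longrightarrow> \<exists>!s'. (s, x, s') \<in> transitions B"
    using assms unfolding complete_dfa_def session_automaton_def by blast+
  have in_trans: "(s, x, \<delta> s x) \<in> transitions B" if "s \<in> states B" "x \<in> ?Al" for s x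
    unfolding \<delta>_def by (rule theI') (rule ex1[OF that])
  have "(s, x, s') \<in> transitions B \<longleftrightarrow> s \<in> states B \<and> x \<in> ?Al \<and> s' = \<delta> s x" for s x s'
    using B(2) in_trans ex1 by blast
  then have trans: "transitions B = {(s, x, \<delta> s x) | s x. s \<in> states B \<and> x \<in> ?Al}" by auto
  have closed: "\<delta> s x \<in> states B" if "s \<in> states B" "x \<in> ?Al" for s x
    using in_trans[OF that] B(2) by auto
  let ?\<rho> = "foldl \<delta> (initial B)"
  have "u \<in> lists ?Al \<Longrightarrow> ?\<rho> u \<in> states B" for u
    using closed B(1) by (rule foldl_closed)
  moreover have "right_invariant ?Al ?\<rho>" by (simp add: right_invariant_def)
  moreover have "sym_lang B = {u \<in> lists ?Al. ?\<rho> u \<in> finals B}"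
    using sym_path_dfa_iff[OF trans closed B(1)] by (auto simp: sym_lang_def)
  ultimately show thesis using that by blast
qed

text \<open>The easy half of Myhill-Nerode: words reaching the same state are separated by no
  suffix.\<close>

lemma card_inequivalent_le:
  assumes "complete_dfa \<Sigma> k B" "W \<subseteq> lists (\<Sigma> \<times> Gam k)"
    and ineq: "\<And>u v. u \<in> W \<Longrightarrow> v \<in> W \<Longrightarrow> u \<noteq> v \<Longrightarrow> \<exists>z. (u @ z \<in> sym_lang B) \<noteq> (v @ z \<in> sym_lang B)"
  shows "card W \<le> card (states B)"
proof -
  obtain \<rho> where \<rho>: "\<And>u. u \<in> lists (\<Sigma> \<times> Gam k) \<Longrightarrow> \<rho> u \<in> states B"
    "right_invariant (\<Sigma> \<times> Gam k) \<rho>" "sym_lang B = {u \<in> lists (\<Sigma> \<times> Gam k). \<rho> u \<in> finals B}"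
    using complete_dfa_reach[OF assms(1)] by blast
  have "inj_on \<rho> W"
  proof (rule inj_onI, rule ccontr)
    fix u v assume uv: "u \<in> W" "v \<in> W" "\<rho> u = \<rho> v" "u \<noteq> v"
    then obtain z where z: "(u @ z \<in> sym_lang B) \<noteq> (v @ z \<in> sym_lang B)" using ineq by blast
    have l: "u \<in> lists (\<Sigma> \<times> Gam k)" "v \<in> lists (\<Sigma> \<times> Gam k)" using uv assms(2) by auto
    \<comment> \<open>The separating suffix is over the alphabet because one of the two words is
      accepted.\<close>
    then have "z \<in> lists (\<Sigma> \<times> Gam k)" using z \<rho>(3) by auto
    then show False using z right_invariant_append[OF \<rho>(2) l _ uv(3)] l \<rho>(3) by auto
  qed
  moreover have "\<rho> ` W \<subseteq> states B" using \<rho>(1) assms(2) by blast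
  moreover have "finite (states B)"
    using assms(1) by (auto simp: complete_dfa_def session_automaton_def)
  ultimately show ?thesis by (rule card_inj_on_le)
qed

section \<open>Regularity of the set of normal forms\<close>

text \<open>This is all that \<open>ok\<close> inspects for operations in \<open>Gam k\<close>.
  \<open>None\<close> is the sink, and each of the two sets has at most \<open>2 ^ k\<close> values,
  whence the bound \<open>Suc (4 ^ k)\<close>.\<close>

definition nf_state :: "nat \<Rightarrow> ('a \<times> reg_op) list \<Rightarrow> (nat set \<times> nat set) option" where
  "nf_state k u = (if pre u then Some ({q \<in> {1..k}. opens u q \<noteq> []}, set (obs u)) else None)"

lemma nf_state_pre: "nf_state k u = nf_state k v \<Longrightarrow> pre u = pre v"
  by (auto simp: nf_state_def split: if_splits)

lemma nf_state_nf: "nf_state k u = nf_state k v \<Longrightarrow> nf u = nf v"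
  by (auto simp: nf_state_def nf_def split: if_splits)

lemma nf_state_ok:
  assumes "nf_state k u = nf_state k v" "pre u" "\<pi> \<in> Gam k"
  shows "ok u \<pi> = ok v \<pi>"
proof -
  have e: "{q \<in> {1..k}. opens u q \<noteq> []} = {q \<in> {1..k}. opens v q \<noteq> []}" "set (obs u) = set (obs v)"
    using assms by (auto simp: nf_state_def split: if_splits)
  have "opens u q = [] \<longleftrightarrow> opens v q = []" if "1 \<le> q" "q \<le> k" for q
    using e(1) that by (auto simp: set_eq_iff)
  then show ?thesis using assms(3) e(2) by (auto simp: ok_def Gam_def)
qed

lemma right_invariant_nf_state: "right_invariant (\<Sigma> \<times> Gam k) (nf_state k)"
proof -
  have "nf_state k (u @ [x]) = nf_state k (v @ [x])"
    if e: "nf_state k u = nf_state k v" and x: "x \<in> \<Sigma> \<times> Gam k" for u v :: "('a \<times> reg_op) list" and x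
  proof (cases "pre u")
    case True
    obtain a \<pi> where [simp]: "x = (a, \<pi>)" by (cases x)
    have pv: "pre v" using nf_state_pre[OF e] True by simp
    have e': "{q \<in> {1..k}. opens u q \<noteq> []} = {q \<in> {1..k}. opens v q \<noteq> []}" "set (obs u) = set (obs v)"
      using e True pv by (auto simp: nf_state_def)
    have "ok u \<pi> = ok v \<pi>" using nf_state_ok[OF e True] x by simp
    moreover have "{q \<in> {1..k}. opens (u @ [x]) q \<noteq> []} = {q \<in> {1..k}. opens (v @ [x]) q \<noteq> []}"
      using e'(1) by (auto simp: set_eq_iff)
    moreover have "set (obs (u @ [x])) = set (obs (v @ [x]))" using e'(2) by auto
    ultimately show ?thesis using True pv by (simp add: nf_state_def del: obs_snoc opens_snoc)
  next
    case False
    then have "\<not> pre v" using nf_state_pre[OF e] by simp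
    with False show ?thesis by (simp add: nf_state_def)
  qed
  then show ?thesis unfolding right_invariant_def by blast
qed

lemma obs_subset: "u \<in> lists (\<Sigma> \<times> Gam k) \<Longrightarrow> set (obs u) \<subseteq> {1..k}"
  by (induction u rule: rev_induct) (auto simp: Gam_def)

lemma nf_state_range:
  "nf_state k ` lists (\<Sigma> \<times> Gam k) \<subseteq> insert None (Some ` (Pow {1..k} \<times> Pow {1..k}))"
proof
  fix y assume "y \<in> nf_state k ` lists (\<Sigma> \<times> Gam k)"
  then obtain u where "u \<in> lists (\<Sigma> \<times> Gam k)" "y = nf_state k u" by blast
  with obs_subset[of u \<Sigma> k] show "y \<in> insert None (Some ` (Pow {1..k} \<times> Pow {1..k}))"
    by (auto simp: nf_state_def)
qed

lemma finite_nf_state_range: "finite (nf_state k ` lists (\<Sigma> \<times> Gam k))"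
  by (rule finite_subset[OF nf_state_range]) simp

lemma card_nf_state_range: "card (nf_state k ` lists (\<Sigma> \<times> Gam k)) \<le> Suc (4 ^ k)"
proof -
  have "card (nf_state k ` lists (\<Sigma> \<times> Gam k)) \<le> card (insert None (Some ` (Pow {1..k} \<times> Pow {1..k})))"
    by (rule card_mono[OF _ nf_state_range]) simp
  also have "\<dots> = Suc (card (Pow {1..k} \<times> Pow {1..k}))"
    by (subst card_insert_disjoint) (auto simp: card_image)
  also have "card (Pow {1..k} \<times> Pow {1..k}) = 2 ^ k * 2 ^ k"
    by (simp only: card_cartesian_product card_Pow finite_atLeastAtMost card_atLeastAtMost) simp
  also have "(2 :: nat) ^ k * 2 ^ k = 4 ^ k" by (simp flip: power_mult_distrib)
  finally show ?thesis .
qed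

lemma dval_le: "dval u \<pi> \<le> length u"
  using current_Fresh(1)[of u "reg \<pi>"] by (auto simp: dval_def current_def)

text \<open>A value of \<open>dat u\<close> is the position of its first occurrence, so
  \<open>pattern\<close> undoes any injective renaming of values.\<close>

lemma pattern_dat:
  assumes "well_formed u" "inj \<nu>"
  shows "pattern (map (map_prod h \<nu>) (dat u)) = map (map_prod h id) (dat u)"
  using assms(1)
proof (induction u rule: rev_induct)
  case Nil then show ?case by (simp add: pattern_def)
next
  case (snoc x u)
  let ?w = "map (map_prod h \<nu>) (dat u)"
  obtain a \<pi> where x: "x = (a, \<pi>)" by (cases x)
  have snd_w: "snd (?w ! j) = \<nu> (dval (take j u) (snd (u ! j)))" if "j < length u" for j
    using that by (simp add: nth_dat)
  have "(if \<nu> (dval u \<pi>) \<in> snd ` set ?w then first_pos ?w (\<nu> (dval u \<pi>)) else length ?w) = dval u \<pi>"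
  proof (cases "is_Fresh \<pi>")
    case True
    have "\<nu> (length u) \<notin> snd ` set ?w"
    proof
      assume "\<nu> (length u) \<in> snd ` set ?w"
      then obtain j where j: "j < length u" "snd (?w ! j) = \<nu> (length u)"
        by (metis (no_types, lifting) image_iff in_set_conv_nth length_dat length_map)
      then have "dval (take j u) (snd (u ! j)) = length u"
        using snd_w[OF j(1)] assms(2) by (auto dest: injD)
      then show False using dval_le[of "take j u" "snd (u ! j)"] j by simp
    qed
    with True show ?thesis by (simp add: dval_def)
  next
    case False
    then have o: "opens u (reg \<pi>) \<noteq> []" using snoc.prems by (simp add: x)
    let ?c = "current u (reg \<pi>)"
    have c: "?c < length u" "dval u \<pi> = ?c" using current_Fresh(1)[OF o] False by (auto simp: dval_def)
    have wc: "snd (?w ! ?c) = \<nu> ?c"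
      using snd_w[OF c(1)] dat_nth_current[OF o] c(1) by (simp add: nth_dat)
    have "first_pos ?w (\<nu> ?c) = ?c"
    proof (rule first_pos_eqI)
      fix j assume j: "j < ?c"
      then have "dval (take j u) (snd (u ! j)) \<noteq> ?c"
        using dval_le[of "take j u" "snd (u ! j)"] c(1) by auto
      then show "snd (?w ! j) \<noteq> \<nu> ?c" using snd_w[of j] j c(1) assms(2) by (auto dest: injD)
    qed (use wc c(1) in auto)
    moreover have "\<nu> ?c \<in> snd ` set ?w" using wc c(1) by (metis image_eqI length_dat length_map nth_mem)
    ultimately show ?thesis using c(2) by simp
  qed
  then show ?case using snoc by (simp add: x pattern_snoc)
qed

text \<open>Acceptance depends on the pattern of a data word only. Infinity of \<open>D\<close>
  serves to realize the data word of \<open>u\<close> by distinct values.\<close>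

lemma snf_data_lang_iff:
  fixes \<Sigma> :: "'a set" and D :: "'d set"
  assumes "infinite D" "session_automaton \<Sigma> A"
  shows "u \<in> snf ` data_lang \<Sigma> D A \<longleftrightarrow>
    nf u \<and> (\<exists>z\<in>sym_lang A. well_formed z \<and> dat z = dat u)"
proof
  assume "u \<in> snf ` data_lang \<Sigma> D A"
  then obtain w where "w \<in> data_lang \<Sigma> D A" "u = snf w" by blast
  then show "nf u \<and> (\<exists>z\<in>sym_lang A. well_formed z \<and> dat z = dat u)"
    by (simp add: data_lang_iff nf_snf dat_snf)
next
  assume R: "nf u \<and> (\<exists>z\<in>sym_lang A. well_formed z \<and> dat z = dat u)"
  then obtain z where z: "z \<in> sym_lang A" "well_formed z" "dat z = dat u" by blast
  obtain \<nu> :: "nat \<Rightarrow> 'd" where \<nu>: "inj \<nu>" "range \<nu> \<subseteq> D"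
    using infinite_countable_subset[OF assms(1)] by blast
  define w where "w = map (map_prod id \<nu>) (dat u)"
  have pat: "pattern w = dat u"
    unfolding w_def using pattern_dat[OF nf_imp_well_formed \<nu>(1), of u id] R
    by (simp add: prod.map_id0)
  have "sym_path A s v t \<Longrightarrow> fst ` set v \<subseteq> \<Sigma>" for s v t
    using assms(2) by (induction v arbitrary: s) (fastforce simp: session_automaton_def)+
  then have "fst ` set z \<subseteq> \<Sigma>" using z(1) unfolding sym_lang_def by blast
  then have "set (map fst (dat z)) \<subseteq> \<Sigma>" by (simp only: map_fst_dat) simp
  then have "w \<in> lists (\<Sigma> \<times> D)" using \<nu>(2) z(3) by (fastforce simp: w_def)
  then have "w \<in> data_lang \<Sigma> D A" using z pat by (auto simp: data_lang_iff)
  moreover have "u = snf w" using R pat by (simp add: eq_snf_iff)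
  ultimately show "u \<in> snf ` data_lang \<Sigma> D A" by blast
qed

text \<open>
  Besides the normal form \<open>u\<close>, the automaton also tracks the runs of \<open>A\<close> on the data word of \<open>u\<close>,
  each with the set of pairs of registers, one of \<open>A\<close> and one of \<open>u\<close>, that hold the same value.
\<close>

definition linked :: "nat \<Rightarrow> nat \<Rightarrow> ('a \<times> reg_op) list \<Rightarrow> ('a \<times> reg_op) list \<Rightarrow> (nat \<times> nat) set" where
  "linked l k z u = {(p, q) \<in> {1..l} \<times> {1..k}. opens z p \<noteq> [] \<and> opens u q \<noteq> [] \<and> current z p = current u q}"

definition runs :: "('s, 'a) session_automaton \<Rightarrow> nat \<Rightarrow> ('a \<times> reg_op) list \<Rightarrow> ('s \<times> (nat \<times> nat) set) set" where
  "runs A k u = {(s, E). \<exists>z. sym_path A (initial A) z s \<and> well_formed z \<and> dat z = dat u \<and>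
     E = linked (registers A) k z u}"

text \<open>The two overwritten registers lose their old partners, and a fresh value equals no older
  one, so the new pair is the only link of either.\<close>

lemma linked_snoc_Fresh:
  assumes "length z = length u" "1 \<le> p" "p \<le> l" "1 \<le> q" "q \<le> k"
  shows "linked l k (z @ [(a, Fresh p)]) (u @ [(b, Fresh q)]) =
    insert (p, q) {(p', q') \<in> linked l k z u. p' \<noteq> p \<and> q' \<noteq> q}"
proof -
  have "(p', q') \<in> linked l k (z @ [(a, Fresh p)]) (u @ [(b, Fresh q)]) \<longleftrightarrow>
      (p', q') \<in> insert (p, q) {(p', q') \<in> linked l k z u. p' \<noteq> p \<and> q' \<noteq> q}" for p' q'
    using assms current_Fresh(1)[of z p'] current_Fresh(1)[of u q']
    by (cases "p' = p"; cases "q' = q") (auto simp: linked_def)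
  then show ?thesis by auto
qed

lemma linked_snoc_Reuse:
  "linked l k (z @ [(a, Reuse p)]) (u @ [(b, Reuse q)]) = linked l k z u"
  by (simp add: linked_def)

text \<open>The right-hand side mentions \<open>u\<close> only through \<open>runs A k u\<close>:
  \<open>A\<close> can follow a reuse of \<open>reg \<pi>\<close> exactly through a register linked
  to it, whatever the value is. Hence \<open>runs\<close> can be updated by a finite
  automaton.\<close>

lemma runs_snoc:
  assumes A: "session_automaton \<Sigma> A" and u: "ok u \<pi>" and \<pi>: "\<pi> \<in> Gam k"
  shows "(s', E') \<in> runs A k (u @ [(a, \<pi>)]) \<longleftrightarrow> (\<exists>s E \<rho>. (s, E) \<in> runs A k u \<and>
    (s, (a, \<rho>), s') \<in> transitions A \<and> is_Fresh \<rho> = is_Fresh \<pi> \<and>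
    (if is_Fresh \<pi> then E' = insert (reg \<rho>, reg \<pi>) {(p, q) \<in> E. p \<noteq> reg \<rho> \<and> q \<noteq> reg \<pi>}
     else (reg \<rho>, reg \<pi>) \<in> E \<and> E' = E))"  (is "?L \<longleftrightarrow> ?R")
proof
  assume ?L
  then obtain z' where z': "sym_path A (initial A) z' s'" "well_formed z'"
    "dat z' = dat (u @ [(a, \<pi>)])" "E' = linked (registers A) k z' (u @ [(a, \<pi>)])"
    by (auto simp: runs_def)
  have "length z' = Suc (length u)" using z'(3) by (metis length_append_singleton length_dat)
  then obtain z b \<rho> where zx: "z' = z @ [(b, \<rho>)]" by (cases z' rule: rev_cases) auto
  then obtain s where s: "sym_path A (initial A) z s" "(s, (b, \<rho>), s') \<in> transitions A"
    using z'(1) by (auto simp: sym_path_append)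
  have e: "dat z = dat u" "b = a" "dval z \<rho> = dval u \<pi>" using z'(3) by (auto simp: zx)
  have len: "length z = length u" using e(1) by (metis length_dat)
  have wf: "well_formed z" "is_Fresh \<rho> \<or> opens z (reg \<rho>) \<noteq> []" using z'(2) by (auto simp: zx)
  have wf': "is_Fresh \<pi> \<or> opens u (reg \<pi>) \<noteq> []" using u by (auto simp: ok_def split: if_splits)
  have F: "is_Fresh \<rho> = is_Fresh \<pi>"
    using dval_eq_length_iff[OF wf(2)] dval_eq_length_iff[OF wf'] e(3) len by simp
  have \<rho>: "\<rho> \<in> Gam (registers A)" using s(2) A by (auto simp: session_automaton_def)
  have "(s, linked (registers A) k z u) \<in> runs A k u" using s wf e by (auto simp: runs_def)
  moreover have "if is_Fresh \<pi> then E' = insert (reg \<rho>, reg \<pi>)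
      {(p, q) \<in> linked (registers A) k z u. p \<noteq> reg \<rho> \<and> q \<noteq> reg \<pi>}
    else (reg \<rho>, reg \<pi>) \<in> linked (registers A) k z u \<and> E' = linked (registers A) k z u"
  proof (cases \<pi>)
    case (Fresh q)
    then obtain p where p: "\<rho> = Fresh p" using F by (cases \<rho>) auto
    then show ?thesis using Fresh \<rho> \<pi> len z'(4) linked_snoc_Fresh[of z u p "registers A" q k b a]
      by (simp add: zx Gam_def)
  next
    case (Reuse q)
    then obtain p where p: "\<rho> = Reuse p" using F by (cases \<rho>) auto
    then have "(p, q) \<in> linked (registers A) k z u"
      using Reuse e(3) wf wf' \<rho> \<pi> by (auto simp: linked_def dval_def Gam_def)
    then show ?thesis using Reuse p z'(4) by (simp add: zx linked_snoc_Reuse)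
  qed
  ultimately show ?R using s(2) e(2) F by blast
next
  assume ?R
  then obtain s E \<rho> where R: "(s, E) \<in> runs A k u" "(s, (a, \<rho>), s') \<in> transitions A"
    "is_Fresh \<rho> = is_Fresh \<pi>"
    "if is_Fresh \<pi> then E' = insert (reg \<rho>, reg \<pi>) {(p, q) \<in> E. p \<noteq> reg \<rho> \<and> q \<noteq> reg \<pi>}
     else (reg \<rho>, reg \<pi>) \<in> E \<and> E' = E"
    by blast
  then obtain z where z: "sym_path A (initial A) z s" "well_formed z" "dat z = dat u"
    "E = linked (registers A) k z u"
    by (auto simp: runs_def)
  have len: "length z = length u" using z(3) by (metis length_dat)
  have \<rho>: "\<rho> \<in> Gam (registers A)" using R(2) A by (auto simp: session_automaton_def)
  have "well_formed (z @ [(a, \<rho>)]) \<and> dval z \<rho> = dval u \<pi> \<and>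
      E' = linked (registers A) k (z @ [(a, \<rho>)]) (u @ [(a, \<pi>)])"
  proof (cases \<pi>)
    case (Fresh q)
    then obtain p where p: "\<rho> = Fresh p" using R(3) by (cases \<rho>) auto
    then show ?thesis using Fresh \<rho> \<pi> len z R(4) linked_snoc_Fresh[of z u p "registers A" q k a a]
      by (simp add: Gam_def dval_def)
  next
    case (Reuse q)
    then obtain p where p: "\<rho> = Reuse p" using R(3) by (cases \<rho>) auto
    then show ?thesis using Reuse R(4) z by (auto simp: linked_snoc_Reuse linked_def dval_def)
  qed
  moreover have "sym_path A (initial A) (z @ [(a, \<rho>)]) s'"
    using z(1) R(2) by (auto simp: sym_path_append)
  ultimately show ?L using z(3) by (auto simp: runs_def intro!: exI[of _ "z @ [(a, \<rho>)]"])
qed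

lemma snf_data_lang_regular:
  assumes fin: "finite \<Sigma>" "infinite D" and A: "session_automaton \<Sigma> A"
    and K: "snf ` data_lang \<Sigma> D A \<subseteq> lists (\<Sigma> \<times> Gam k)"
  obtains B :: "(nat, 'a) session_automaton"
    where "complete_dfa \<Sigma> k B" "sym_lang B = snf ` data_lang \<Sigma> D A"
proof -
  \<comment> \<open>\<open>runs_snoc\<close> presupposes \<open>ok\<close>; outside
    \<open>pre\<close> the second component is collapsed, since such words are never completed to a
    normal form.\<close>
  define f where "f = (\<lambda>u. (nf_state k u, if pre u then runs A k u else {}))"
  have "f (u @ [x]) = f (v @ [x])" if e: "f u = f v" and uv: "u \<in> lists (\<Sigma> \<times> Gam k)"
    "v \<in> lists (\<Sigma> \<times> Gam k)" and x: "x \<in> \<Sigma> \<times> Gam k" for u v x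
  proof -
    obtain a \<pi> where [simp]: "x = (a, \<pi>)" by (cases x)
    have \<pi>: "\<pi> \<in> Gam k" using x by simp
    have n: "nf_state k u = nf_state k v" using e by (simp add: f_def)
    have n': "nf_state k (u @ [x]) = nf_state k (v @ [x])"
      using right_invariant_nf_state uv x n unfolding right_invariant_def by blast
    then have p: "pre (u @ [x]) = pre (v @ [x])" by (rule nf_state_pre)
    have "runs A k (u @ [x]) = runs A k (v @ [x])" if "pre (u @ [x])"
    proof -
      have "pre u" "pre v" "ok u \<pi>" "ok v \<pi>" using that p by auto
      then have "runs A k u = runs A k v" using e by (simp add: f_def)
      then have "(s, E) \<in> runs A k (u @ [x]) \<longleftrightarrow> (s, E) \<in> runs A k (v @ [x])" for s E
        by (simp only: \<open>x = (a, \<pi>)\<close> runs_snoc[OF A \<open>ok u \<pi>\<close> \<pi>] runs_snoc[OF A \<open>ok v \<pi>\<close> \<pi>])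
      then show ?thesis by auto
    qed
    then show ?thesis using n' p by (simp add: f_def del: pre_snoc)
  qed
  then have inv: "right_invariant (\<Sigma> \<times> Gam k) f" unfolding right_invariant_def by blast
  have path: "sym_path A s z t \<Longrightarrow> s \<in> states A \<Longrightarrow> t \<in> states A" for s z t
    using A by (induction z arbitrary: s) (auto simp: session_automaton_def)
  have "runs A k u \<subseteq> states A \<times> Pow ({1..registers A} \<times> {1..k})" for u
    using path A by (auto simp: runs_def linked_def session_automaton_def)
  then have "(if pre u then runs A k u else {}) \<in> Pow (states A \<times> Pow ({1..registers A} \<times> {1..k}))" for u
    by simp
  then have "f ` lists (\<Sigma> \<times> Gam k) \<subseteq> nf_state k ` lists (\<Sigma> \<times> Gam k) \<times>
      Pow (states A \<times> Pow ({1..registers A} \<times> {1..k}))"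
    unfolding f_def by blast
  moreover have "finite \<dots>" using finite_nf_state_range A by (auto simp: session_automaton_def)
  ultimately have "finite (f ` lists (\<Sigma> \<times> Gam k))" by (rule finite_subset)
  moreover have "v \<in> snf ` data_lang \<Sigma> D A" if "f u = f v" "u \<in> snf ` data_lang \<Sigma> D A" for u v
  proof -
    have u: "nf u" "\<exists>z\<in>sym_lang A. well_formed z \<and> dat z = dat u"
      using that(2) unfolding snf_data_lang_iff[OF fin(2) A] by auto
    have v: "nf v" using u(1) that(1) nf_state_nf[of k u v] by (simp add: f_def)
    then have "runs A k u = runs A k v" using u(1) that(1) by (simp add: f_def nf_def)
    moreover obtain z t where "sym_path A (initial A) z t" "t \<in> finals A" "well_formed z" "dat z = dat u"
      using u(2) by (auto simp: sym_lang_def)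
    moreover from this have "(t, linked (registers A) k z u) \<in> runs A k u" by (auto simp: runs_def)
    ultimately have "(t, linked (registers A) k z u) \<in> runs A k v" by simp
    then obtain z' where "sym_path A (initial A) z' t" "well_formed z'" "dat z' = dat v"
      by (auto simp: runs_def)
    then show ?thesis
      unfolding snf_data_lang_iff[OF fin(2) A] using v \<open>t \<in> finals A\<close> by (auto simp: sym_lang_def)
  qed
  ultimately show thesis using complete_dfa_exists[OF fin(1) inv _ K] that by metis
qed

section \<open>The number of registers\<close>

lemma nf_reg_opened:
  assumes "nf u" "x \<in> set u"
  obtains i where "i < length u" "snd (u ! i) = Fresh (reg (snd x))" "1 \<le> reg (snd x)"
proof -
  obtain j where j: "j < length u" "u ! j = x" using assms(2) by (auto simp: in_set_conv_nth)
  have "\<exists>i<length u. snd (u ! i) = Fresh (reg (snd x))"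
  proof (cases "snd x")
    case (Fresh r) then show ?thesis using j by auto
  next
    case (Reuse r)
    then have "opens (take j u) r \<noteq> []"
      using nf_imp_well_formed[OF assms(1)] j by (auto simp: well_formed_def)
    then obtain i where "i < j" "snd (u ! i) = Fresh r" using j by (auto simp: opens_nonempty_iff)
    then show ?thesis using j Reuse by (intro exI[of _ i]) auto
  qed
  then obtain i where i: "i < length u" "snd (u ! i) = Fresh (reg (snd x))" by blast
  then have "ok (take i u) (Fresh (reg (snd x)))" using assms(1) by (metis nf_def pre_def)
  then show thesis using i that by (simp add: ok_def)
qed

text \<open>When \<open>u\<close> opens register \<open>r\<close>, the values in its
  \<open>r - 1\<close> smaller registers are all needed later, so a run along \<open>z\<close> must
  hold them and the fresh value in different registers. Here \<open>h q\<close> is the register of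
  \<open>z\<close> that keeps the value of register \<open>q\<close> beyond position
  \<open>i\<close>, and \<open>p0\<close> receives the fresh one; the pigeonhole principle gives the
  bound.\<close>

lemma nf_registers_le:
  assumes nf: "nf u" and z: "well_formed z" "dat z = dat u" "snd ` set z \<subseteq> Gam k"
    and i: "i < length u" "snd (u ! i) = Fresh r"
  shows "r \<le> k"
proof -
  have len: "length z = length u" using z(2) by (metis length_dat)
  have dv: "dval (take j z) (snd (z ! j)) = dval (take j u) (snd (u ! j))" if "j < length u" for j
    using arg_cong[OF z(2), of "\<lambda>w. snd (w ! j)"] that len by (simp add: nth_dat)
  have wz: "is_Fresh (snd (z ! j)) \<or> opens (take j z) (reg (snd (z ! j))) \<noteq> []" if "j < length u" for j
    using z(1) that len by (auto simp: well_formed_def)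
  have "\<exists>p c. p \<in> {1..k} \<and> c < i \<and> snd (u ! c) = Fresh q \<and> snd (z ! c) = Fresh p \<and>
      (\<forall>c'. c < c' \<and> c' \<le> i \<longrightarrow> snd (z ! c') \<noteq> Fresh p)" if q: "1 \<le> q" "q < r" for q
  proof -
    obtain j where j: "i < j" "j < length u" "snd (u ! j) = Reuse q"
      "current (take j u) q = current (take i u) q" "opens (take i u) q \<noteq> []"
      using nf_Fresh_reused[OF nf i q] by blast
    define c where "c = current (take i u) q"
    have c: "c < i" "snd (u ! c) = Fresh q" using current_Fresh[OF j(5)] i(1) by (auto simp: c_def)
    have d: "dval (take j z) (snd (z ! j)) = c" using dv[OF j(2)] j(3,4) by (simp add: dval_def c_def)
    then have nF: "\<not> is_Fresh (snd (z ! j))" using c(1) j(1,2) len by (auto simp: dval_def)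
    define p where "p = reg (snd (z ! j))"
    have o: "opens (take j z) p \<noteq> []" using wz[OF j(2)] nF by (simp add: p_def)
    have cp: "current (take j z) p = c" using d nF by (simp add: dval_def p_def)
    have "snd (z ! c) = Fresh p" using current_Fresh(2)[OF o] cp c(1) j(1) by simp
    moreover have "snd (z ! c') \<noteq> Fresh p" if "c < c' \<and> c' \<le> i" for c'
    proof
      assume "snd (z ! c') = Fresh p"
      then have "c' \<le> current (take j z) p" using that j(1,2) len by (intro current_greatest) auto
      then show False using cp that by simp
    qed
    moreover have "p \<in> {1..k}"
    proof -
      have "z ! j \<in> set z" using j(2) len by simp
      then have "snd (z ! j) \<in> Gam k" using z(3) by blast
      then show ?thesis by (simp add: Gam_def p_def)
    qed
    ultimately show ?thesis using c by blast
  qed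
  then obtain h c where h: "\<And>q. 1 \<le> q \<Longrightarrow> q < r \<Longrightarrow> h q \<in> {1..k} \<and> c q < i \<and> snd (u ! c q) = Fresh q \<and>
      snd (z ! c q) = Fresh (h q) \<and> (\<forall>c'. c q < c' \<and> c' \<le> i \<longrightarrow> snd (z ! c') \<noteq> Fresh (h q))"
    by metis
  have "is_Fresh (snd (z ! i))"
    using dval_eq_length_iff[OF wz[OF i(1)]] dv[OF i(1)] i len by (simp add: dval_def)
  then obtain p0 where p0: "snd (z ! i) = Fresh p0" by (metis reg_op.collapse(1))
  have "z ! i \<in> set z" using i(1) len by simp
  then have "snd (z ! i) \<in> Gam k" using z(3) by blast
  then have p0k: "p0 \<in> {1..k}" using p0 by (simp add: Gam_def)
  have neq0: "h q \<noteq> p0" if "1 \<le> q" "q < r" for q using h[OF that] p0 by auto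
  have neq: "h q \<noteq> h q'" if "1 \<le> q" "q < q'" "q' < r" for q q'
  proof
    assume e: "h q = h q'"
    have "1 \<le> q'" "q < r" using that by simp_all
    note hq = h[OF that(1) this(2)] and hq' = h[OF this(1) that(3)]
    have "c q \<noteq> c q'" using hq hq' that by auto
    then show False using hq hq' e by (metis less_imp_le linorder_neqE_nat)
  qed
  have "inj_on (h(r := p0)) {1..r}"
    by (rule linorder_inj_onI) (use neq neq0 in \<open>force split: if_splits\<close>)+
  moreover have "(h(r := p0)) ` {1..r} \<subseteq> {1..k}" using h p0k by fastforce
  ultimately have "card {1..r} \<le> card {1..k}" by (rule card_inj_on_le) simp
  then show ?thesis by simp
qed

lemma snf_data_lang_registers:
  assumes "infinite D" and A: "session_automaton \<Sigma> A"
  shows "snf ` data_lang \<Sigma> D A \<subseteq> lists (\<Sigma> \<times> Gam (registers A))"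
proof
  fix u assume u: "u \<in> snf ` data_lang \<Sigma> D A"
  then obtain z where nf: "nf u" and z: "z \<in> sym_lang A" "well_formed z" "dat z = dat u"
    unfolding snf_data_lang_iff[OF assms] by blast
  have "sym_path A s v t \<Longrightarrow> set v \<subseteq> \<Sigma> \<times> Gam (registers A)" for s v t
    using A by (induction v arbitrary: s) (fastforce simp: session_automaton_def)+
  then have zs: "set z \<subseteq> \<Sigma> \<times> Gam (registers A)" using z(1) by (auto simp: sym_lang_def)
  have "map fst u = map fst z" using z(3) by (metis map_fst_dat)
  then have "fst ` set u = fst ` set z" by (metis list.set_map)
  moreover have "snd x \<in> Gam (registers A)" if "x \<in> set u" for x
  proof -
    obtain i where i: "i < length u" "snd (u ! i) = Fresh (reg (snd x))" "1 \<le> reg (snd x)"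
      using nf_reg_opened[OF nf \<open>x \<in> set u\<close>] by blast
    have "reg (snd x) \<le> registers A"
      using zs by (intro nf_registers_le[OF nf z(2,3) _ i(1,2)]) auto
    with i(3) show ?thesis by (simp add: Gam_def)
  qed
  moreover have "fst ` set z \<subseteq> \<Sigma>" using zs by auto
  ultimately have "x \<in> \<Sigma> \<times> Gam (registers A)" if "x \<in> set u" for x
    using that by (metis image_eqI mem_Times_iff subsetD)
  then show "u \<in> lists (\<Sigma> \<times> Gam (registers A))" by blast
qed

text \<open>The number of registers of \<open>A\<close> is a candidate, so the \<open>LEAST\<close>
  defining \<open>snf_registers\<close> is attained.\<close>

lemma snf_registers_subset:
  assumes "infinite D" "session_automaton \<Sigma> A"
  defines "L \<equiv> data_lang \<Sigma> D A"
  shows "snf ` L \<subseteq> lists (\<Sigma> \<times> Gam (snf_registers \<Sigma> L))"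
  unfolding snf_registers_def L_def
  by (rule LeastI[where P = "\<lambda>k. snf ` data_lang \<Sigma> D A \<subseteq> lists (\<Sigma> \<times> Gam k)"])
    (rule snf_data_lang_registers[OF assms(1,2)])

lemma obs_in_completion:
  assumes "nf (v @ z)" "q \<in> set (obs v)"
  shows "Reuse q \<in> snd ` set z"
proof -
  obtain z1 a z2 where "z = z1 @ (a, Reuse q) # z2"
    using obligation_discharged[of v z q] assms by (auto simp: nf_def)
  then show ?thesis by force
qed

lemma snf_registers_le_states:
  assumes "infinite D" and A: "session_automaton \<Sigma> A" and L: "L = data_lang \<Sigma> D A"
    and k: "k = snf_registers \<Sigma> L" and B: "complete_dfa \<Sigma> k B" "sym_lang B = snf ` L"
  shows "k \<le> card (states B)"
proof (cases "k = 0")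
  case False
  let ?Al = "\<Sigma> \<times> Gam k"
  have sub: "snf ` L \<subseteq> lists ?Al" unfolding k L by (rule snf_registers_subset[OF assms(1,2)])
  have "\<not> snf ` L \<subseteq> lists (\<Sigma> \<times> Gam (k - 1))"
    using not_less_Least[of "k - 1" "\<lambda>k. snf ` L \<subseteq> lists (\<Sigma> \<times> Gam k)"] False
    by (simp add: k snf_registers_def)
  then obtain u x where u: "u \<in> snf ` L" "x \<in> set u" "x \<notin> \<Sigma> \<times> Gam (k - 1)" by blast
  then have "x \<in> ?Al" using sub by blast
  with u(3) False have x: "reg (snd x) = k" by (auto simp: Gam_def)
  have nf: "nf v" if "v \<in> snf ` L" for v using that nf_snf by blast
  obtain i where i: "i < length u" "snd (u ! i) = Fresh k"
    using nf_reg_opened[OF nf[OF u(1)] u(2)] x by metis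
  define v where "v = take (Suc i) u"
  have v: "v = take i u @ [u ! i]" "v @ drop (Suc i) u = u"
    unfolding v_def by (rule take_Suc_conv_app_nth[OF i(1)], rule append_take_drop_id)
  have uAl: "u \<in> lists ?Al" using u(1) sub by blast
  have vAl: "v \<in> lists ?Al" "drop (Suc i) u \<in> lists ?Al"
    using uAl v(2) by (metis append_in_lists_conv)+
  obtain \<rho> where \<rho>: "\<And>u. u \<in> lists ?Al \<Longrightarrow> \<rho> u \<in> states B"
    "right_invariant ?Al \<rho>" "sym_lang B = {u \<in> lists ?Al. \<rho> u \<in> finals B}"
    using complete_dfa_reach[OF B(1)] by blast
  have fin: "finite (states B)" using B(1) by (auto simp: complete_dfa_def session_automaton_def)
  have range: "(\<lambda>z. \<rho> (v @ z)) ` lists ?Al \<subseteq> states B"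
    by (intro image_subsetI \<rho>(1)) (use vAl in simp)
  have inv: "right_invariant ?Al (\<lambda>z. \<rho> (v @ z))"
    unfolding right_invariant_def
  proof (intro ballI impI)
    fix z z' x assume "z \<in> lists ?Al" "z' \<in> lists ?Al" "x \<in> ?Al" "\<rho> (v @ z) = \<rho> (v @ z')"
    then show "\<rho> (v @ z @ [x]) = \<rho> (v @ z' @ [x])"
      using right_invariant_append[OF \<rho>(2), of "v @ z" "v @ z'" "[x]"] vAl by simp
  qed
  obtain z where z: "z \<in> lists ?Al" "v @ z \<in> snf ` L"
    "length z < card ((\<lambda>z. \<rho> (v @ z)) ` lists ?Al)"
  proof (rule short_witness[OF inv, where P = "\<lambda>z. v @ z \<in> snf ` L"])
    show "finite ((\<lambda>z. \<rho> (v @ z)) ` lists ?Al)" using range fin by (rule finite_subset)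
    show "drop (Suc i) u \<in> lists ?Al" by (rule vAl)
    show "v @ drop (Suc i) u \<in> snf ` L" using u(1) v(2) by simp
    show "v @ z' \<in> snf ` L" if "z \<in> lists ?Al" "z' \<in> lists ?Al" "\<rho> (v @ z) = \<rho> (v @ z')" "v @ z \<in> snf ` L" for z z'
      using that vAl \<rho>(3) B(2) by auto
  qed
  \<comment> \<open>The reuses of different registers are different letters, so \<open>z\<close> has
    length at least \<open>k - 1\<close>; the strict bound on its length makes up for the missing
    one.\<close>
  have "Reuse ` {1..<k} \<subseteq> snd ` set z"
    using obs_in_completion[OF nf[OF z(2)]] i by (auto simp: v(1))
  then have "card (Reuse ` {1..<k}) \<le> card (snd ` set z)" by (intro card_mono) auto
  also have "\<dots> \<le> length z" by (meson card_image_le card_length finite_set le_trans)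
  also have "card (Reuse ` {1..<k}) = k - 1" by (subst card_image) (auto simp: inj_on_def)
  finally have "k - 1 \<le> length z" .
  also have "length z < card (states B)" using z(3) card_mono[OF fin range] by simp
  finally show ?thesis by simp
qed simp

section \<open>The learner\<close>

lemma effective_opens [effective_intros]:
  assumes "effective u" "effective r"
  shows "effective (\<lambda>x. opens (u x) (r x))"
proof -
  have "opens v q = filter (\<lambda>j. snd (nth_default undefined v j) = Fresh q) [0..<length v]"
    for v :: "('b \<times> reg_op) list" and q
    unfolding opens_def by (rule filter_cong) auto
  then show ?thesis
    by (simp only:) (intro effective_intros effective_comp[OF assms(1)] effective_comp[OF assms(2)] assms)
qed

lemma effective_current [effective_intros]:
  assumes "effective u" "effective r"
  shows "effective (\<lambda>x. current (u x) (r x))"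
proof -
  have "current v q = first 0 (rev (opens v q))" for v :: "('b \<times> reg_op) list" and q
    by (simp add: current_def first_def hd_rev)
  then show ?thesis by (simp only:) (intro effective_intros assms)
qed

lemma effective_dval [effective_intros]:
  "effective u \<Longrightarrow> effective p \<Longrightarrow> effective (\<lambda>x. dval (u x) (p x))"
  unfolding dval_def by (intro effective_intros)

lemma effective_dat [effective_intros]:
  assumes "effective u"
  shows "effective (\<lambda>x. dat (u x))"
proof -
  have "dat v = map (\<lambda>i. (fst (nth_default undefined v i),
      dval (take i v) (snd (nth_default undefined v i)))) [0..<length v]"
    for v :: "('b \<times> reg_op) list"
    by (simp add: dat_def)
  then show ?thesis by (simp only:) (intro effective_intros effective_comp[OF assms] assms)
qed

lemma effective_obs [effective_intros]: "effective u \<Longrightarrow> effective (\<lambda>x. obs (u x))"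
  unfolding obs_def by (intro effective_intros)

lemma effective_ok [effective_intros]:
  assumes "effective u" "effective p"
  shows "effective (\<lambda>x. ok (u x) (p x))"
  unfolding ok_def by (intro effective_intros effective_comp[OF assms(1)] assms)

lemma effective_nf [effective_intros]:
  assumes "effective u"
  shows "effective (\<lambda>x. nf (u x))"
proof -
  have "nf v \<longleftrightarrow> (\<forall>i\<in>set [0..<length v]. ok (take i v) (snd (nth_default undefined v i))) \<and> obs v = []"
    for v :: "('b \<times> reg_op) list"
    by (auto simp: nf_def pre_def)
  then show ?thesis by (simp only:) (intro effective_intros effective_comp[OF assms] assms)
qed

section \<open>Observation tables, binary search and the transition function of the learner\<close>

type_synonym sword = "(nat \<times> reg_op) list"
type_synonym table = "(sword \<times> bool) list"

text \<open>
  A state consists of the number \<open>k\<close> of registers, the access words \<open>S\<close>, the suffixes \<open>E\<close>, the table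
  \<open>T\<close> of known answers, a symbolic counterexample together with the interval of the binary search on it
  (inactive if its upper end is 0), and a flag that is set once the hypothesis has been confirmed.
\<close>

type_synonym lstate =
  "nat \<times> sword list \<times> sword list \<times> table \<times> (sword \<times> nat \<times> nat) \<times> bool"

definition letters :: "nat \<Rightarrow> nat \<Rightarrow> (nat \<times> reg_op) list" where
  "letters n k = concat (map (\<lambda>a. concat (map (\<lambda>r. [(a, Fresh r), (a, Reuse r)]) [1..<Suc k])) [0..<n])"

definition words :: "nat \<Rightarrow> nat \<Rightarrow> nat \<Rightarrow> sword list" where
  "words n k m = ((\<lambda>W. [] # concat (map (\<lambda>x. map (\<lambda>w. x # w) W) (letters n k))) ^^ m) [[]]"

text \<open>Unknown words count as rejected. As long as \<open>k = 0\<close>, the hypothesis decides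
  on the empty word in this way, without a query.\<close>

definition val :: "table \<Rightarrow> sword \<Rightarrow> bool" where
  "val T u \<longleftrightarrow> (u, True) \<in> set T"

definition known :: "table \<Rightarrow> sword \<Rightarrow> bool" where
  "known T u \<longleftrightarrow> (u, True) \<in> set T \<or> (u, False) \<in> set T"

definition row :: "sword list \<Rightarrow> table \<Rightarrow> sword \<Rightarrow> bool list" where
  "row E T u = map (\<lambda>e. val T (u @ e)) E"

text \<open>There are no cells for \<open>k = 0\<close>: with no counterexample, no membership query is allowed then.\<close>

definition cells :: "nat \<Rightarrow> nat \<Rightarrow> sword list \<Rightarrow> sword list \<Rightarrow> sword list" where
  "cells n k S E = concat (map (\<lambda>s. concat (map (\<lambda>x. concat (map (\<lambda>e. [s @ e, s @ x # e]) E)) (letters n k))) S)"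

definition missing :: "nat \<Rightarrow> nat \<Rightarrow> sword list \<Rightarrow> sword list \<Rightarrow> table \<Rightarrow> sword list" where
  "missing n k S E T = filter (\<lambda>u. \<not> known T u) (cells n k S E)"

definition unclosed :: "nat \<Rightarrow> nat \<Rightarrow> sword list \<Rightarrow> sword list \<Rightarrow> table \<Rightarrow> sword list" where
  "unclosed n k S E T = filter (\<lambda>u. row E T u \<notin> set (map (\<lambda>s. row E T s) S))
     (concat (map (\<lambda>s. map (\<lambda>x. s @ [x]) (letters n k)) S))"

text \<open>The default 0 keeps the map total; in a closed table a matching row exists.\<close>

definition nxt :: "sword list \<Rightarrow> sword list \<Rightarrow> table \<Rightarrow> nat \<Rightarrow> nat \<times> reg_op \<Rightarrow> nat" where
  "nxt S E T i x = first 0 (filter (\<lambda>j. row E T (nth_default [] S j) = row E T (nth_default [] S i @ [x]))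
     [0..<length S])"

definition delta :: "sword list \<Rightarrow> sword list \<Rightarrow> table \<Rightarrow> sword \<Rightarrow> nat" where
  "delta S E T u = fold (\<lambda>x i. nxt S E T i x) u 0"

definition access :: "sword list \<Rightarrow> sword list \<Rightarrow> table \<Rightarrow> sword \<Rightarrow> sword" where
  "access S E T u = nth_default [] S (delta S E T u)"

definition accepts :: "sword list \<Rightarrow> sword list \<Rightarrow> table \<Rightarrow> sword \<Rightarrow> bool" where
  "accepts S E T u \<longleftrightarrow> val T (access S E T u)"

text \<open>
  If the hypothesis accepts any word that is not in normal form, then it accepts such a word whose
  length is bounded by the product of the numbers of its states and of the states of an automaton for
  normal forms.
\<close>

definition bad :: "nat \<Rightarrow> nat \<Rightarrow> sword list \<Rightarrow> sword list \<Rightarrow> table \<Rightarrow> sword list" where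
  "bad n k S E T = filter (\<lambda>u. accepts S E T u \<and> \<not> nf u) (words n k (length S * Suc (4 ^ k)))"

text \<open>The bounded search suffices because a normal form uses no register beyond its
  length.\<close>

definition normal_form :: "nat \<Rightarrow> (nat \<times> nat) list \<Rightarrow> sword" where
  "normal_form n p = first [] (filter (\<lambda>u. nf u \<and> dat u = p) (words n (length p) (length p)))"

definition max_reg :: "sword \<Rightarrow> nat" where
  "max_reg u = fold (\<lambda>x m. if m \<le> reg (snd x) then reg (snd x) else m) u 0"

definition querying :: "nat \<Rightarrow> lstate \<Rightarrow> bool" where
  "querying n = (\<lambda>(k, S, E, T, (u, lo, hi), don). \<not> don \<and>
     (hi \<noteq> 0 \<or> missing n k S E T \<noteq> [] \<or> unclosed n k S E T \<noteq> [] \<or> bad n k S E T \<noteq> []))"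

text \<open>
  The query for the empty word is only a means to spend a step when there is nothing to be asked: its
  answer is ignored.
\<close>

definition ask :: "nat \<Rightarrow> lstate \<Rightarrow> sword" where
  "ask n = (\<lambda>(k, S, E, T, (u, lo, hi), don).
     if hi \<noteq> 0 then
       (if hi \<le> Suc lo then []
        else access S E T (take ((lo + hi) div 2) u) @ drop ((lo + hi) div 2) u)
     else first [] (missing n k S E T))"

text \<open>The binary search looks for the position where membership of
  \<open>access S E T (take i u) @ drop i u\<close> begins to agree with the verdict of the
  hypothesis on \<open>u\<close>. There, one more letter yields the new access word, and the rest of
  \<open>u\<close> the new suffix. Each answer is combined with \<open>nf\<close>, as the data word
  of a symbolic word that is no normal form says nothing about that word.\<close>

definition on_truth :: "nat \<Rightarrow> lstate \<Rightarrow> bool \<Rightarrow> lstate" where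
  "on_truth n = (\<lambda>(k, S, E, T, (u, lo, hi), don) b.
     if don then (k, S, E, T, (u, lo, hi), don)
     else if hi \<noteq> 0 then
       (if hi \<le> Suc lo then
          (k, S @ [access S E T (take lo u) @ take 1 (drop lo u)], E @ [drop (Suc lo) u], T, ([], 0, 0), don)
        else if (b \<and> nf (access S E T (take ((lo + hi) div 2) u) @ drop ((lo + hi) div 2) u)) = accepts S E T u
        then (k, S, E, T, (u, lo, (lo + hi) div 2), don)
        else (k, S, E, T, (u, (lo + hi) div 2, hi), don))
     else if missing n k S E T \<noteq> [] then
       (k, S, E, (first [] (missing n k S E T), b \<and> nf (first [] (missing n k S E T))) # T, (u, lo, hi), don)
     else if unclosed n k S E T \<noteq> [] then
       (k, S @ [first [] (unclosed n k S E T)], E, T, (u, lo, hi), don)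
     else if bad n k S E T \<noteq> [] then
       (k, S, E, T, (first [] (bad n k S E T), 0, length (first [] (bad n k S E T))), don)
     else (k, S, E, T, (u, lo, hi), don))"

text \<open>The hypothesis rejects the empty word only while the table does not contain it as
  accepted, so as a counterexample this word belongs to the target. A word with a register beyond
  \<open>k\<close> merely raises \<open>k\<close>, and may be returned again later.\<close>

definition on_cex :: "lstate \<Rightarrow> sword \<Rightarrow> lstate" where
  "on_cex = (\<lambda>(k, S, E, T, (u, lo, hi), don) v.
     if v = [] then (k, S, E, ([], True) # T, (u, lo, hi), don)
     else if k < max_reg v then (max_reg v, S, E, T, (u, lo, hi), don)
     else (k, S, E, T, (v, 0, length v), don))"

definition on_yes :: "lstate \<Rightarrow> lstate" where
  "on_yes = (\<lambda>(k, S, E, T, (u, lo, hi), don). (k, S, E, T, (u, lo, hi), True))"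

definition upd :: "nat \<Rightarrow> lstate \<Rightarrow> (nat, nat) answer \<Rightarrow> lstate" where
  "upd n \<sigma> r = (case r of Truth b \<Rightarrow> on_truth n \<sigma> b | Yes \<Rightarrow> on_yes \<sigma>
     | Counterexample p \<Rightarrow> on_cex \<sigma> (normal_form n p))"

definition init_state :: lstate where
  "init_state = (0, [[]], [[]], [], ([], 0, 0), False)"

text \<open>The trailing units make the encodings of tuples coincide with those of \<^const>\<open>enc_list\<close>.\<close>

definition hyp_trans :: "nat \<Rightarrow> lstate \<Rightarrow> (nat \<times> nat \<times> reg_op \<times> nat \<times> unit) list" where
  "hyp_trans n = (\<lambda>(k, S, E, T, bs, don).
     concat (map (\<lambda>i. map (\<lambda>x. (i, fst x, snd x, nxt S E T i x, ())) (letters n k)) [0..<length S]))"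

definition hyp_finals :: "lstate \<Rightarrow> nat list" where
  "hyp_finals = (\<lambda>(k, S, E, T, bs, don). filter (\<lambda>i. val T (nth_default [] S i)) [0..<length S])"

definition hyp_code :: "nat \<Rightarrow> lstate \<Rightarrow> sexp" where
  "hyp_code n \<sigma> = sexp_of ([0..<length (fst (snd \<sigma>))], fst \<sigma>, 0 :: nat, hyp_finals \<sigma>, hyp_trans n \<sigma>, ())"

definition out :: "nat \<Rightarrow> lstate \<Rightarrow> sexp" where
  "out n \<sigma> = (if snd (snd (snd (snd (snd \<sigma>)))) then Cell (enc_nat 2) (hyp_code n \<sigma>)
     else if querying n \<sigma> then Cell (enc_nat 0) (sexp_of (dat (ask n \<sigma>)))
     else Cell (enc_nat 1) (hyp_code n \<sigma>))"

section \<open>Effectiveness of the learner\<close>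

lemma effective_letters [effective_intros]:
  assumes "effective k" shows "effective (\<lambda>x. letters n (k x))"
  unfolding letters_def by (intro effective_intros assms[THEN effective_comp])

lemma effective_words [effective_intros]:
  assumes "effective k" "effective m"
  shows "effective (\<lambda>x. words n (k x) (m x))"
  unfolding words_def by (intro effective_intros assms[THEN effective_comp])

lemma effective_val [effective_intros]:
  "effective T \<Longrightarrow> effective u \<Longrightarrow> effective (\<lambda>x. val (T x) (u x))"
  unfolding val_def by (intro effective_intros)

lemma effective_known [effective_intros]:
  "effective T \<Longrightarrow> effective u \<Longrightarrow> effective (\<lambda>x. known (T x) (u x))"
  unfolding known_def by (intro effective_intros)

lemma effective_row [effective_intros]:
  assumes "effective E" "effective T" "effective u"
  shows "effective (\<lambda>x. row (E x) (T x) (u x))"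
  unfolding row_def by (intro effective_intros assms[THEN effective_comp])

context
  fixes k :: "'a :: encodable \<Rightarrow> nat" and S E :: "'a \<Rightarrow> sword list" and T :: "'a \<Rightarrow> table"
  assumes S: "effective S" and E: "effective E" and T: "effective T"
begin

lemmas effective_tables = S[THEN effective_comp] E[THEN effective_comp] T[THEN effective_comp]

lemma effective_nxt [effective_intros]:
  assumes "effective i" "effective x"
  shows "effective (\<lambda>z. nxt (S z) (E z) (T z) (i z) (x z))"
  unfolding nxt_def by (intro effective_intros effective_tables assms[THEN effective_comp])

lemma effective_access [effective_intros]:
  assumes "effective u"
  shows "effective (\<lambda>z. access (S z) (E z) (T z) (u z))"
  unfolding access_def delta_def nxt_def
  by (intro effective_intros effective_tables assms[THEN effective_comp])

lemma effective_accepts [effective_intros]: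
  assumes "effective u"
  shows "effective (\<lambda>z. accepts (S z) (E z) (T z) (u z))"
  unfolding accepts_def access_def delta_def nxt_def
  by (intro effective_intros effective_tables assms[THEN effective_comp])

context
  assumes k: "effective k"
begin

lemma effective_missing [effective_intros]:
  "effective (\<lambda>z. missing n (k z) (S z) (E z) (T z))"
  unfolding missing_def cells_def by (intro effective_intros effective_tables k[THEN effective_comp])

lemma effective_unclosed [effective_intros]:
  "effective (\<lambda>z. unclosed n (k z) (S z) (E z) (T z))"
  unfolding unclosed_def by (intro effective_intros effective_tables k[THEN effective_comp])

lemma effective_bad [effective_intros]:
  "effective (\<lambda>z. bad n (k z) (S z) (E z) (T z))"
  unfolding bad_def accepts_def access_def delta_def nxt_def
  by (intro effective_intros effective_tables k[THEN effective_comp])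

end

end

lemma effective_normal_form [effective_intros]:
  assumes "effective p" shows "effective (\<lambda>x. normal_form n (p x))"
  unfolding normal_form_def by (intro effective_intros assms[THEN effective_comp])

lemma effective_max_reg [effective_intros]: "effective u \<Longrightarrow> effective (\<lambda>x. max_reg (u x))"
  unfolding max_reg_def by (intro effective_intros)

lemma effective_querying [effective_intros]: "effective s \<Longrightarrow> effective (\<lambda>x. querying n (s x))"
  unfolding querying_def case_prod_beta by (intro effective_intros)

lemma effective_ask [effective_intros]: "effective s \<Longrightarrow> effective (\<lambda>x. ask n (s x))"
  unfolding ask_def case_prod_beta by (intro effective_intros)

lemma effective_on_truth [effective_intros]:
  assumes "effective s" "effective b"
  shows "effective (\<lambda>x. on_truth n (s x) (b x))"
proof -
  have "effective (\<lambda>p. on_truth n (fst p) (snd p))"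
    unfolding on_truth_def case_prod_beta by (intro effective_intros)
  from effective_comp2[OF this assms] show ?thesis .
qed

lemma effective_on_cex [effective_intros]:
  assumes "effective s" "effective v"
  shows "effective (\<lambda>x. on_cex (s x) (v x))"
proof -
  have "effective (\<lambda>p. on_cex (fst p) (snd p))"
    unfolding on_cex_def case_prod_beta by (intro effective_intros)
  from effective_comp2[OF this assms] show ?thesis .
qed

lemma effective_on_yes [effective_intros]: "effective s \<Longrightarrow> effective (\<lambda>x. on_yes (s x))"
  unfolding on_yes_def case_prod_beta by (intro effective_intros)

lemma effective_upd [effective_intros]:
  assumes "effective s" "effective r"
  shows "effective (\<lambda>x. upd n (s x) (r x))"
proof -
  have "effective (\<lambda>p. upd n (fst p) (snd p))"
    unfolding upd_def by (intro effective_intros)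
  from effective_comp2[OF this assms] show ?thesis .
qed

lemma effective_hyp_code [effective_intros]:
  assumes "effective s" shows "effective (\<lambda>x. hyp_code n (s x))"
proof -
  have "effective (\<lambda>s. hyp_code n s)"
    unfolding hyp_code_def hyp_trans_def hyp_finals_def case_prod_beta by (intro effective_intros)
  from effective_comp[OF this assms] show ?thesis .
qed

lemma effective_out: "effective (out n)"
  unfolding out_def[abs_def] by (intro effective_intros)

lemma effective_learner: "effective (\<lambda>h. out n (fold (\<lambda>r s. upd n s r) h init_state))"
  by (intro effective_comp[OF effective_out] effective_intros)

section \<open>Invariants of the learner\<close>

lemma set_letters: "set (letters n k) = {..<n} \<times> Gam k"
proof -
  have "x \<in> set (letters n k) \<longleftrightarrow> x \<in> {..<n} \<times> Gam k" for x
  proof (cases x)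
    case (Pair a \<pi>)
    then show ?thesis by (cases \<pi>) (auto simp: letters_def Gam_def)
  qed
  then show ?thesis by blast
qed

lemma length_letters: "length (letters n k) = 2 * n * k"
proof -
  have "length (concat (map (\<lambda>r. [(a, Fresh r), (a, Reuse r)]) rs)) = 2 * length rs" for a :: nat and rs
    by (induction rs) auto
  then have "length (concat (map (\<lambda>a. concat (map (\<lambda>r. [(a, Fresh r), (a, Reuse r)]) [1..<Suc k])) as)) =
      2 * length as * k" for as :: "nat list"
    by (induction as) (auto simp: algebra_simps simp del: upt_Suc)
  then show ?thesis by (simp add: letters_def del: upt_Suc)
qed

lemma set_words: "set (words n k m) = {u \<in> lists ({..<n} \<times> Gam k). length u \<le> m}"
proof (induction m)
  case 0 show ?case by (auto simp: words_def)
next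
  case (Suc m)
  have "words n k (Suc m) = [] # concat (map (\<lambda>x. map ((#) x) (words n k m)) (letters n k))"
    by (simp add: words_def)
  then have e: "set (words n k (Suc m)) =
      insert [] {x # u | x u. x \<in> {..<n} \<times> Gam k \<and> u \<in> set (words n k m)}"
    by (auto simp: set_letters)
  have "v \<in> set (words n k (Suc m)) \<longleftrightarrow> v \<in> {u \<in> lists ({..<n} \<times> Gam k). length u \<le> Suc m}" for v
    unfolding e Suc by (cases v) auto
  then show ?case by blast
qed

lemma in_cells_iff:
  "v \<in> set (cells n k S E) \<longleftrightarrow>
    (\<exists>s\<in>set S. \<exists>x\<in>{..<n} \<times> Gam k. \<exists>e\<in>set E. v = s @ e \<or> v = s @ x # e)"
  unfolding set_letters[symmetric] by (simp add: cells_def)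

lemma length_concat_map_const:
  "(\<And>x. length (h x) = c) \<Longrightarrow> length (concat (map h xs)) = length xs * c"
  by (induction xs) auto

lemma length_cells: "length (cells n k S E) = length S * (2 * n * k * (length E * 2))"
  unfolding cells_def by (intro length_concat_map_const trans[OF length_concat_map_const[where c = "length E * 2"]])
    (simp_all add: length_letters)

lemma cells_mono:
  "k \<le> k' \<Longrightarrow> set S \<subseteq> set S' \<Longrightarrow> set E \<subseteq> set E' \<Longrightarrow> set (cells n k S E) \<subseteq> set (cells n k' S' E')"
proof
  fix v assume le: "k \<le> k'" "set S \<subseteq> set S'" "set E \<subseteq> set E'" and "v \<in> set (cells n k S E)"
  then obtain s x e where "s \<in> set S" "x \<in> {..<n} \<times> Gam k" "e \<in> set E" "v = s @ e \<or> v = s @ x # e"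
    unfolding in_cells_iff by blast
  moreover from this have "x \<in> {..<n} \<times> Gam k'" using Gam_mono[OF le(1)] by auto
  ultimately show "v \<in> set (cells n k' S' E')" using le unfolding in_cells_iff by blast
qed

lemma max_reg_snoc: "max_reg (u @ [x]) = max (max_reg u) (reg (snd x))"
  by (simp add: max_reg_def max_def)

lemma reg_le_max_reg: "x \<in> set u \<Longrightarrow> reg (snd x) \<le> max_reg u"
  by (induction u rule: rev_induct) (auto simp: max_reg_snoc)

lemma max_reg_le: "(\<And>x. x \<in> set u \<Longrightarrow> reg (snd x) \<le> m) \<Longrightarrow> max_reg u \<le> m"
  by (induction u rule: rev_induct) (auto simp: max_reg_snoc max_reg_def[of "[]"])

text \<open>When register \<open>r\<close> is opened, the \<open>r - 1\<close> smaller ones have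
  been opened before, at pairwise different positions.\<close>

lemma nf_reg_le_length:
  assumes "nf u" "x \<in> set u"
  shows "reg (snd x) \<le> length u"
proof -
  obtain i where i: "i < length u" "snd (u ! i) = Fresh (reg (snd x))"
    using nf_reg_opened[OF assms] by metis
  let ?r = "reg (snd x)" and ?c = "current (take i u)"
  have "ok (take i u) (Fresh ?r)" using assms(1) i by (metis nf_def pre_def)
  then have o: "opens (take i u) q \<noteq> []" if "q \<in> {1..<?r}" for q using that by (auto simp: ok_def)
  have "inj_on ?c {1..<?r}"
  proof (rule inj_onI)
    fix p q assume "p \<in> {1..<?r}" "q \<in> {1..<?r}" "?c p = ?c q"
    then have "Fresh p = Fresh q" using current_Fresh(2) o by metis
    then show "p = q" by simp
  qed
  moreover have "?c ` {1..<?r} \<subseteq> {..<i}" using current_Fresh(1)[OF o] by auto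
  ultimately have "card {1..<?r} \<le> card {..<i}" by (intro card_inj_on_le) auto
  then show ?thesis using i(1) by simp
qed

lemma first_in_set: "xs \<noteq> [] \<Longrightarrow> first d xs \<in> set xs"
  by (simp add: first_def)

lemma normal_form_dat:
  assumes "nf u" "fst ` set u \<subseteq> {..<n}"
  shows "normal_form n (dat u) = u"
proof -
  have "u \<in> lists ({..<n} \<times> Gam (length u))"
    unfolding in_lists_conv_set
  proof
    fix x assume x: "x \<in> set u"
    have "fst x \<in> {..<n}" using x assms(2) by blast
    moreover have "1 \<le> reg (snd x)" using nf_reg_opened[OF assms(1) x] by blast
    moreover have "reg (snd x) \<le> length u" by (rule nf_reg_le_length[OF assms(1) x])
    ultimately show "x \<in> {..<n} \<times> Gam (length u)" by (simp add: mem_Times_iff Gam_def)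
  qed
  define ws where "ws = filter (\<lambda>v. nf v \<and> dat v = dat u) (words n (length u) (length u))"
  have "u \<in> set ws" using assms(1) \<open>u \<in> lists _\<close> unfolding ws_def by (simp add: set_words)
  then have "first [] ws \<in> set ws" by (intro first_in_set) auto
  then have "first [] ws = u" using nf_unique[OF _ assms(1), of "first [] ws"] by (simp add: ws_def)
  then show ?thesis by (simp add: normal_form_def ws_def)
qed

lemma delta_Nil [simp]: "delta S E T [] = 0"
  by (simp add: delta_def)

lemma delta_snoc: "delta S E T (u @ [x]) = nxt S E T (delta S E T u) x"
  by (simp add: delta_def)

lemma nxt_less:
  assumes "S \<noteq> []" shows "nxt S E T i x < length S"
proof -
  have "first 0 (filter P [0..<length S]) < length S" for P
  proof (cases "filter P [0..<length S] = []")
    case False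
    from first_in_set[OF this, of 0] show ?thesis by simp
  qed (use assms in \<open>simp add: first_def\<close>)
  then show ?thesis by (simp add: nxt_def)
qed

lemma delta_less: "S \<noteq> [] \<Longrightarrow> delta S E T u < length S"
  by (cases u rule: rev_cases) (auto simp: delta_snoc nxt_less)

lemma access_nth: "S \<noteq> [] \<Longrightarrow> access S E T u = S ! delta S E T u"
  by (simp add: access_def delta_less)

lemma access_in: "S \<noteq> [] \<Longrightarrow> access S E T u \<in> set S"
  by (simp add: access_nth delta_less)

definition hyp_lang :: "nat \<Rightarrow> nat \<Rightarrow> sword list \<Rightarrow> sword list \<Rightarrow> table \<Rightarrow> sword set" where
  "hyp_lang n k S E T = {u \<in> lists ({..<n} \<times> Gam k). accepts S E T u}"

text \<open>The pair of hypothesis state and \<open>nf_state\<close> decides whether a word is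
  wrongly accepted, so \<open>short_witness\<close> yields such a word within the range searched by
  \<open>bad\<close>.\<close>

lemma hyp_lang_nf:
  assumes "S \<noteq> []" "bad n k S E T = []" "u \<in> hyp_lang n k S E T"
  shows "nf u"
proof (rule ccontr)
  assume u: "\<not> nf u"
  let ?Al = "{..<n} \<times> Gam k"
  let ?f = "\<lambda>u. (delta S E T u, nf_state k u)"
  have inv: "right_invariant ?Al ?f"
    using right_invariant_nf_state[of "{..<n}" k] unfolding right_invariant_def
    by (metis delta_snoc prod.inject)
  have sub: "?f ` lists ?Al \<subseteq> {..<length S} \<times> nf_state k ` lists ?Al"
    using delta_less[OF assms(1)] by auto
  have fin: "finite ({..<length S} \<times> nf_state k ` lists ?Al)"
    using finite_nf_state_range by blast
  obtain v where v: "v \<in> lists ?Al" "accepts S E T v \<and> \<not> nf v" "length v < card (?f ` lists ?Al)"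
  proof (rule short_witness[OF inv finite_subset[OF sub fin], of "\<lambda>v. accepts S E T v \<and> \<not> nf v"])
    show "u \<in> lists ?Al" "accepts S E T u \<and> \<not> nf u" using assms(3) u by (auto simp: hyp_lang_def)
    show "accepts S E T v' \<and> \<not> nf v'" if "?f v = ?f v'" "accepts S E T v \<and> \<not> nf v" for v v'
      using that nf_state_nf[of k v v'] by (simp add: accepts_def access_def)
  qed
  have "length v \<le> card ({..<length S} \<times> nf_state k ` lists ?Al)"
    using v(3) card_mono[OF fin sub] by simp
  also have "\<dots> \<le> length S * Suc (4 ^ k)"
    using card_nf_state_range[of k "{..<n}"] by (simp add: card_cartesian_product del: mult_Suc_right)
  finally have "v \<in> set (words n k (length S * Suc (4 ^ k)))" using v(1) unfolding set_words by blast
  then have "v \<in> set (bad n k S E T)" using v(2) by (simp add: bad_def)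
  then show False using assms(2) by simp
qed

text \<open>The learner is studied against an arbitrary set \<open>K\<close> of normal forms. The
  minimal automaton enters only as the bound \<open>N\<close> on pairwise inequivalent words.
  \<open>Q\<close> is the number of halvings allowed to a search: \<open>2 ^ Q\<close> bounds the
  length of words found in \<open>bad\<close>, and in \<open>invariant_cex\<close> that of
  counterexamples.\<close>

locale learning_target =
  fixes n kmax N Q :: nat and K :: "sword set"
  assumes n_pos: "0 < n"
    and K_nf: "u \<in> K \<Longrightarrow> nf u"
    and K_sub: "K \<subseteq> lists ({..<n} \<times> Gam kmax)"
    and inequivalent: "\<And>W. W \<subseteq> lists ({..<n} \<times> Gam kmax) \<Longrightarrow>
      (\<And>u v. u \<in> W \<Longrightarrow> v \<in> W \<Longrightarrow> u \<noteq> v \<Longrightarrow> \<exists>z. (u @ z \<in> K) \<noteq> (v @ z \<in> K)) \<Longrightarrow> card W \<le> N"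
    and Q: "N * Suc (4 ^ kmax) \<le> 2 ^ Q"
begin

text \<open>\<open>length E \<le> length S\<close> makes the number of cells quadratic in the number
  of access words, and distinct entries let each cell cost one query. The additional
  \<open>[]\<close> is the entry made by \<open>on_cex\<close>.\<close>

definition table_inv :: "nat \<Rightarrow> sword list \<Rightarrow> sword list \<Rightarrow> table \<Rightarrow> bool" where
  "table_inv k S E T \<longleftrightarrow> k \<le> kmax \<and> S \<noteq> [] \<and> S ! 0 = [] \<and> set S \<subseteq> lists ({..<n} \<times> Gam k) \<and>
     [] \<in> set E \<and> length E \<le> length S \<and>
     (\<forall>i<length S. \<forall>j<i. \<exists>e\<in>set E. (S ! i @ e \<in> K) \<noteq> (S ! j @ e \<in> K)) \<and>
     (\<forall>v b. (v, b) \<in> set T \<longrightarrow> b = (v \<in> K)) \<and> distinct (map fst T) \<and>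
     fst ` set T \<subseteq> insert [] (set (cells n k S E))"

text \<open>One end disagrees with the hypothesis and the other agrees, so the change happens
  between two neighbouring positions.\<close>

definition search_inv where
  "search_inv k S E T u lo hi \<longleftrightarrow> 1 \<le> k \<and> missing n k S E T = [] \<and> unclosed n k S E T = [] \<and>
     lo < hi \<and> hi \<le> length u \<and> u \<in> lists ({..<n} \<times> Gam k) \<and>
     (access S E T (take lo u) @ drop lo u \<in> K) \<noteq> accepts S E T u \<and>
     (access S E T (take hi u) @ drop hi u \<in> K) = accepts S E T u"

text \<open>
  \<open>mq\<close> and \<open>ce\<close> count the membership queries and the counterexamples. Each new access word pays for
  the closing step or for the binary search that produced it.
\<close>

definition invariant :: "lstate \<Rightarrow> nat \<Rightarrow> nat \<Rightarrow> bool" where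
  "invariant = (\<lambda>(k, S, E, T, (u, lo, hi), don) mq ce. table_inv k S E T \<and> (k = 0 \<longrightarrow> mq = 0) \<and>
     (don \<longrightarrow> hi = 0 \<and> hyp_lang n k S E T = K) \<and>
     ce \<le> length S - 1 + k + of_bool (val T []) + of_bool (hi \<noteq> 0) \<and>
     (if hi = 0 then mq \<le> length T + (length S - 1) * (Q + 2)
      else search_inv k S E T u lo hi \<and>
        (\<exists>q. hi - lo \<le> 2 ^ q \<and> mq + q + 1 \<le> length T + length S * (Q + 2))))"

lemma table_inv_props:
  assumes "table_inv k S E T"
  shows "k \<le> kmax" "S \<noteq> []" "S ! 0 = []" "set S \<subseteq> lists ({..<n} \<times> Gam k)" "[] \<in> set E"
    "length E \<le> length S" "\<And>v b. (v, b) \<in> set T \<Longrightarrow> b = (v \<in> K)" "distinct (map fst T)"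
    "fst ` set T \<subseteq> insert [] (set (cells n k S E))"
    "\<And>i j. i < length S \<Longrightarrow> j < i \<Longrightarrow> \<exists>e\<in>set E. (S ! i @ e \<in> K) \<noteq> (S ! j @ e \<in> K)"
  using assms unfolding table_inv_def by (elim conjE, (assumption | simp))+

lemma length_S_le:
  assumes "table_inv k S E T"
  shows "length S \<le> N"
proof -
  note t = table_inv_props[OF assms]
  have neq: "\<exists>z. (S ! i @ z \<in> K) \<noteq> (S ! j @ z \<in> K)" if "i < length S" "j < length S" "i \<noteq> j" for i j
    using t(10)[of i j] t(10)[of j i] that by (metis linorder_neqE_nat)
  then have "distinct S" unfolding distinct_conv_nth by metis
  moreover have "card (set S) \<le> N"
  proof (rule inequivalent)
    show "set S \<subseteq> lists ({..<n} \<times> Gam kmax)"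
      using t(4) lists_mono[of "{..<n} \<times> Gam k" "{..<n} \<times> Gam kmax"] Gam_mono[OF t(1)] by blast
    show "\<exists>z. (u @ z \<in> K) \<noteq> (v @ z \<in> K)" if "u \<in> set S" "v \<in> set S" "u \<noteq> v" for u v
      using that neq by (metis in_set_conv_nth)
  qed
  ultimately show ?thesis by (simp add: distinct_card)
qed

lemma letter_exists:
  assumes "1 \<le> k" obtains x where "x \<in> {..<n} \<times> Gam k"
  using that[of "(0, Fresh 1)"] n_pos assms by (auto simp: Gam_def)

lemma val_iff:
  assumes t: "table_inv k S E T" and "missing n k S E T = []" "v \<in> set (cells n k S E)"
  shows "val T v \<longleftrightarrow> v \<in> K"
proof -
  have "known T v" using assms(2,3) by (auto simp: missing_def filter_empty_conv)
  then show ?thesis using table_inv_props(7)[OF t] by (auto simp: known_def val_def)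
qed

lemma val_access_iff:
  assumes t: "table_inv k S E T" and "missing n k S E T = []" "1 \<le> k" "s \<in> set S" "e \<in> set E"
  shows "val T (s @ e) \<longleftrightarrow> s @ e \<in> K"
proof -
  obtain x where "x \<in> {..<n} \<times> Gam k" using letter_exists[OF assms(3)] by blast
  then have "s @ e \<in> set (cells n k S E)" using assms(4,5) unfolding in_cells_iff by blast
  then show ?thesis by (rule val_iff[OF assms(1,2)])
qed

lemma val_succ_iff:
  assumes t: "table_inv k S E T" and "missing n k S E T = []" "x \<in> {..<n} \<times> Gam k" "s \<in> set S" "e \<in> set E"
  shows "val T (s @ x # e) \<longleftrightarrow> s @ x # e \<in> K"
proof -
  have "s @ x # e \<in> set (cells n k S E)" using assms(3-5) unfolding in_cells_iff by blast
  then show ?thesis by (rule val_iff[OF assms(1,2)])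
qed

lemma row_nxt:
  assumes "unclosed n k S E T = []" "i < length S" "x \<in> {..<n} \<times> Gam k"
  shows "row E T (S ! nxt S E T i x) = row E T (S ! i @ [x])"
proof -
  have "S ! i @ [x] \<in> set (concat (map (\<lambda>s. map (\<lambda>x. s @ [x]) (letters n k)) S))"
    using assms(2,3) by (fastforce simp: set_letters)
  then have "row E T (S ! i @ [x]) \<in> set (map (\<lambda>s. row E T s) S)"
    using assms(1) unfolding unclosed_def filter_empty_conv by blast
  then obtain j where "j < length S" "row E T (S ! j) = row E T (S ! i @ [x])"
    by (auto simp: in_set_conv_nth)
  then have "filter (\<lambda>j. row E T (nth_default [] S j) = row E T (nth_default [] S i @ [x])) [0..<length S] \<noteq> []"
    using assms(2) by (auto simp: filter_empty_conv)
  from first_in_set[OF this, of 0]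
  have "nxt S E T i x < length S" "row E T (nth_default [] S (nxt S E T i x)) = row E T (S ! i @ [x])"
    by (simp_all add: nxt_def nth_default_eq[OF assms(2)] del: nth_default_eq)
  then show ?thesis by simp
qed

text \<open>At position 0 the word is \<open>v\<close> itself, where hypothesis and \<open>K\<close>
  differ; at the end it is an access word, on which the complete table is right.\<close>

lemma start_search:
  assumes t: "table_inv k S E T" and m: "missing n k S E T = []" "unclosed n k S E T = []"
    and v: "v \<in> lists ({..<n} \<times> Gam k)" "v \<noteq> []" "(v \<in> K) \<noteq> accepts S E T v"
  shows "search_inv k S E T v 0 (length v)"
proof -
  note p = table_inv_props[OF t]
  have "hd v \<in> {..<n} \<times> Gam k" using v(1,2) by (simp add: in_lists_conv_set)
  then have k: "1 \<le> k" by (auto simp: Gam_def)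
  have "access S E T [] = []" using p(2,3) by (simp add: access_nth)
  moreover have "(access S E T v \<in> K) = accepts S E T v"
    using val_access_iff[OF t m(1) k access_in[OF p(2)] p(5), of E T v] by (simp add: accepts_def)
  ultimately show ?thesis using v m k by (simp add: search_inv_def)
qed

text \<open>The allowance \<open>Q + 2\<close> of an access word covers at most one query to start
  the search, \<open>Q\<close> halvings, and the final query that extends the table.\<close>

lemma invariant_start_search:
  assumes inv: "table_inv k S E T" "mq' \<le> Suc mq" "mq \<le> length T + (length S - 1) * (Q + 2)"
    and "ce \<le> length S - 1 + k + of_bool (val T []) + 1"
    and m: "missing n k S E T = []" "unclosed n k S E T = []"
    and v: "v \<in> lists ({..<n} \<times> Gam k)" "v \<noteq> []" "(v \<in> K) \<noteq> accepts S E T v" "length v \<le> 2 ^ Q"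
  shows "invariant (k, S, E, T, (v, 0, length v), False) mq' ce"
proof -
  have s: "search_inv k S E T v 0 (length v)" using start_search inv m v by blast
  have "length S \<noteq> 0" using table_inv_props(2)[OF inv(1)] by simp
  then have "length S * (Q + 2) = (length S - 1) * (Q + 2) + (Q + 2)"
    by (cases "length S") simp_all
  then have "mq' + Q + 1 \<le> length T + length S * (Q + 2)" using inv(2,3) by linarith
  then show ?thesis
    using s inv(1) assms(4) v by (auto simp: invariant_def search_inv_def intro!: exI[of _ Q])
qed

lemma extend_table:
  assumes t: "table_inv k S E T" and s: "s \<in> lists ({..<n} \<times> Gam k)"
    and E': "set E' = insert e (set E)" "length E' \<le> Suc (length S)"
    and new: "\<And>j. j < length S \<Longrightarrow> \<exists>e\<in>set E'. (s @ e \<in> K) \<noteq> (S ! j @ e \<in> K)"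
  shows "table_inv k (S @ [s]) E' T"
proof -
  note p = table_inv_props[OF t]
  have "\<exists>e\<in>set E'. ((S @ [s]) ! i @ e \<in> K) \<noteq> ((S @ [s]) ! j @ e \<in> K)"
    if "i < Suc (length S)" "j < i" for i j
    using that new[of j] p(10)[of i j] E'(1) by (cases "i = length S") (auto simp: nth_append)
  moreover have "set (cells n k S E) \<subseteq> set (cells n k (S @ [s]) E')"
    using E'(1) by (intro cells_mono) auto
  ultimately show ?thesis
    using p s E' unfolding table_inv_def by (auto simp: nth_append)
qed

lemma val_row_eq:
  "row E T u = row E T v \<Longrightarrow> e \<in> set E \<Longrightarrow> val T (u @ e) = val T (v @ e)"
  by (simp add: row_def)

lemma extend_unclosed:
  assumes t: "table_inv k S E T" and m: "missing n k S E T = []" and u: "s \<in> set (unclosed n k S E T)"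
  shows "table_inv k (S @ [s]) E T"
proof -
  note p = table_inv_props[OF t]
  obtain s0 x where s0: "s0 \<in> set S" "x \<in> {..<n} \<times> Gam k" "s = s0 @ [x]"
    using u by (auto simp: unclosed_def set_letters)
  have k: "1 \<le> k" using s0(2) by (auto simp: Gam_def)
  show ?thesis
  proof (rule extend_table[OF t])
    show "s \<in> lists ({..<n} \<times> Gam k)" using s0 p(4) by auto
    show "set E = insert [] (set E)" using p(5) by blast
    show "length E \<le> Suc (length S)" using p(6) by simp
    fix j assume j: "j < length S"
    have "row E T s \<noteq> row E T (S ! j)" using u j unfolding unclosed_def by fastforce
    then obtain e where e: "e \<in> set E" "val T (s @ e) \<noteq> val T (S ! j @ e)"
      unfolding row_def by auto
    then show "\<exists>e\<in>set E. (s @ e \<in> K) \<noteq> (S ! j @ e \<in> K)"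
      using val_succ_iff[OF t m s0(2,1) e(1)] val_access_iff[OF t m k nth_mem[OF j] e(1)] s0(3) by auto
  qed
qed

text \<open>Let \<open>S ! j\<close> be the successor of \<open>S ! i\<close> in the hypothesis
  under the letter \<open>x\<close> at the change. Its row is that of \<open>S ! i @ [x]\<close>, so
  old suffixes separate the new word from all access words except \<open>S ! j\<close>; the new
  suffix separates it from \<open>S ! j\<close>.\<close>

lemma extend_search:
  assumes t: "table_inv k S E T" and s: "search_inv k S E T u lo hi" and hi: "hi \<le> Suc lo"
  shows "table_inv k (S @ [access S E T (take lo u) @ take 1 (drop lo u)]) (E @ [drop (Suc lo) u]) T"
proof -
  note p = table_inv_props[OF t]
  have hi: "hi = Suc lo" and lo: "lo < length u" and k: "1 \<le> k" and m: "missing n k S E T = []"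
    and c: "unclosed n k S E T = []" and u: "u \<in> lists ({..<n} \<times> Gam k)"
    using s hi by (auto simp: search_inv_def)
  define x where "x = u ! lo"
  define i where "i = delta S E T (take lo u)"
  have i: "i < length S" "access S E T (take lo u) = S ! i"
    using p(2) by (auto simp: i_def delta_less access_nth)
  have x: "x \<in> {..<n} \<times> Gam k" using u lo by (auto simp: x_def)
  have dr: "drop lo u = x # drop (Suc lo) u" using lo by (simp add: x_def Cons_nth_drop_Suc)
  define j where "j = nxt S E T i x"
  have "delta S E T (take (Suc lo) u) = j"
    using lo by (simp add: take_Suc_conv_app_nth delta_snoc j_def i_def x_def)
  then have j: "j < length S" "access S E T (take (Suc lo) u) = S ! j"
    using p(2) by (auto simp: access_nth j_def nxt_less)
  have row: "row E T (S ! j) = row E T (S ! i @ [x])" unfolding j_def by (rule row_nxt[OF c i(1) x])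
  have diff: "(S ! i @ x # drop (Suc lo) u \<in> K) \<noteq> (S ! j @ drop (Suc lo) u \<in> K)"
    using s by (simp add: search_inv_def hi i j dr)
  have "table_inv k (S @ [S ! i @ [x]]) (E @ [drop (Suc lo) u]) T"
  proof (rule extend_table[OF t])
    show "S ! i @ [x] \<in> lists ({..<n} \<times> Gam k)" using p(4) nth_mem[OF i(1)] x by auto
    show "set (E @ [drop (Suc lo) u]) = insert (drop (Suc lo) u) (set E)" by simp
    show "length (E @ [drop (Suc lo) u]) \<le> Suc (length S)" using p(6) by simp
    fix l assume l: "l < length S"
    show "\<exists>e\<in>set (E @ [drop (Suc lo) u]). ((S ! i @ [x]) @ e \<in> K) \<noteq> (S ! l @ e \<in> K)"
    proof (cases "l = j")
      case True
      then show ?thesis using diff by simp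
    next
      case False
      then obtain e where e: "e \<in> set E" "(S ! j @ e \<in> K) \<noteq> (S ! l @ e \<in> K)"
        using p(10)[of j l] p(10)[of l j] j(1) l by (metis linorder_neqE_nat)
      have "(S ! j @ e \<in> K) = ((S ! i @ [x]) @ e \<in> K)"
        using val_row_eq[OF row e(1)] val_access_iff[OF t m k nth_mem[OF j(1)] e(1)]
          val_succ_iff[OF t m x nth_mem[OF i(1)] e(1)] by simp
      then show ?thesis using e by auto
    qed
  qed
  then show ?thesis by (simp add: i dr)
qed

text \<open>Without registers there are no letters, hence no cells, and the only word to be
  searched, the empty one, is a normal form.\<close>

lemma querying_pos:
  assumes "invariant (k, S, E, T, (u, lo, hi), don) mq ce" "querying n (k, S, E, T, (u, lo, hi), don)"
  shows "1 \<le> k"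
proof (rule ccontr)
  assume "\<not> 1 \<le> k"
  then have k: "k = 0" by simp
  then have l: "letters n k = []" using length_letters[of n k] by simp
  have G: "Gam 0 = {}" by (auto simp: Gam_def)
  have "hi = 0" using assms(1) k by (auto simp: invariant_def search_inv_def split: if_splits)
  moreover have "missing n k S E T = []" "unclosed n k S E T = []"
    by (simp_all add: missing_def cells_def unclosed_def l)
  moreover have "set (words n k m) \<subseteq> {[]}" for m by (auto simp: set_words k G)
  then have "bad n k S E T = []" unfolding bad_def filter_empty_conv using nf_Nil by blast
  ultimately show False using assms(2) by (simp add: querying_def)
qed

lemma invariant_truth:
  assumes inv: "invariant \<sigma> mq ce" and q: "querying n \<sigma>" and b: "nf (ask n \<sigma>) \<Longrightarrow> b = (ask n \<sigma> \<in> K)"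
  shows "invariant (on_truth n \<sigma> b) (Suc mq) ce"
proof -
  obtain k S E T u lo hi don where \<sigma>: "\<sigma> = (k, S, E, T, (u, lo, hi), don)" by (metis prod.exhaust)
  have k: "1 \<le> k" using querying_pos inv q unfolding \<sigma> by blast
  have t: "table_inv k S E T" and ce: "ce \<le> length S - 1 + k + of_bool (val T []) + of_bool (hi \<noteq> 0)"
    and don: "\<not> don" using inv q by (auto simp: \<sigma> invariant_def querying_def)
  note p = table_inv_props[OF t]
  have ans: "(b \<and> nf (ask n \<sigma>)) = (ask n \<sigma> \<in> K)" using b K_nf by blast
  have len: "length S * (Q + 2) = (length S - 1) * (Q + 2) + (Q + 2)"
    using p(2) by (cases "length S") simp_all
  show ?thesis
  proof (cases "hi = 0")
    case False
    then obtain r where s: "search_inv k S E T u lo hi"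
      and r: "hi - lo \<le> 2 ^ r" "mq + r + 1 \<le> length T + length S * (Q + 2)"
      using inv by (auto simp: \<sigma> invariant_def)
    show ?thesis
    proof (cases "hi \<le> Suc lo")
      case True
      then show ?thesis
        using extend_search[OF t s True] False don k ce r(2) length_greater_0_conv[THEN iffD2, OF p(2)]
        by (auto simp: \<sigma> on_truth_def invariant_def simp del: length_greater_0_conv)
    next
      case nle: False
      define m where "m = (lo + hi) div 2"
      have m: "lo < m" "m < hi" using nle by (auto simp: m_def)
      \<comment> \<open>The interval still has length at least two, so a halving is left in the
        budget.\<close>
      have "r \<noteq> 0" using r(1) nle by (cases r) auto
      then obtain r' where r': "r = Suc r'" by (cases r) auto
      have gap: "m - lo \<le> 2 ^ r'" "hi - m \<le> 2 ^ r'" using r(1) by (auto simp: r' m_def)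
      have a: "ask n \<sigma> = access S E T (take m u) @ drop m u"
        using False nle by (simp add: \<sigma> ask_def m_def)
      have e: "on_truth n \<sigma> b = (if (ask n \<sigma> \<in> K) = accepts S E T u
          then (k, S, E, T, (u, lo, m), don) else (k, S, E, T, (u, m, hi), don))"
        using False nle don ans unfolding a by (simp add: \<sigma> on_truth_def m_def)
      have "search_inv k S E T u lo m" if "(ask n \<sigma> \<in> K) = accepts S E T u"
        using s that m by (auto simp: search_inv_def a)
      moreover have "search_inv k S E T u m hi" if "(ask n \<sigma> \<in> K) \<noteq> accepts S E T u"
        using s that m by (auto simp: search_inv_def a)
      moreover have "Suc mq + r' + 1 \<le> length T + length S * (Q + 2)" using r(2) by (simp add: r')
      ultimately show ?thesis
        using t k ce False don m gap unfolding e
        by (auto simp: invariant_def intro!: exI[of _ r'])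
    qed
  next
    case hi: True
    have mq: "mq \<le> length T + (length S - 1) * (Q + 2)" using inv hi by (simp add: \<sigma> invariant_def)
    show ?thesis
    proof (cases "missing n k S E T = []")
      case False
      define v where "v = first [] (missing n k S E T)"
      have v: "v \<in> set (cells n k S E)" "\<not> known T v"
        using first_in_set[OF False, of "[]"] by (auto simp: v_def missing_def)
      have a: "ask n \<sigma> = v" using hi by (simp add: \<sigma> ask_def v_def)
      have vT: "v \<notin> fst ` set T"
      proof
        assume "v \<in> fst ` set T"
        then obtain c where "(v, c) \<in> set T" by auto
        then show False using v(2) unfolding known_def by (cases c) auto
      qed
      have "table_inv k S E ((v, v \<in> K) # T)"
        using t v(1) vT unfolding table_inv_def by auto
      moreover have "val T [] \<Longrightarrow> val ((v, v \<in> K) # T) []" by (simp add: val_def)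
      ultimately have "invariant (k, S, E, (v, v \<in> K) # T, (u, lo, hi), don) (Suc mq) ce"
        using ce mq hi don k by (auto simp: invariant_def of_bool_def split: if_splits)
      then show ?thesis
        using False hi don ans unfolding a by (simp add: \<sigma> on_truth_def v_def[symmetric])
    next
      case m: True
      show ?thesis
      proof (cases "unclosed n k S E T = []")
        case False
        have "table_inv k (S @ [first [] (unclosed n k S E T)]) E T"
          using extend_unclosed[OF t m first_in_set[OF False]] .
        then show ?thesis using False m hi don k ce mq len
          by (auto simp: \<sigma> on_truth_def invariant_def)
      next
        case c: True
        then have bad: "bad n k S E T \<noteq> []" using q m hi don by (simp add: \<sigma> querying_def)
        define v where "v = first [] (bad n k S E T)"
        have "v \<in> set (bad n k S E T)" unfolding v_def by (rule first_in_set[OF bad])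
        then have v: "v \<in> set (words n k (length S * Suc (4 ^ k)))" "accepts S E T v" "\<not> nf v"
          by (auto simp: bad_def)
        have "length v \<le> length S * Suc (4 ^ k)" using v(1) unfolding set_words by blast
        also have "\<dots> \<le> N * Suc (4 ^ kmax)"
          using length_S_le[OF t] p(1) by (intro mult_mono) (auto simp: power_increasing)
        also note Q
        finally have "length v \<le> 2 ^ Q" .
        moreover have "v \<noteq> []" "v \<notin> K" using v(3) K_nf by auto
        moreover have "v \<in> lists ({..<n} \<times> Gam k)" using v(1) unfolding set_words by blast
        ultimately have "invariant (k, S, E, T, (v, 0, length v), False) (Suc mq) ce"
          using t mq ce m c v(2) hi by (intro invariant_start_search[where mq = mq]) auto
        then show ?thesis using bad c m hi don by (simp add: \<sigma> on_truth_def v_def[symmetric])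
      qed
    qed
  qed
qed

lemma invariant_yes:
  assumes "invariant \<sigma> mq ce" "\<not> querying n \<sigma>" "\<sigma> = (k, S, E, T, bs, False)" "hyp_lang n k S E T = K"
  shows "invariant (on_yes \<sigma>) mq ce"
  using assms by (cases bs) (auto simp: on_yes_def invariant_def querying_def)

text \<open>A counterexample is paid for by the entry of the empty word, by an increase of
  \<open>k\<close>, or by the access word that its search is going to add.\<close>

lemma invariant_cex:
  assumes inv: "invariant \<sigma> mq ce" and q: "\<not> querying n \<sigma>" and \<sigma>: "\<sigma> = (k, S, E, T, bs, False)"
    and v: "(v \<in> K) \<noteq> (v \<in> hyp_lang n k S E T)" "length v \<le> 2 ^ Q"
  shows "invariant (on_cex \<sigma> v) mq (Suc ce)"
proof -
  obtain u lo hi where bs: "bs = (u, lo, hi)" by (cases bs)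
  have hi: "hi = 0" and m: "missing n k S E T = []" "unclosed n k S E T = []"
    using q by (auto simp: \<sigma> bs querying_def)
  have t: "table_inv k S E T" and ce: "ce \<le> length S - 1 + k + of_bool (val T [])"
    and k0: "k = 0 \<Longrightarrow> mq = 0" and mq: "mq \<le> length T + (length S - 1) * (Q + 2)"
    using inv hi by (auto simp: \<sigma> bs invariant_def)
  note p = table_inv_props[OF t]
  consider (Nil) "v = []" | (reg) "v \<noteq> []" "k < max_reg v" | (search) "v \<noteq> []" "\<not> k < max_reg v" by blast
  then show ?thesis
  proof cases
    case Nil
    have "[] \<in> hyp_lang n k S E T \<longleftrightarrow> val T []"
      using p(2,3) by (simp add: hyp_lang_def accepts_def access_nth)
    then have e: "[] \<in> K" "\<not> val T []" using v(1) Nil p(7) by (auto simp: val_def)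
    then have "[] \<notin> fst ` set T" using p(7) by (fastforce simp: val_def)
    then have "table_inv k S E (([], True) # T)" using t e(1) unfolding table_inv_def by auto
    then show ?thesis
      using Nil hi ce k0 mq e(2) by (auto simp: \<sigma> bs on_cex_def invariant_def val_def)
  next
    case reg
    \<comment> \<open>Words of the hypothesis use at most \<open>k\<close> registers, so
      \<open>v\<close> must belong to \<open>K\<close>; this is why the number of registers never
      exceeds \<open>kmax\<close>.\<close>
    have "v \<notin> hyp_lang n k S E T"
    proof
      assume "v \<in> hyp_lang n k S E T"
      then have "max_reg v \<le> k" by (intro max_reg_le) (auto simp: hyp_lang_def Gam_def)
      then show False using reg by simp
    qed
    then have "v \<in> lists ({..<n} \<times> Gam kmax)" using v(1) K_sub by blast
    then have le: "max_reg v \<le> kmax" by (intro max_reg_le) (auto simp: Gam_def)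
    have G: "Gam k \<subseteq> Gam (max_reg v)" and c: "set (cells n k S E) \<subseteq> set (cells n (max_reg v) S E)"
      using reg(2) by (simp_all add: Gam_mono cells_mono)
    have S': "set S \<subseteq> lists ({..<n} \<times> Gam (max_reg v))"
      using p(4) G lists_mono[of "{..<n} \<times> Gam k" "{..<n} \<times> Gam (max_reg v)"] by blast
    have T': "fst ` set T \<subseteq> insert [] (set (cells n (max_reg v) S E))" using p(9) c by blast
    have "table_inv (max_reg v) S E T"
      unfolding table_inv_def by (intro conjI allI impI le S' T' p(2,3,5-8,10))
    then show ?thesis
      using reg hi ce mq by (auto simp: \<sigma> bs on_cex_def invariant_def)
  next
    case search
    have vl: "v \<in> lists ({..<n} \<times> Gam k)"
      unfolding in_lists_conv_set
    proof
      fix x assume x: "x \<in> set v"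
      have "x \<in> {..<n} \<times> Gam kmax \<or> x \<in> {..<n} \<times> Gam k"
        using v(1) x K_sub by (auto simp: hyp_lang_def dest: subsetD)
      moreover have "reg (snd x) \<le> k" using reg_le_max_reg[OF x] search by simp
      ultimately show "x \<in> {..<n} \<times> Gam k" by (auto simp: Gam_def)
    qed
    then have "(v \<in> K) \<noteq> accepts S E T v" using v(1) by (simp add: hyp_lang_def)
    then have "invariant (k, S, E, T, (v, 0, length v), False) mq (Suc ce)"
      using t mq ce m vl v(2) search by (intro invariant_start_search[where mq = mq]) auto
    then show ?thesis using search by (simp add: \<sigma> bs on_cex_def)
  qed
qed

lemma invariant_init: "invariant init_state 0 0"
  by (simp add: invariant_def init_state_def table_inv_def)

lemma invariant_bounds:
  assumes "invariant (k, S, E, T, bs, don) mq ce"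
  shows "ce \<le> N + kmax + 1" "mq \<le> 1 + N * (2 * n * kmax * (N * 2)) + N * (Q + 2)"
    "kmax = 0 \<Longrightarrow> mq = 0" "length S \<le> N" "k \<le> kmax"
proof -
  obtain u lo hi where bs: "bs = (u, lo, hi)" by (cases bs)
  have t: "table_inv k S E T" using assms by (simp add: bs invariant_def)
  note p = table_inv_props[OF t]
  show S: "length S \<le> N" by (rule length_S_le[OF t])
  show "k \<le> kmax" by (rule p(1))
  moreover have "k = 0 \<Longrightarrow> mq = 0" using assms unfolding bs invariant_def by simp
  ultimately show "kmax = 0 \<Longrightarrow> mq = 0" by simp
  have "ce \<le> length S - 1 + k + of_bool (val T []) + of_bool (hi \<noteq> 0)"
    using assms by (simp add: bs invariant_def)
  moreover have "0 < length S" using p(2) by simp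
  ultimately show "ce \<le> N + kmax + 1" using S p(1) by (auto simp: of_bool_def split: if_splits)
  have "length T = card (fst ` set T)" using p(8) by (metis distinct_card length_map list.set_map)
  also have "\<dots> \<le> card (insert [] (set (cells n k S E)))" using p(9) by (intro card_mono) auto
  also have "\<dots> \<le> Suc (length (cells n k S E))"
    using card_length[of "cells n k S E"] by (simp add: card_insert_if)
  also have "length (cells n k S E) \<le> N * (2 * n * kmax * (N * 2))"
    unfolding length_cells using S p(1,6) by (intro mult_mono) auto
  finally have T: "length T \<le> 1 + N * (2 * n * kmax * (N * 2))" by simp
  have "mq \<le> length T + length S * (Q + 2)"
  proof (cases "hi = 0")
    case True
    then have "mq \<le> length T + (length S - 1) * (Q + 2)" using assms by (simp add: bs invariant_def)
    also have "(length S - 1) * (Q + 2) \<le> length S * (Q + 2)" by (intro mult_mono) auto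
    finally show ?thesis by simp
  qed (use assms in \<open>auto simp: bs invariant_def\<close>)
  also have "length S * (Q + 2) \<le> N * (Q + 2)" using S by (rule mult_right_mono) simp
  finally show "mq \<le> 1 + N * (2 * n * kmax * (N * 2)) + N * (Q + 2)" using T by simp
qed

end

section \<open>Renaming letters\<close>

definition relabel :: "('a \<Rightarrow> 'b) \<Rightarrow> ('a \<times> 'c) list \<Rightarrow> ('b \<times> 'c) list" where
  "relabel g = map (\<lambda>x. (g (fst x), snd x))"

lemma relabel_simps [simp]:
  "relabel g [] = []" "relabel g (x # u) = (g (fst x), snd x) # relabel g u"
  "relabel g (u @ v) = relabel g u @ relabel g v" "length (relabel g u) = length u"
  "i < length u \<Longrightarrow> relabel g u ! i = (g (fst (u ! i)), snd (u ! i))"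
  by (simp_all add: relabel_def)

lemma relabel_conv_map_prod: "relabel g u = map (map_prod g id) u"
  by (induction u) auto

lemma opens_relabel: "opens (relabel g u) r = opens u r"
  unfolding opens_def by (intro filter_cong) auto

lemma current_relabel: "current (relabel g u) r = current u r"
  by (simp add: current_def opens_relabel)

lemma dval_relabel: "dval (relabel g u) \<pi> = dval u \<pi>"
  by (simp add: dval_def current_relabel)

lemma dat_relabel: "dat (relabel g u) = relabel g (dat u)"
  by (induction u rule: rev_induct) (simp_all add: dval_relabel)

lemma obs_relabel: "obs (relabel g u) = obs u"
  by (induction u rule: rev_induct) simp_all

lemma pre_relabel: "pre (relabel g u) \<longleftrightarrow> pre u"
  by (induction u rule: rev_induct) (simp_all add: ok_def obs_relabel opens_relabel)

lemma nf_relabel: "nf (relabel g u) \<longleftrightarrow> nf u"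
  by (simp add: nf_def pre_relabel obs_relabel)

lemma relabel_in_lists: "u \<in> lists (A \<times> X) \<Longrightarrow> g ` A \<subseteq> B \<Longrightarrow> relabel g u \<in> lists (B \<times> X)"
  by (induction u) auto

lemma relabel_inverse:
  "fst ` set u \<subseteq> A \<Longrightarrow> (\<And>a. a \<in> A \<Longrightarrow> f (g a) = a) \<Longrightarrow> relabel f (relabel g u) = u"
  by (induction u) auto

lemma map_snd_in_lists: "u \<in> lists (A \<times> X) \<Longrightarrow> range g \<subseteq> B \<Longrightarrow> map (map_prod id g) u \<in> lists (A \<times> B)"
  by (induction u) (auto simp: image_subset_iff)

lemma fst_in_lists: "u \<in> lists (A \<times> X) \<Longrightarrow> fst ` set u \<subseteq> A"
  by auto

section \<open>Learning session automata\<close>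

text \<open>Equal normal forms have equal patterns, and acceptance depends on the pattern
  only.\<close>

lemma data_lang_iff_snf:
  "w \<in> data_lang \<Sigma> D A \<longleftrightarrow> w \<in> lists (\<Sigma> \<times> D) \<and> snf w \<in> snf ` data_lang \<Sigma> D A"
proof
  assume "w \<in> lists (\<Sigma> \<times> D) \<and> snf w \<in> snf ` data_lang \<Sigma> D A"
  then obtain w' where w: "w \<in> lists (\<Sigma> \<times> D)" "w' \<in> data_lang \<Sigma> D A" "snf w = snf w'" by blast
  then have "pattern w = pattern w'" by (metis dat_snf)
  then show "w \<in> data_lang \<Sigma> D A" using w(1,2) by (simp add: data_lang_iff)
qed (auto simp: data_lang_iff)

text \<open>An accepted \<open>z\<close> with the same data as a normal form \<open>u\<close> is
  itself a normal form here, and therefore equal to \<open>u\<close>.\<close>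

lemma snf_data_lang_nf:
  assumes "infinite D" "session_automaton \<Sigma> A" "\<And>z. z \<in> sym_lang A \<Longrightarrow> nf z"
  shows "snf ` data_lang \<Sigma> D A = sym_lang A"
proof (intro set_eqI)
  fix u
  show "u \<in> snf ` data_lang \<Sigma> D A \<longleftrightarrow> u \<in> sym_lang A"
    unfolding snf_data_lang_iff[OF assms(1,2)] using assms(3) nf_imp_well_formed nf_unique by blast
qed

text \<open>Unlike \<open>invariant\<close>, this holds after all histories, also those that no
  teacher produces; \<open>algorithm\<close> asks for coded actions on such histories as
  well.\<close>

definition letters_ok :: "nat \<Rightarrow> lstate \<Rightarrow> bool" where
  "letters_ok n = (\<lambda>(k, S, E, T, (u, lo, hi), don). S \<noteq> [] \<and>
     (\<forall>v\<in>insert u (set S \<union> set E). fst ` set v \<subseteq> {..<n}))"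

lemma letters_ok_words: "v \<in> set (words n k m) \<Longrightarrow> fst ` set v \<subseteq> {..<n}"
  unfolding set_words by (auto simp: image_subset_iff)

lemma first_props: "(\<And>x. x \<in> set xs \<Longrightarrow> P x) \<Longrightarrow> P d \<Longrightarrow> P (first d xs)"
  by (simp add: first_def)

lemma letters_ok_missing:
  assumes "letters_ok n (k, S, E, T, (u, lo, hi), don)"
  shows "fst ` set (first [] (missing n k S E T)) \<subseteq> {..<n}"
proof (rule first_props)
  fix v assume "v \<in> set (missing n k S E T)"
  then have "v \<in> set (cells n k S E)" by (simp add: missing_def)
  then obtain s x e where "s \<in> set S" "x \<in> {..<n} \<times> Gam k" "e \<in> set E" "v = s @ e \<or> v = s @ x # e"
    unfolding in_cells_iff by blast
  moreover from this have "fst ` set s \<subseteq> {..<n}" "fst ` set e \<subseteq> {..<n}" "fst x < n"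
    using assms by (auto simp: letters_ok_def)
  ultimately show "fst ` set v \<subseteq> {..<n}" by (elim disjE) (simp_all add: image_Un)
qed simp

lemma letters_ok_unclosed:
  assumes "letters_ok n (k, S, E, T, (u, lo, hi), don)"
  shows "fst ` set (first [] (unclosed n k S E T)) \<subseteq> {..<n}"
proof (rule first_props)
  fix v assume "v \<in> set (unclosed n k S E T)"
  then obtain s x where "s \<in> set S" "x \<in> {..<n} \<times> Gam k" "v = s @ [x]"
    by (auto simp: unclosed_def set_letters)
  moreover from this have "fst ` set s \<subseteq> {..<n}" "fst x < n" using assms by (auto simp: letters_ok_def)
  ultimately show "fst ` set v \<subseteq> {..<n}" by (simp add: image_Un)
qed simp

lemma letters_ok_access:
  assumes "letters_ok n (k, S, E, T, (u, lo, hi), don)"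
  shows "fst ` set (access S E T v) \<subseteq> {..<n}"
proof -
  have "S \<noteq> []" using assms by (simp add: letters_ok_def)
  from access_in[OF this, of E T v] show ?thesis using assms by (simp add: letters_ok_def)
qed

lemma letters_ok_ask:
  assumes "letters_ok n \<sigma>"
  shows "fst ` set (ask n \<sigma>) \<subseteq> {..<n}"
proof -
  obtain k S E T u lo hi don where \<sigma>: "\<sigma> = (k, S, E, T, (u, lo, hi), don)" by (metis prod.exhaust)
  have "fst ` set u \<subseteq> {..<n}" using assms by (simp add: \<sigma> letters_ok_def)
  then have "fst ` set (drop m u) \<subseteq> {..<n}" for m using set_drop_subset[of m u] by blast
  moreover note letters_ok_missing[OF assms[unfolded \<sigma>]] letters_ok_access[OF assms[unfolded \<sigma>]]
  ultimately show ?thesis by (simp add: \<sigma> ask_def image_Un)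
qed

lemma letters_ok_truth:
  assumes "letters_ok n \<sigma>"
  shows "letters_ok n (on_truth n \<sigma> b)"
proof -
  obtain k S E T u lo hi don where \<sigma>: "\<sigma> = (k, S, E, T, (u, lo, hi), don)" by (metis prod.exhaust)
  have u: "fst ` set u \<subseteq> {..<n}" using assms by (simp add: \<sigma> letters_ok_def)
  have d: "fst ` set (drop m u) \<subseteq> {..<n}" for m using set_drop_subset[of m u] u by blast
  have t: "fst ` set (take l (drop m u)) \<subseteq> {..<n}" for l m
    using set_take_subset[of l "drop m u"] d[of m] by blast
  have b: "fst ` set (first [] (bad n k S E T)) \<subseteq> {..<n}"
  proof (rule first_props)
    fix v assume "v \<in> set (bad n k S E T)"
    then show "fst ` set v \<subseteq> {..<n}" unfolding bad_def by (intro letters_ok_words) auto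
  qed simp
  note l = letters_ok_unclosed[OF assms[unfolded \<sigma>]] letters_ok_access[OF assms[unfolded \<sigma>], of "take lo u"]
  show ?thesis using assms u d t b l by (simp add: \<sigma> on_truth_def letters_ok_def image_Un)
qed

lemma letters_ok_upd:
  assumes "letters_ok n \<sigma>"
  shows "letters_ok n (upd n \<sigma> r)"
proof (cases r)
  case (Truth b) then show ?thesis using letters_ok_truth[OF assms] by (simp add: upd_def)
next
  case Yes then show ?thesis using assms by (cases \<sigma>) (auto simp: upd_def on_yes_def letters_ok_def)
next
  case (Counterexample p)
  have "fst ` set (normal_form n p) \<subseteq> {..<n}"
    unfolding normal_form_def
  proof (rule first_props)
    fix v assume "v \<in> set (filter (\<lambda>u. nf u \<and> dat u = p) (words n (length p) (length p)))"
    then show "fst ` set v \<subseteq> {..<n}" by (intro letters_ok_words) auto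
  qed simp
  then show ?thesis using assms Counterexample
    by (cases \<sigma>) (auto simp: upd_def on_cex_def letters_ok_def)
qed

lemma enc_list_map: "enc_list e (map f xs) = enc_list (\<lambda>x. e (f x)) xs"
  by (induction xs) simp_all

lemma enc_list_cong: "(\<And>x. x \<in> set xs \<Longrightarrow> e x = e' x) \<Longrightarrow> enc_list e xs = enc_list e' xs"
  by (induction xs) simp_all

lemma enc_word_eq: "enc_word \<alpha> w = sexp_of (relabel \<alpha> w)"
  unfolding enc_word_def sexp_of_list_def relabel_def enc_list_map
  by (rule enc_list_cong) (auto simp: sexp_of_nat_def)

definition finished :: "lstate \<Rightarrow> bool" where
  "finished \<sigma> = snd (snd (snd (snd (snd \<sigma>))))"

lemma finished_on_truth: "finished (on_truth n \<sigma> b) = finished \<sigma>"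
proof -
  obtain k S E T u lo hi don where "\<sigma> = (k, S, E, T, (u, lo, hi), don)" by (metis prod.exhaust)
  then show ?thesis by (simp add: on_truth_def finished_def)
qed

definition cex_count :: "('a, 'd) answer list \<Rightarrow> nat" where
  "cex_count h = length (filter (\<lambda>x. \<exists>w. x = Counterexample w) h)"

lemma length_le_max_counterexample:
  assumes "Counterexample w \<in> set h"
  shows "length w \<le> max_counterexample h"
proof -
  have "{length w | w. Counterexample w \<in> set h} \<subseteq>
      (\<lambda>x. case x of Counterexample w \<Rightarrow> length w | _ \<Rightarrow> 0) ` set h" by force
  then have "finite {length w | w. Counterexample w \<in> set h}" by (rule finite_subset) simp
  then show ?thesis
    unfolding max_counterexample_def using assms by (intro Max_ge) auto
qed

section \<open>The learner over the given alphabet\<close>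

locale session_learner =
  fixes \<Sigma> :: "'a set" and D :: "'d set" and \<alpha> :: "'a \<Rightarrow> nat" and \<nu> :: "nat \<Rightarrow> 'd"
  assumes fin: "finite \<Sigma>" and nonempty: "\<Sigma> \<noteq> {}" and inf: "infinite D"
    and \<alpha>: "bij_betw \<alpha> \<Sigma> {..<card \<Sigma>}" and \<nu>: "inj \<nu>" "range \<nu> \<subseteq> D"
begin

abbreviation n :: nat where "n \<equiv> card \<Sigma>"

definition \<beta> :: "nat \<Rightarrow> 'a" where "\<beta> = inv_into \<Sigma> \<alpha>"

lemma \<alpha>_\<beta>: "i \<in> {..<n} \<Longrightarrow> \<alpha> (\<beta> i) = i"
  and \<beta>_\<alpha>: "a \<in> \<Sigma> \<Longrightarrow> \<beta> (\<alpha> a) = a"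
  and \<beta>_in: "\<beta> ` {..<n} \<subseteq> \<Sigma>"
  and \<alpha>_in: "\<alpha> ` \<Sigma> \<subseteq> {..<n}"
  using \<alpha> bij_betw_inv_into_right[OF \<alpha>] bij_betw_inv_into_left[OF \<alpha>] bij_betw_inv_into[OF \<alpha>]
  unfolding \<beta>_def by (auto simp: bij_betw_def)

lemma n_pos: "0 < n"
  using fin nonempty by (simp add: card_gt_0_iff)

fun abstract :: "('a, 'd) answer \<Rightarrow> (nat, nat) answer" where
  "abstract (Truth b) = Truth b"
| "abstract Yes = Yes"
| "abstract (Counterexample w) = Counterexample (relabel \<alpha> (pattern w))"

definition state_after :: "('a, 'd) answer list \<Rightarrow> lstate" where
  "state_after h = fold (\<lambda>r s. upd n s r) (map abstract h) init_state"

definition hyp :: "lstate \<Rightarrow> (nat, 'a) session_automaton" where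
  "hyp = (\<lambda>(k, S, E, T, bs, don). dfa_of {..<length S} (\<Sigma> \<times> Gam k) k
     (\<lambda>i x. nxt S E T i (\<alpha> (fst x), snd x)) 0 {i. i < length S \<and> val T (S ! i)})"

definition act :: "lstate \<Rightarrow> ('a, nat) action" where
  "act \<sigma> = (if finished \<sigma> then Output (hyp \<sigma>)
     else if querying n \<sigma> then Member (relabel \<beta> (dat (ask n \<sigma>)))
     else Equiv (hyp \<sigma>))"

definition learner :: "('a, 'd) learner" where
  "learner h = map_action \<nu> (act (state_after h))"

lemma state_after_Nil: "state_after [] = init_state"
  by (simp add: state_after_def)

lemma state_after_snoc: "state_after (h @ [r]) = upd n (state_after h) (abstract r)"
  by (simp add: state_after_def)

lemma letters_ok_state_after: "letters_ok n (state_after h)"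
proof (induction h rule: rev_induct)
  case Nil show ?case by (simp add: state_after_Nil init_state_def letters_ok_def)
qed (simp add: state_after_snoc letters_ok_upd)

lemma complete_dfa_hyp:
  assumes "S \<noteq> []"
  shows "complete_dfa \<Sigma> k (hyp (k, S, E, T, bs, don))"
  unfolding hyp_def prod.case using assms fin
  by (intro complete_dfa_dfa_of) (auto simp: nxt_less)

lemma session_automaton_hyp: "letters_ok n \<sigma> \<Longrightarrow> session_automaton \<Sigma> (hyp \<sigma>)"
  using complete_dfa_hyp by (cases \<sigma>) (auto simp: letters_ok_def complete_dfa_def)

lemma sym_lang_hyp:
  assumes "S \<noteq> []"
  shows "sym_lang (hyp (k, S, E, T, bs, don)) = {u \<in> lists (\<Sigma> \<times> Gam k). relabel \<alpha> u \<in> hyp_lang n k S E T}"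
proof -
  have "foldl (\<lambda>i x. nxt S E T i (\<alpha> (fst x), snd x)) i u = fold (\<lambda>x i. nxt S E T i x) (relabel \<alpha> u) i" for i u
    by (induction u arbitrary: i) simp_all
  then have "foldl (\<lambda>i x. nxt S E T i (\<alpha> (fst x), snd x)) 0 u = delta S E T (relabel \<alpha> u)" for u
    by (simp add: delta_def)
  moreover have "sym_lang (hyp (k, S, E, T, bs, don)) = {u \<in> lists (\<Sigma> \<times> Gam k).
      foldl (\<lambda>i x. nxt S E T i (\<alpha> (fst x), snd x)) 0 u \<in> {i. i < length S \<and> val T (S ! i)}}"
    unfolding hyp_def prod.case using assms by (intro sym_lang_dfa_of) (auto simp: nxt_less)
  ultimately show ?thesis
    using assms relabel_in_lists[OF _ \<alpha>_in, of _ "Gam k"]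
    by (intro set_eqI)
      (simp add: hyp_lang_def accepts_def access_nth delta_less del: in_lists_conv_set, blast)
qed

lemma codes_hyp: "codes_automaton \<alpha> (hyp_code n \<sigma>) (hyp \<sigma>)"
proof -
  obtain k S E T bs don where \<sigma>: "\<sigma> = (k, S, E, T, bs, don)" by (metis prod.exhaust)
  define ts where "ts = map (\<lambda>t. (fst t, (\<beta> (fst (snd t)), fst (snd (snd t))), fst (snd (snd (snd t))))) (hyp_trans n \<sigma>)"
  have in_trans: "t \<in> set (hyp_trans n \<sigma>) \<longleftrightarrow> (\<exists>i a \<pi>. t = (i, a, \<pi>, nxt S E T i (a, \<pi>), ()) \<and>
      i < length S \<and> a < n \<and> \<pi> \<in> Gam k)" for t
    by (force simp: hyp_trans_def \<sigma> set_letters)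
  have "set ts = transitions (hyp \<sigma>)"
  proof (intro set_eqI iffI)
    fix t assume "t \<in> set ts"
    then obtain i a \<pi> where t: "t = (i, (\<beta> a, \<pi>), nxt S E T i (a, \<pi>))" "i < length S" "a < n" "\<pi> \<in> Gam k"
      by (auto simp: ts_def in_trans)
    then have "\<alpha> (\<beta> a) = a" "\<beta> a \<in> \<Sigma>" using \<alpha>_\<beta>[of a] \<beta>_in by auto
    then show "t \<in> transitions (hyp \<sigma>)" using t by (auto simp: hyp_def \<sigma> dfa_of_def)
  next
    fix t assume "t \<in> transitions (hyp \<sigma>)"
    then obtain i b \<pi> where t: "t = (i, (b, \<pi>), nxt S E T i (\<alpha> b, \<pi>))" "i < length S" "b \<in> \<Sigma>" "\<pi> \<in> Gam k"
      by (auto simp: hyp_def \<sigma> dfa_of_def)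
    then have "(i, \<alpha> b, \<pi>, nxt S E T i (\<alpha> b, \<pi>), ()) \<in> set (hyp_trans n \<sigma>)"
      using \<alpha>_in unfolding in_trans by auto
    then show "t \<in> set ts" unfolding ts_def using t \<beta>_\<alpha>[of b] by force
  qed
  moreover have "set (hyp_finals \<sigma>) = finals (hyp \<sigma>)"
    by (auto simp: hyp_finals_def hyp_def \<sigma> dfa_of_def)
  moreover have "set [0..<length S] = states (hyp \<sigma>)" by (auto simp: hyp_def \<sigma> dfa_of_def)
  moreover have "enc_list (enc_transition \<alpha>) ts = sexp_of (hyp_trans n \<sigma>)"
  proof -
    have "enc_transition \<alpha> (fst t, (\<beta> (fst (snd t)), fst (snd (snd t))), fst (snd (snd (snd t)))) = sexp_of t"
      if "t \<in> set (hyp_trans n \<sigma>)" for t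
      using that \<alpha>_\<beta> unfolding in_trans
      by (auto simp: enc_transition_def sexp_of_nat_def sexp_of_reg_op_def)
    then show ?thesis unfolding ts_def enc_list_map sexp_of_list_def by (rule enc_list_cong)
  qed
  moreover have "registers (hyp \<sigma>) = k" "initial (hyp \<sigma>) = 0" by (simp_all add: hyp_def \<sigma> dfa_of_def)
  moreover have "enc_list enc_nat xs = sexp_of xs" for xs
    unfolding sexp_of_list_def by (rule enc_list_cong) (simp add: sexp_of_nat_def)
  ultimately have "hyp_code n \<sigma> = enc_list id [enc_list enc_nat [0..<length S], enc_nat (registers (hyp \<sigma>)),
      enc_nat (initial (hyp \<sigma>)), enc_list enc_nat (hyp_finals \<sigma>), enc_list (enc_transition \<alpha>) ts]"
    by (simp add: hyp_code_def \<sigma> sexp_of_nat_def)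
  then show ?thesis
    using codes_automaton.intros[OF \<open>set [0..<length S] = states (hyp \<sigma>)\<close>
        \<open>set (hyp_finals \<sigma>) = finals (hyp \<sigma>)\<close> \<open>set ts = transitions (hyp \<sigma>)\<close>, of \<alpha>] by simp
qed

lemma fst_dat_ask: "letters_ok n \<sigma> \<Longrightarrow> fst ` set (dat (ask n \<sigma>)) \<subseteq> {..<n}"
  using letters_ok_ask[of n \<sigma>] by (metis list.set_map map_fst_dat)

lemma relabel_ask: "letters_ok n \<sigma> \<Longrightarrow> relabel \<alpha> (relabel \<beta> (dat (ask n \<sigma>))) = dat (ask n \<sigma>)"
  by (intro relabel_inverse[of _ "{..<n}"] fst_dat_ask \<alpha>_\<beta>)

lemma query_in_lists:
  assumes "letters_ok n \<sigma>"
  shows "map (map_prod id \<nu>) (relabel \<beta> (dat (ask n \<sigma>))) \<in> lists (\<Sigma> \<times> D)"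
proof -
  have "relabel \<beta> (dat (ask n \<sigma>)) \<in> lists (\<Sigma> \<times> UNIV)"
    using \<beta>_in fst_dat_ask[OF assms]
    by (intro relabel_in_lists[of _ "{..<n}"]) (auto simp: image_subset_iff)
  then show ?thesis using \<nu>(2) by (rule map_snd_in_lists)
qed

lemma codes_act: "letters_ok n \<sigma> \<Longrightarrow> codes_action \<alpha> (out n \<sigma>) (act \<sigma>)"
  using codes_hyp[of \<sigma>] codes_action.intros(1)[of \<alpha> "relabel \<beta> (dat (ask n \<sigma>))"]
  unfolding out_def act_def finished_def enc_word_eq
  by (auto simp only: relabel_ask if_True if_False intro: codes_action.intros(2,3) split: if_split)

lemma algorithm_learner: "algorithm \<Sigma> D learner"
proof -
  obtain F where F: "computable F" "\<And>h. F (sexp_of h) = out n (fold (\<lambda>r s. upd n s r) h init_state)"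
    using effective_learner[of n] unfolding effective_def by auto
  have "enc_answer \<alpha> r = sexp_of (abstract r)" for r :: "('a, 'd) answer"
    by (cases r) (simp_all add: enc_word_eq sexp_of_bool_def)
  then have "enc_list (enc_answer \<alpha>) h = sexp_of (map abstract h)" for h :: "('a, 'd) answer list"
    unfolding sexp_of_list_def enc_list_map by (intro enc_list_cong)
  then have "codes_action \<alpha> (F (enc_list (enc_answer \<alpha>) h)) (act (state_after h))" for h
    using codes_act[OF letters_ok_state_after] by (simp add: F(2) state_after_def)
  moreover have "inj_on \<alpha> \<Sigma>" using \<alpha> by (simp add: bij_betw_def)
  ultimately show ?thesis
    unfolding algorithm_def learner_def using \<nu> F(1) by blast
qed

lemma admissible_learner: "admissible \<Sigma> D (learner h)"
  using letters_ok_state_after[of h] query_in_lists session_automaton_hyp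
  by (simp add: learner_def act_def)

section \<open>Dialogues with a teacher for a fixed session automaton\<close>

context
  fixes A :: "('s, 'a) session_automaton"
  assumes A: "session_automaton \<Sigma> A"
begin

abbreviation L where "L \<equiv> data_lang \<Sigma> D A"
abbreviation k where "k \<equiv> snf_registers \<Sigma> L"
abbreviation N where "N \<equiv> canonical_size \<Sigma> L"
abbreviation K where "K \<equiv> relabel \<alpha> ` (snf ` L)"

lemma snf_L_sub: "snf ` L \<subseteq> lists (\<Sigma> \<times> Gam k)"
  by (rule snf_registers_subset[OF inf A])

lemma minimal_dfa:
  obtains B :: "(nat, 'a) session_automaton"
    where "complete_dfa \<Sigma> k B" "sym_lang B = snf ` L" "card (states B) = N"
proof -
  obtain B :: "(nat, 'a) session_automaton" where "complete_dfa \<Sigma> k B" "sym_lang B = snf ` L"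
    using snf_data_lang_regular[OF fin inf A snf_L_sub] by blast
  then have "\<exists>m. \<exists>B :: (nat, 'a) session_automaton. complete_dfa \<Sigma> k B \<and> sym_lang B = snf ` L \<and> card (states B) = m"
    by blast
  from LeastI_ex[OF this] show thesis
    by (elim exE conjE) (rule that, simp_all add: canonical_size_def min_dfa_size_def)
qed

lemma N_le:
  fixes B :: "(nat, 'a) session_automaton"
  assumes "complete_dfa \<Sigma> k B" "sym_lang B = snf ` L"
  shows "N \<le> card (states B)"
  unfolding canonical_size_def min_dfa_size_def by (rule Least_le) (use assms in blast)

lemma N_pos: "0 < N"
proof -
  obtain B :: "(nat, 'a) session_automaton"
    where "complete_dfa \<Sigma> k B" "sym_lang B = snf ` L" "card (states B) = N"
    by (rule minimal_dfa)
  then show ?thesis by (metis card_gt_0_iff complete_dfa_def empty_iff session_automaton_def)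
qed

lemma k_le_N: "k \<le> N"
proof -
  obtain B :: "(nat, 'a) session_automaton"
    where B: "complete_dfa \<Sigma> k B" "sym_lang B = snf ` L" "card (states B) = N"
    by (rule minimal_dfa)
  show ?thesis using snf_registers_le_states[OF inf A refl refl B(1,2)] B(3) by simp
qed

lemma in_K_iff:
  assumes "fst ` set u \<subseteq> {..<n}"
  shows "u \<in> K \<longleftrightarrow> relabel \<beta> u \<in> snf ` L"
proof
  assume "u \<in> K"
  then obtain v where v: "v \<in> snf ` L" "u = relabel \<alpha> v" by blast
  then have "v \<in> lists (\<Sigma> \<times> Gam k)" using snf_L_sub by blast
  then have "relabel \<beta> (relabel \<alpha> v) = v" using \<beta>_\<alpha> by (intro relabel_inverse[of _ \<Sigma>] fst_in_lists) auto
  then show "relabel \<beta> u \<in> snf ` L" using v by simp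
next
  assume "relabel \<beta> u \<in> snf ` L"
  moreover have "relabel \<alpha> (relabel \<beta> u) = u" using \<alpha>_\<beta> assms by (intro relabel_inverse) auto
  ultimately show "u \<in> K" by (metis image_eqI)
qed

lemma K_letters: "u \<in> K \<Longrightarrow> u \<in> lists ({..<n} \<times> Gam k)"
  using relabel_in_lists[OF _ \<alpha>_in] snf_L_sub by blast

text \<open>Renaming the letters back carries inequivalent words for \<open>K\<close> to
  inequivalent words for the minimal automaton, where \<open>card_inequivalent_le\<close>
  applies.\<close>

lemma learning_target:
  assumes "N * Suc (4 ^ k) \<le> 2 ^ Q"
  shows "learning_target n k N Q K"
proof
  show "0 < n" by (rule n_pos)
  show "nf u" if "u \<in> K" for u using that nf_snf by (auto simp: nf_relabel)
  show "K \<subseteq> lists ({..<n} \<times> Gam k)" using K_letters by blast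
  show "N * Suc (4 ^ k) \<le> 2 ^ Q" by (rule assms)
  fix W assume W: "W \<subseteq> lists ({..<n} \<times> Gam k)"
    and ineq: "\<And>u v. u \<in> W \<Longrightarrow> v \<in> W \<Longrightarrow> u \<noteq> v \<Longrightarrow> \<exists>z. (u @ z \<in> K) \<noteq> (v @ z \<in> K)"
  obtain B :: "(nat, 'a) session_automaton"
    where B: "complete_dfa \<Sigma> k B" "sym_lang B = snf ` L" "card (states B) = N"
    by (rule minimal_dfa)
  have Wn: "fst ` set u \<subseteq> {..<n}" if "u \<in> W" for u using W that by (intro fst_in_lists[of _ _ "Gam k"]) blast
  have inv: "relabel \<alpha> (relabel \<beta> u) = u" if "u \<in> W" for u
    using \<alpha>_\<beta> Wn[OF that] by (intro relabel_inverse) auto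
  then have "inj_on (relabel \<beta>) W" by (rule inj_on_inverseI)
  then have "card W = card (relabel \<beta> ` W)" by (simp add: card_image)
  also have "\<dots> \<le> card (states B)"
  proof (rule card_inequivalent_le[OF B(1)])
    show "relabel \<beta> ` W \<subseteq> lists (\<Sigma> \<times> Gam k)" using W relabel_in_lists[OF _ \<beta>_in] by blast
    fix u' v' assume "u' \<in> relabel \<beta> ` W" "v' \<in> relabel \<beta> ` W" "u' \<noteq> v'"
    then obtain u v where uv: "u \<in> W" "v \<in> W" "u \<noteq> v" "u' = relabel \<beta> u" "v' = relabel \<beta> v" by blast
    then obtain z where z: "(u @ z \<in> K) \<noteq> (v @ z \<in> K)" using ineq[OF uv(1-3)] by (elim exE)
    have "u @ z \<in> lists ({..<n} \<times> Gam k) \<or> v @ z \<in> lists ({..<n} \<times> Gam k)" using z K_letters by blast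
    then have "z \<in> lists ({..<n} \<times> Gam k)" unfolding append_in_lists_conv by blast
    then have "fst ` set (u @ z) \<subseteq> {..<n}" "fst ` set (v @ z) \<subseteq> {..<n}"
      using Wn[OF uv(1)] Wn[OF uv(2)] fst_in_lists[of z "{..<n}" "Gam k"] by (simp_all add: image_Un)
    from in_K_iff[OF this(1)] in_K_iff[OF this(2)] z
    show "\<exists>z. (u' @ z \<in> sym_lang B) \<noteq> (v' @ z \<in> sym_lang B)"
      using uv B(2) by (intro exI[of _ "relabel \<beta> z"]) simp
  qed
  finally show "card W \<le> N" using B(3) by simp
qed

text \<open>The values in the word asked for are an injective renaming of those in
  \<open>dat (ask n \<sigma>)\<close>, so its normal form is the asked symbolic word over the
  original letters.\<close>

lemma member_answer:
  assumes "letters_ok n \<sigma>" "nf (ask n \<sigma>)"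
  shows "map (map_prod id \<nu>) (relabel \<beta> (dat (ask n \<sigma>))) \<in> L \<longleftrightarrow> ask n \<sigma> \<in> K"
proof -
  let ?u = "ask n \<sigma>" and ?w = "map (map_prod id \<nu>) (relabel \<beta> (dat (ask n \<sigma>)))"
  note l = letters_ok_ask[OF assms(1)]
  have w: "?w = map (map_prod \<beta> \<nu>) (dat ?u)"
    by (rule nth_equalityI) (simp_all add: map_prod_def case_prod_beta)
  have "pattern ?w = dat (relabel \<beta> ?u)"
    unfolding w unfolding dat_relabel unfolding relabel_conv_map_prod
    by (rule pattern_dat[OF nf_imp_well_formed[OF assms(2)] \<nu>(1)])
  then have s: "relabel \<beta> ?u = snf ?w" using assms(2) by (simp add: eq_snf_iff nf_relabel)
  show ?thesis
    unfolding in_K_iff[OF l] s using data_lang_iff_snf[of ?w \<Sigma> D A] query_in_lists[OF assms(1)] by simp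
qed

lemma hyp_lang_K_iff:
  fixes bs :: "sword \<times> nat \<times> nat" and don :: bool
  assumes "S \<noteq> []" "\<And>u. u \<in> hyp_lang n l S E T \<Longrightarrow> nf u"
  defines "H \<equiv> hyp (l, S, E, T, bs, don)"
  shows "snf ` data_lang \<Sigma> D H = sym_lang H"
    "hyp_lang n l S E T = K \<longleftrightarrow> sym_lang H = snf ` L"
proof -
  have sym: "sym_lang H = {u \<in> lists (\<Sigma> \<times> Gam l). relabel \<alpha> u \<in> hyp_lang n l S E T}"
    unfolding H_def by (rule sym_lang_hyp[OF assms(1)])
  have "session_automaton \<Sigma> H"
    using complete_dfa_hyp[OF assms(1)] by (simp add: H_def complete_dfa_def)
  moreover have "nf z" if "z \<in> sym_lang H" for z
    using that assms(2)[of "relabel \<alpha> z"] unfolding sym by (simp add: nf_relabel)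
  ultimately show "snf ` data_lang \<Sigma> D H = sym_lang H" by (intro snf_data_lang_nf[OF inf])
  have img: "hyp_lang n l S E T = relabel \<alpha> ` sym_lang H"
  proof (intro set_eqI iffI)
    fix u assume u: "u \<in> hyp_lang n l S E T"
    then have ul: "u \<in> lists ({..<n} \<times> Gam l)" by (simp add: hyp_lang_def)
    then have "relabel \<alpha> (relabel \<beta> u) = u" using \<alpha>_\<beta> by (intro relabel_inverse fst_in_lists) auto
    moreover from this have "relabel \<beta> u \<in> sym_lang H"
      using u relabel_in_lists[OF ul \<beta>_in] unfolding sym by simp
    ultimately show "u \<in> relabel \<alpha> ` sym_lang H" by (metis image_eqI)
  next
    fix u assume "u \<in> relabel \<alpha> ` sym_lang H"
    then show "u \<in> hyp_lang n l S E T" unfolding sym by blast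
  qed
  have inj: "inj_on (relabel \<alpha>) {u. fst ` set u \<subseteq> \<Sigma>}"
    using \<beta>_\<alpha> by (intro inj_on_inverseI[of _ "relabel \<beta>"] relabel_inverse) auto
  have "sym_lang H \<subseteq> {u. fst ` set u \<subseteq> \<Sigma>}" "snf ` L \<subseteq> {u. fst ` set u \<subseteq> \<Sigma>}"
    using sym snf_L_sub fst_in_lists[of _ \<Sigma>] by blast+
  then show "hyp_lang n l S E T = K \<longleftrightarrow> sym_lang H = snf ` L"
    unfolding img by (rule inj_on_image_eq_iff[OF inj])
qed

lemma cex_answer:
  fixes bs :: "sword \<times> nat \<times> nat" and don :: bool
  assumes "S \<noteq> []" "\<And>u. u \<in> hyp_lang n l S E T \<Longrightarrow> nf u"
  defines "H \<equiv> hyp (l, S, E, T, bs, don)"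
  assumes w: "w \<in> (data_lang \<Sigma> D H - L) \<union> (L - data_lang \<Sigma> D H)"
  defines "v \<equiv> normal_form n (relabel \<alpha> (pattern w))"
  shows "(v \<in> K) \<noteq> (v \<in> hyp_lang n l S E T)" "length v = length w"
proof -
  have wl: "w \<in> lists (\<Sigma> \<times> D)" using w by (auto simp: data_lang_iff)
  have "map fst (snf w) = map fst w" by (metis dat_snf map_fst_dat map_fst_pattern)
  then have "fst ` set (snf w) = fst ` set w" by (metis list.set_map)
  then have sl: "fst ` set (snf w) \<subseteq> \<Sigma>" using fst_in_lists[OF wl] by simp
  have vn: "fst ` set (relabel \<alpha> (snf w)) \<subseteq> {..<n}"
    using sl \<alpha>_in by (auto simp: relabel_def image_subset_iff)
  have "normal_form n (dat (relabel \<alpha> (snf w))) = relabel \<alpha> (snf w)"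
    using vn nf_snf[of w] by (intro normal_form_dat) (simp_all add: nf_relabel)
  then have v: "v = relabel \<alpha> (snf w)" by (simp add: v_def dat_relabel dat_snf)
  have "length (snf w) = length w" by (metis dat_snf length_dat length_pattern)
  then show "length v = length w" by (simp add: v)
  have \<beta>v: "relabel \<beta> v = snf w" unfolding v using sl \<beta>_\<alpha> by (intro relabel_inverse) auto
  have 1: "v \<in> K \<longleftrightarrow> w \<in> L"
    using in_K_iff[of v] vn data_lang_iff_snf[of w \<Sigma> D A] wl \<beta>v by (simp add: v)
  have "w \<in> data_lang \<Sigma> D H \<longleftrightarrow> snf w \<in> sym_lang H"
    using data_lang_iff_snf[of w \<Sigma> D H] wl hyp_lang_K_iff(1)[OF assms(1,2)] by (simp add: H_def)
  also have "\<dots> \<longleftrightarrow> v \<in> hyp_lang n l S E T"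
  proof -
    have "snf w \<in> lists (\<Sigma> \<times> Gam l)" if "v \<in> hyp_lang n l S E T"
      using relabel_in_lists[OF _ \<beta>_in, of v "Gam l"] that \<beta>v by (simp add: hyp_lang_def del: in_lists_conv_set)
    then show ?thesis unfolding H_def sym_lang_hyp[OF assms(1)] v by blast
  qed
  finally show "(v \<in> K) \<noteq> (v \<in> hyp_lang n l S E T)" using 1 w by blast
qed

text \<open>\<open>Q\<close> belongs to the analysis; the learner does not know it. It is chosen
  afterwards, from the counterexamples in the given history.\<close>

lemma dialogue_invariant:
  assumes "dialogue \<Sigma> D L learner h" "N * Suc (4 ^ k) \<le> 2 ^ Q" "\<And>w. Counterexample w \<in> set h \<Longrightarrow> length w \<le> 2 ^ Q"
  shows "learning_target.invariant n k Q K (state_after h) (member_queries h) (cex_count h) \<and>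
    equiv_queries h = cex_count h + of_bool (finished (state_after h))"
proof -
  interpret learning_target n k N Q K by (rule learning_target[OF assms(2)])
  have hyp_nf: "nf u" if "invariant (l, S, E, T, bs, False) mq ce" "\<not> querying n (l, S, E, T, bs, False)"
    "u \<in> hyp_lang n l S E T" for l S E T bs mq ce u
  proof -
    have "S \<noteq> []" "bad n l S E T = []"
      using that(1,2) by (cases bs; simp add: invariant_def table_inv_def querying_def)+
    then show ?thesis using hyp_lang_nf that(3) by blast
  qed
  have equiv_state: "\<exists>l S E T bs. state_after h = (l, S, E, T, bs, False) \<and>
      \<not> querying n (state_after h) \<and> H = hyp (l, S, E, T, bs, False) \<and> S \<noteq> [] \<and>
      (\<forall>u\<in>hyp_lang n l S E T. nf u)"
    if "learner h = Equiv H" "invariant (state_after h) mq ce" for h H mq ce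
  proof -
    obtain l S E T bs don where \<sigma>: "state_after h = (l, S, E, T, bs, don)" by (metis prod.exhaust)
    have q: "\<not> finished (state_after h)" "\<not> querying n (state_after h)" "H = hyp (state_after h)"
      using that(1) by (auto simp: learner_def act_def split: if_splits)
    then have don: "don = False" by (simp add: finished_def \<sigma>)
    have S: "S \<noteq> []" using letters_ok_state_after[of h] by (cases bs) (simp add: \<sigma> letters_ok_def)
    have "\<forall>u\<in>hyp_lang n l S E T. nf u" using that(2) q(2) hyp_nf unfolding \<sigma> don by blast
    then show ?thesis using q(2,3) S unfolding \<sigma> don by auto
  qed
  show ?thesis
    using assms(1,3)
  proof (induction rule: dialogue.induct)
    case start
    show ?case
      using invariant_init
      by (simp add: state_after_Nil member_queries_def cex_count_def equiv_queries_def)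
        (simp add: finished_def init_state_def)
  next
    case (member h w)
    let ?\<sigma> = "state_after h"
    have IH: "invariant ?\<sigma> (member_queries h) (cex_count h)"
      "equiv_queries h = cex_count h + of_bool (finished ?\<sigma>)" using member by auto
    have q: "\<not> finished ?\<sigma>" "querying n ?\<sigma>" "w = map (map_prod id \<nu>) (relabel \<beta> (dat (ask n ?\<sigma>)))"
      using member.hyps(2) by (auto simp: learner_def act_def split: if_splits)
    have "invariant (on_truth n ?\<sigma> (w \<in> L)) (Suc (member_queries h)) (cex_count h)"
      using member_answer[OF letters_ok_state_after] q(3) by (intro invariant_truth IH q) simp
    moreover have "finished (on_truth n ?\<sigma> (w \<in> L)) = finished ?\<sigma>" by (rule finished_on_truth)
    ultimately show ?case
      using IH(2) by (simp add: state_after_snoc upd_def member_queries_def cex_count_def equiv_queries_def)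
  next
    case (equiv_yes h H)
    then have IH: "invariant (state_after h) (member_queries h) (cex_count h)"
      "equiv_queries h = cex_count h + of_bool (finished (state_after h))" by auto
    obtain l S E T bs where \<sigma>: "state_after h = (l, S, E, T, bs, False)"
      and q: "\<not> querying n (state_after h)" and H: "H = hyp (l, S, E, T, bs, False)" and S: "S \<noteq> []"
      and nf: "\<And>u. u \<in> hyp_lang n l S E T \<Longrightarrow> nf u"
      using equiv_state[OF equiv_yes.hyps(2) IH(1)] by blast
    have "hyp_lang n l S E T = K"
      using hyp_lang_K_iff[OF S nf, where bs = bs and don = False] equiv_yes.hyps(3) H by metis
    then have "invariant (on_yes (state_after h)) (member_queries h) (cex_count h)"
      using IH(1) q by (intro invariant_yes[of _ _ _ l S E T bs]) (simp_all add: \<sigma>)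
    then show ?case
      using IH(2)
      by (simp add: state_after_snoc upd_def member_queries_def cex_count_def equiv_queries_def)
        (simp add: \<sigma> on_yes_def finished_def case_prod_beta)
  next
    case (equiv_no h H w)
    then have IH: "invariant (state_after h) (member_queries h) (cex_count h)"
      "equiv_queries h = cex_count h + of_bool (finished (state_after h))" by auto
    obtain l S E T bs where \<sigma>: "state_after h = (l, S, E, T, bs, False)"
      and q: "\<not> querying n (state_after h)" and H: "H = hyp (l, S, E, T, bs, False)" and S: "S \<noteq> []"
      and nf: "\<And>u. u \<in> hyp_lang n l S E T \<Longrightarrow> nf u"
      using equiv_state[OF equiv_no.hyps(2) IH(1)] by blast
    let ?v = "normal_form n (relabel \<alpha> (pattern w))"
    note c = cex_answer[OF S nf equiv_no.hyps(3)[unfolded H]]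
    have "length ?v \<le> 2 ^ Q" using c(2) equiv_no.prems by simp
    then have "invariant (on_cex (state_after h) ?v) (member_queries h) (Suc (cex_count h))"
      using IH(1) q c(1) by (intro invariant_cex[of _ _ _ l S E T bs]) (simp_all add: \<sigma>)
    moreover have "finished (on_cex (state_after h) ?v) = finished (state_after h)"
      by (simp add: \<sigma> on_cex_def finished_def case_prod_beta)
    ultimately show ?case
      using IH(2) by (simp add: state_after_snoc upd_def member_queries_def cex_count_def equiv_queries_def)
  qed
qed

text \<open>Follows from \<open>N \<le> 2 ^ N\<close> and
  \<open>4 ^ k + 1 \<le> 2 ^ (2 * k + 1)\<close>.\<close>

lemma search_bound:
  assumes "N + 2 * k + 1 \<le> Q" shows "N * Suc (4 ^ k) \<le> 2 ^ Q"
proof -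
  have "Suc (4 ^ k) \<le> 2 * (2 ^ 2) ^ k" using one_le_power[of "4 :: nat" k] by simp
  also have "\<dots> = 2 ^ (2 * k + 1)" by (simp add: power_mult)
  finally have "N * Suc (4 ^ k) \<le> 2 ^ N * 2 ^ (2 * k + 1)"
    by (intro mult_mono) (simp_all add: less_imp_le)
  also have "\<dots> = 2 ^ (N + 2 * k + 1)" by (simp only: power_add mult.assoc)
  also have "\<dots> \<le> 2 ^ Q" using assms by (intro power_increasing) simp_all
  finally show ?thesis .
qed

lemma dialogue_bounds:
  assumes "dialogue \<Sigma> D L learner h" "\<And>w. Counterexample w \<in> set h \<Longrightarrow> length w \<le> 2 ^ q"
  shows "member_queries h \<le> 1 + 4 * n * k * N ^ 2 + N * (q + N + 2 * k + 3)"
    "k = 0 \<Longrightarrow> member_queries h = 0" "cex_count h \<le> N + k + 1" "equiv_queries h \<le> N + k + 2"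
proof -
  \<comment> \<open>The sum replaces a maximum of the bounds for counterexamples and for
    \<open>bad\<close>. For positive \<open>k\<close>, the additional
    \<open>N * (N + 2 * k + 1)\<close> queries are absorbed by a multiple of
    \<open>k * n * N ^ 2\<close>.\<close>
  define Q where "Q = q + (N + 2 * k + 1)"
  have Q: "N * Suc (4 ^ k) \<le> 2 ^ Q"
    by (rule search_bound) (simp add: Q_def)
  have "(2 :: nat) ^ q \<le> 2 ^ Q" by (intro power_increasing) (simp_all add: Q_def)
  then have *: "length w \<le> 2 ^ Q" if "Counterexample w \<in> set h" for w
    using assms(2)[OF that] by (rule order_trans[rotated])
  interpret learning_target n k N Q K by (rule learning_target[OF Q])
  obtain l S E T bs don where \<sigma>: "state_after h = (l, S, E, T, bs, don)" by (metis prod.exhaust)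
  have inv: "invariant (l, S, E, T, bs, don) (member_queries h) (cex_count h)"
    and eq: "equiv_queries h = cex_count h + of_bool (finished (state_after h))"
    using dialogue_invariant[OF assms(1) Q *] by (simp_all add: \<sigma>)
  show "k = 0 \<Longrightarrow> member_queries h = 0" by (rule invariant_bounds(3)[OF inv])
  show "cex_count h \<le> N + k + 1" by (rule invariant_bounds(1)[OF inv])
  then show "equiv_queries h \<le> N + k + 2" using eq by (simp add: of_bool_def)
  show "member_queries h \<le> 1 + 4 * n * k * N ^ 2 + N * (q + N + 2 * k + 3)"
    using invariant_bounds(2)[OF inv] by (simp add: Q_def algebra_simps power2_eq_square)
qed

lemma output_correct:
  assumes "dialogue \<Sigma> D L learner h" "learner h = Output H"
  shows "data_lang \<Sigma> D H = L" "canonical \<Sigma> L H"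
proof -
  \<comment> \<open>Any sufficiently large \<open>Q\<close> will do here, since no queries are
    counted.\<close>
  define Q where "Q = max_counterexample h + (N + 2 * k + 1)"
  have Q: "N * Suc (4 ^ k) \<le> 2 ^ Q"
    by (rule search_bound) (simp add: Q_def)
  have *: "length w \<le> 2 ^ Q" if "Counterexample w \<in> set h" for w
  proof -
    have "length w \<le> Q" using length_le_max_counterexample[OF that] by (simp add: Q_def)
    also have "Q \<le> 2 ^ Q" by (simp add: less_imp_le)
    finally show ?thesis .
  qed
  interpret learning_target n k N Q K by (rule learning_target[OF Q])
  obtain l S E T u lo hi don where \<sigma>: "state_after h = (l, S, E, T, (u, lo, hi), don)" by (metis prod.exhaust)
  have inv: "invariant (l, S, E, T, (u, lo, hi), don) (member_queries h) (cex_count h)"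
    using dialogue_invariant[OF assms(1) Q *] by (simp add: \<sigma>)
  have H: "H = hyp (l, S, E, T, (u, lo, hi), don)" and don: "finished (state_after h)"
    using assms(2) by (auto simp: learner_def act_def \<sigma> split: if_splits)
  then have KH: "hyp_lang n l S E T = K" using inv by (simp add: invariant_def \<sigma> finished_def)
  have S: "S \<noteq> []" using letters_ok_state_after[of h] by (simp add: \<sigma> letters_ok_def)
  have nf: "nf v" if "v \<in> hyp_lang n l S E T" for v using that K_nf[of v] by (simp add: KH)
  have s: "snf ` data_lang \<Sigma> D H = sym_lang H" "sym_lang H = snf ` L"
    using hyp_lang_K_iff[OF S, of l E T "(u, lo, hi)" don] nf KH unfolding H by blast+
  then show "data_lang \<Sigma> D H = L"
    using data_lang_iff_snf[of _ \<Sigma> D H] data_lang_iff_snf[of _ \<Sigma> D A] by (intro set_eqI) metis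
  have dfa: "complete_dfa \<Sigma> l H" unfolding H by (rule complete_dfa_hyp[OF S])
  have "snf ` L \<subseteq> lists (\<Sigma> \<times> Gam l)"
    unfolding s(2)[symmetric] H sym_lang_hyp[OF S] by blast
  \<comment> \<open>The register number \<open>l\<close> of the output is at least \<open>k\<close>
    by leastness and at most \<open>k\<close> by the invariant; the number of states equals
    \<open>N\<close> for the same two reasons.\<close>
  then have "k \<le> l" unfolding snf_registers_def by (rule Least_le)
  then have l: "l = k" using invariant_bounds(5)[OF inv] by simp
  have "card (states H) = length S" by (simp add: H hyp_def dfa_of_def)
  then have "card (states H) = N"
    using invariant_bounds(4)[OF inv] N_le[OF dfa[unfolded l] s(2)] by simp
  then show "canonical \<Sigma> L H" using dfa s(2) by (simp add: canonical_def l)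
qed

lemma no_infinite_dialogue: "\<nexists>f :: nat \<Rightarrow> ('a, 'd) answer. \<forall>m. dialogue \<Sigma> D L learner (map f [0..<m])"
proof
  assume "\<exists>f :: nat \<Rightarrow> ('a, 'd) answer. \<forall>m. dialogue \<Sigma> D L learner (map f [0..<m])"
  then obtain f :: "nat \<Rightarrow> ('a, 'd) answer" where f: "\<And>m. dialogue \<Sigma> D L learner (map f [0..<m])" by blast
  define I where "I = {i. \<exists>w. f i = Counterexample w}"
  \<comment> \<open>The bound \<open>N + k + 1\<close> does not involve \<open>q\<close>, so the
    length bound for counterexamples may be chosen anew for each prefix.\<close>
  have count: "card (I \<inter> {..<m}) \<le> N + k + 1" for m
  proof -
    let ?h = "map f [0..<m]"
    have "length w \<le> 2 ^ max_counterexample ?h" if "Counterexample w \<in> set ?h" for w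
      using length_le_max_counterexample[OF that] less_exp[of "max_counterexample ?h"] by linarith
    from dialogue_bounds(3)[OF f this] have "cex_count (map f [0..<m]) \<le> N + k + 1" .
    also have "cex_count (map f [0..<m]) = length (filter (\<lambda>i. i \<in> I) [0..<m])"
      by (simp add: cex_count_def I_def filter_map o_def)
    also have "\<dots> = card (I \<inter> {..<m})"
      by (simp add: distinct_length_filter lessThan_atLeast0)
    finally show ?thesis .
  qed
  have "finite I"
  proof (rule ccontr)
    assume "infinite I"
    then obtain J where J: "finite J" "card J = N + k + 2" "J \<subseteq> I"
      using infinite_arbitrarily_large by blast
    then obtain m where "J \<subseteq> {..<m}" using finite_nat_set_iff_bounded[of J] by blast
    then have "card J \<le> card (I \<inter> {..<m})" using J by (intro card_mono) auto
    then show False using count[of m] J by simp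
  qed
  \<comment> \<open>As \<open>I\<close> is finite, a single \<open>q\<close> serves all prefixes of
    the dialogue, and \<open>X\<close> bounds their length.\<close>
  define q where "q = (\<Sum>i\<in>I. case f i of Counterexample w \<Rightarrow> length w | _ \<Rightarrow> 0)"
  have q: "length w \<le> 2 ^ q" if w: "Counterexample w \<in> set (map f [0..<m])" for w m
  proof -
    obtain i where i: "f i = Counterexample w" using w by force
    then have "i \<in> I" by (auto simp: I_def)
    then have "(case f i of Counterexample w \<Rightarrow> length w | _ \<Rightarrow> 0) \<le> q"
      unfolding q_def using \<open>finite I\<close> by (intro member_le_sum) auto
    also have "q \<le> 2 ^ q" by (simp add: less_imp_le)
    finally show ?thesis using i by simp
  qed
  define X where "X = 1 + 4 * n * k * N ^ 2 + N * (q + N + 2 * k + 3) + (N + k + 2)"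
  have length_eq: "length h = member_queries h + equiv_queries h" for h :: "('a, 'd) answer list"
  proof (induction h)
    case (Cons x h) then show ?case by (cases x) (simp_all add: member_queries_def equiv_queries_def)
  qed (simp add: member_queries_def equiv_queries_def)
  let ?h = "map f [0..<Suc X]"
  have "member_queries ?h \<le> 1 + 4 * n * k * N ^ 2 + N * (q + N + 2 * k + 3)"
    by (rule dialogue_bounds(1)[OF f q])
  moreover have "equiv_queries ?h \<le> N + k + 2" by (rule dialogue_bounds(4)[OF f q])
  ultimately have "length ?h \<le> X" unfolding length_eq X_def by (rule add_mono)
  then show False unfolding length_map length_upt by simp
qed

text \<open>For \<open>k \<ge> 1\<close>, each of 1, \<open>N\<close>, \<open>N ^ 2\<close> and
  \<open>k * N\<close> is at most \<open>k * n * N ^ 2\<close>, and rounding the logarithm up costs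
  another \<open>N\<close>; the coefficients add up to 1 + 4 + 1 + 2 + 4 = 12. For
  \<open>k = 0\<close> the right-hand side may vanish, and the number of membership queries is
  zero.\<close>

lemma query_bounds:
  assumes "dialogue \<Sigma> D L learner h"
  shows "real (member_queries h) \<le> 12 * (real k * real n * real N ^ 2
      + real N * log 2 (real (max 1 (max_counterexample h))))"
    "real (equiv_queries h) \<le> 12 * real N"
proof -
  let ?M = "max 1 (max_counterexample h)"
  define q where "q = nat \<lceil>log 2 (real ?M)\<rceil>"
  have M: "1 \<le> real ?M" by simp
  have log0: "0 \<le> log 2 (real ?M)" using M by simp
  have ql: "real q \<le> log 2 (real ?M) + 1" and lq: "log 2 (real ?M) \<le> real q"
    using log0 unfolding q_def by linarith+
  have "real ?M = 2 powr log 2 (real ?M)" using M by simp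
  also have "\<dots> \<le> 2 powr real q" using lq by (intro powr_mono) simp_all
  also have "\<dots> = real (2 ^ q)" by (simp add: powr_realpow)
  finally have Mq: "?M \<le> 2 ^ q" by (simp only: of_nat_le_iff)
  have "length w \<le> 2 ^ q" if "Counterexample w \<in> set h" for w
    using length_le_max_counterexample[OF that] Mq by simp
  note b = dialogue_bounds[OF assms this]
  have kN: "1 \<le> real N" "real k \<le> real N" using N_pos k_le_N by simp_all
  have "real (equiv_queries h) \<le> real (N + k + 2)" using b(4) by (simp only: of_nat_le_iff)
  then show "real (equiv_queries h) \<le> 12 * real N" using kN by simp
  show "real (member_queries h) \<le> 12 * (real k * real n * real N ^ 2 + real N * log 2 (real ?M))"
  proof (cases "k = 0")
    case True
    then show ?thesis using b(2) log0 by simp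
  next
    case False
    let ?P = "real k * real n * real N ^ 2"
    have k1: "1 \<le> real k" and n1: "1 \<le> real n" using False n_pos by simp_all
    have kn: "real k * 1 \<le> real k * real n" using n1 k1 by (intro mult_left_mono) simp_all
    then have kn1: "1 \<le> real k * real n" using k1 by linarith
    have N2: "real N \<le> real N ^ 2" using kN(1) by (simp add: power2_eq_square mult_le_cancel_left1)
    have P1: "real N ^ 2 \<le> ?P" using kn1 by (simp add: mult_le_cancel_right1)
    have P2: "real k * real N \<le> ?P"
    proof -
      have "real k * real N \<le> (real k * real n) * real N ^ 2"
        using kn N2 by (intro mult_mono) simp_all
      then show ?thesis .
    qed
    have "real (member_queries h) \<le> real (1 + 4 * n * k * N ^ 2 + N * (q + N + 2 * k + 3))"
      using b(1) by (simp only: of_nat_le_iff)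
    also have "\<dots> = 1 + 4 * ?P + real N * real q + real N ^ 2 + 2 * (real k * real N) + 3 * real N"
      by (simp add: algebra_simps power2_eq_square)
    also have "real N * real q \<le> real N * log 2 (real ?M) + real N"
      using mult_left_mono[OF ql, of "real N"] by (simp add: algebra_simps)
    finally have "real (member_queries h) \<le> 12 * ?P + real N * log 2 (real ?M)"
      using P1 P2 N2 kN(1) by linarith
    also have "real N * log 2 (real ?M) \<le> 12 * (real N * log 2 (real ?M))" using log0 by simp
    finally show ?thesis by (simp add: algebra_simps)
  qed
qed

end

end

theorem theorem5p2:
  shows "\<exists>C :: real. \<forall>(\<Sigma> :: 'a set) (D :: 'd set).
    finite \<Sigma> \<and> \<Sigma> \<noteq> {} \<and> infinite D \<longrightarrow>
    (\<exists>\<Lambda> :: ('a, 'd) learner. algorithm \<Sigma> D \<Lambda> \<and>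
      (\<forall>A :: ('s, 'a) session_automaton. session_automaton \<Sigma> A \<longrightarrow>
        (let L = data_lang \<Sigma> D A;
             k = snf_registers \<Sigma> L;
             N = canonical_size \<Sigma> L
         in
           (\<forall>h. dialogue \<Sigma> D L \<Lambda> h \<longrightarrow> admissible \<Sigma> D (\<Lambda> h)) \<and>
           (\<nexists>f :: nat \<Rightarrow> ('a, 'd) answer. \<forall>n. dialogue \<Sigma> D L \<Lambda> (map f [0..<n])) \<and>
           (\<forall>h H. dialogue \<Sigma> D L \<Lambda> h \<and> \<Lambda> h = Output H \<longrightarrow>
              data_lang \<Sigma> D H = L \<and> canonical \<Sigma> L H \<and>
              (let M = max_counterexample h
               in real (member_queries h)
                    \<le> C * (real k * real (card \<Sigma>) * real N ^ 2
                            + real N * log 2 (real (max 1 M)))) \<and>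
              real (equiv_queries h) \<le> C * real N))))"
  apply (intro exI[of _ 12] allI impI)
  subgoal premises asm for \<Sigma> D
  proof -
    obtain \<alpha> where \<alpha>: "bij_betw \<alpha> \<Sigma> {..<card \<Sigma>}"
      using ex_bij_betw_finite_nat[of \<Sigma>] asm by (auto simp: lessThan_atLeast0)
    obtain \<nu> :: "nat \<Rightarrow> 'd" where "inj \<nu>" "range \<nu> \<subseteq> D"
      using infinite_countable_subset[of D] asm by blast
    then interpret session_learner \<Sigma> D \<alpha> \<nu> using asm \<alpha> by unfold_locales auto
    show ?thesis
      unfolding Let_def
      using algorithm_learner admissible_learner no_infinite_dialogue output_correct query_bounds
      by (intro exI[of _ learner] conjI allI impI) blast+
  qed
  done

end
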